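(* The List Coloring Reconfiguration problem is fixed-parameter tractable when parameterized by $k+\mathsf{mw}$, where $k$ is an upper bound on the size of the color set and $\mathsf{mw}$ is an upper bound on the modular-width of the input graph. That is, there is an algorithm deciding every instance $(G,L,f_0,f_t)$ in time $g(k,\mathsf{mw})\cdot |I|^{O(1)}$ for some computable function $g$, where $|I|$ is the instance size.
   Context: All graphs are finite and simple. Let $C$ be a color set with $|C|\le k$. For a graph $G=(V,E)$ and a list assignment $L\colon V\to 2^C$, an $L$-coloring of $G$ is a map $f\colon V\to C$ with $f(v)\in L(v)$ for all $v\in V$ and $f(v)\neq f(w)$ for every edge $vw\in E$. Two $L$-colorings $f,f'$ are adjacent if they differ on exactly one vertex. A reconfiguration sequence between $f_0$ and $f_\ell$ is a sequence $f_0,f_1,\dots,f_\ell$ of $L$-colorings with $f_{i-1},f_i$ adjacent for all $i$. List Coloring Reconfiguration: given $(G,L,f_0,f_t)$ with $f_0,f_t$ $L$-colorings, decide whether a reconfiguration sequence between $f_0$ and $f_t$ exists. Modular-width: A module of $G$ is a set $M\subseteq V$ such that $N(v)\setminus M=N(w)\setminus M$ for all $v,w\in M$; the modules $\emptyset$, $V$ and singletons are trivial, and $G$ is prime if all its modules are trivial. For a graph $Q$ on nodes $u_1,\dots,u_p$ ($p\ge2$) and vertex-disjoint graphs $G_1,\dots,G_p$, the $Q$-substitution is the disjoint union of the $G_i$ plus all edges $vw$ with $v\in V(G_i)$, $w\in V(G_j)$, $u_iu_j\in E(Q)$. A substitution tree is a rooted tree in which every non-leaf node $x$ carries a quotient graph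 $Q_x$ and has $|V(Q_x)|$ children; its corresponding graph is defined recursively (a leaf is a single vertex, an internal node gives the $Q_x$-substitution of its children's graphs). The modular decomposition tree (MD-tree) of $G$ is the unique substitution tree for $G$ in which every internal node is series ($Q_x$ complete), parallel ($Q_x$ edgeless) or prime ($Q_x$ a prime graph with at least four vertices), no two series nodes are adjacent and no two parallel nodes are adjacent. The modular-width of $G$ is the maximum number of children of a prime node in its MD-tree (taken to be $0$ if there is no prime node). *)

theory Defs
  imports Main "HOL-Library.FuncSet"
begin

section \<open>Finite simple graphs and modules\<close>

record 'a graph =
  verts :: "'a set"
  edges :: "'a set set"

definition simple_graph :: "'a graph \<Rightarrow> bool" where
  "simple_graph G \<longleftrightarrow> finite (verts G) \<and> (\<forall>e\<in>edges G. e \<subseteq> verts G \<and> card e = 2)"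

definition neighbours :: "'a graph \<Rightarrow> 'a \<Rightarrow> 'a set" where
  "neighbours G v = {w. {v, w} \<in> edges G}"

definition is_module :: "'a graph \<Rightarrow> 'a set \<Rightarrow> bool" where
  "is_module G M \<longleftrightarrow> M \<subseteq> verts G \<and>
     (\<forall>v\<in>M. \<forall>w\<in>M. neighbours G v - M = neighbours G w - M)"

definition trivial_module :: "'a graph \<Rightarrow> 'a set \<Rightarrow> bool" where
  "trivial_module G M \<longleftrightarrow> M = {} \<or> M = verts G \<or> (\<exists>v. M = {v})"

definition prime_graph :: "'a graph \<Rightarrow> bool" where
  "prime_graph G \<longleftrightarrow> (\<forall>M. is_module G M \<longrightarrow> trivial_module G M)"

definition complete_graph :: "'a graph \<Rightarrow> bool" where
  "complete_graph G \<longleftrightarrow> (\<forall>u\<in>verts G. \<forall>v\<in>verts G. u \<noteq> v \<longrightarrow> {u, v} \<in> edges G)"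

definition edgeless_graph :: "'a graph \<Rightarrow> bool" where
  "edgeless_graph G \<longleftrightarrow> edges G = {}"


section \<open>Substitution trees and modular-width\<close>

definition substitution :: "'b graph \<Rightarrow> ('b \<Rightarrow> 'a graph) \<Rightarrow> 'a graph" where
  "substitution Q H =
     \<lparr>verts = (\<Union>u\<in>verts Q. verts (H u)),
      edges = (\<Union>u\<in>verts Q. edges (H u)) \<union>
        {{v, w} | v w. \<exists>i\<in>verts Q. \<exists>j\<in>verts Q.
            {i, j} \<in> edges Q \<and> v \<in> verts (H i) \<and> w \<in> verts (H j)}\<rparr>"

text \<open>The quotient graph of an internal node with \<open>p\<close> children has the nodes \<open>0, \<dots>, p - 1\<close>;
  node \<open>i\<close> stands for the \<open>i\<close>-th child.\<close>

datatype 'a subst_tree = Leaf 'a | Node "nat graph" "'a subst_tree list"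

fun tree_graph :: "'a subst_tree \<Rightarrow> 'a graph" where
  "tree_graph (Leaf v) = \<lparr>verts = {v}, edges = {}\<rparr>"
| "tree_graph (Node Q ts) = substitution Q (\<lambda>i. map tree_graph ts ! i)"

fun substitution_tree :: "'a subst_tree \<Rightarrow> bool" where
  "substitution_tree (Leaf v) \<longleftrightarrow> True"
| "substitution_tree (Node Q ts) \<longleftrightarrow>
     2 \<le> length ts \<and> simple_graph Q \<and> verts Q = {..<length ts} \<and>
     (\<forall>i<length ts. \<forall>j<length ts. i \<noteq> j \<longrightarrow>
        verts (tree_graph (ts ! i)) \<inter> verts (tree_graph (ts ! j)) = {}) \<and>
     (\<forall>t\<in>set ts. substitution_tree t)"

fun series_node :: "'a subst_tree \<Rightarrow> bool" where
  "series_node (Leaf v) \<longleftrightarrow> False"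
| "series_node (Node Q ts) \<longleftrightarrow> complete_graph Q"

fun parallel_node :: "'a subst_tree \<Rightarrow> bool" where
  "parallel_node (Leaf v) \<longleftrightarrow> False"
| "parallel_node (Node Q ts) \<longleftrightarrow> edgeless_graph Q"

fun prime_node :: "'a subst_tree \<Rightarrow> bool" where
  "prime_node (Leaf v) \<longleftrightarrow> False"
| "prime_node (Node Q ts) \<longleftrightarrow> prime_graph Q \<and> 4 \<le> card (verts Q)"

fun md_labelled :: "'a subst_tree \<Rightarrow> bool" where
  "md_labelled (Leaf v) \<longleftrightarrow> True"
| "md_labelled (Node Q ts) \<longleftrightarrow>
     (series_node (Node Q ts) \<or> parallel_node (Node Q ts) \<or> prime_node (Node Q ts)) \<and>
     (series_node (Node Q ts) \<longrightarrow> (\<forall>t\<in>set ts. \<not> series_node t)) \<and>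
     (parallel_node (Node Q ts) \<longrightarrow> (\<forall>t\<in>set ts. \<not> parallel_node t)) \<and>
     (\<forall>t\<in>set ts. md_labelled t)"

definition md_tree :: "'a graph \<Rightarrow> 'a subst_tree \<Rightarrow> bool" where
  "md_tree G t \<longleftrightarrow> substitution_tree t \<and> md_labelled t \<and> tree_graph t = G"

fun prime_arities :: "'a subst_tree \<Rightarrow> nat set" where
  "prime_arities (Leaf v) = {}"
| "prime_arities (Node Q ts) =
     (if prime_node (Node Q ts) then {length ts} else {}) \<union> (\<Union>t\<in>set ts. prime_arities t)"

text \<open>A nonempty finite simple graph has an MD-tree, unique up to the order of the children, so the
  width does not depend on the choice made by \<open>SOME\<close>. The graph without vertices has no MD-tree;
  its modular-width is taken to be \<open>0\<close>.\<close>

definition modular_width :: "'a graph \<Rightarrow> nat" where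
  "modular_width G =
     (if verts G = {} then 0 else Max (insert 0 (prime_arities (SOME t. md_tree G t))))"


section \<open>List coloring reconfiguration\<close>

text \<open>Colorings are maps with domain \<open>verts G\<close>, represented as extensional functions.\<close>

definition list_coloring :: "'a graph \<Rightarrow> ('a \<Rightarrow> 'c set) \<Rightarrow> ('a \<Rightarrow> 'c) \<Rightarrow> bool" where
  "list_coloring G L f \<longleftrightarrow>
     f \<in> (\<Pi>\<^sub>E v\<in>verts G. L v) \<and> (\<forall>v w. {v, w} \<in> edges G \<longrightarrow> f v \<noteq> f w)"

definition adjacent_colorings :: "'a graph \<Rightarrow> ('a \<Rightarrow> 'c) \<Rightarrow> ('a \<Rightarrow> 'c) \<Rightarrow> bool" where
  "adjacent_colorings G f f' \<longleftrightarrow> (\<exists>!v. v \<in> verts G \<and> f v \<noteq> f' v)"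

definition reconfigurable ::
  "'a graph \<Rightarrow> ('a \<Rightarrow> 'c set) \<Rightarrow> ('a \<Rightarrow> 'c) \<Rightarrow> ('a \<Rightarrow> 'c) \<Rightarrow> bool" where
  "reconfigurable G L f\<^sub>0 f\<^sub>t \<longleftrightarrow>
     (\<exists>(l::nat) s. s 0 = f\<^sub>0 \<and> s l = f\<^sub>t \<and> (\<forall>i\<le>l. list_coloring G L (s i)) \<and>
        (\<forall>i<l. adjacent_colorings G (s i) (s (Suc i))))"


section \<open>Algorithms and running time\<close>

text \<open>Algorithms are programs of a first-order functional language over binary trees (pure LISP; it
  is a functional variant of the tree-manipulating languages of N. D. Jones, ``Computability and
  Complexity from a Programming Perspective''). A program is a list of function bodies, its entry
  point being the body number \<open>0\<close>. Variables are positions in the list of arguments of the current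
  call. The last argument of \<open>eval\<close> is the number of evaluation steps. Atoms are the only values
  that can be tested, and a step creates at most one cell, which can share its components with
  others. So \<open>n\<close> steps can be simulated by a Turing machine in time polynomial in \<open>n\<close> and the input
  length, and conversely a Turing machine is simulated with constant overhead per step.\<close>

datatype val = Atom | Cell val val

datatype expr =
    EVar nat
  | EAtom
  | ECell expr expr
  | EFst expr
  | ESnd expr
  | EIf expr expr expr
  | ECall nat "expr list"

type_synonym program = "expr list"

fun cell_fst :: "val \<Rightarrow> val" where
  "cell_fst Atom = Atom"
| "cell_fst (Cell x y) = x"

fun cell_snd :: "val \<Rightarrow> val" where
  "cell_snd Atom = Atom"
| "cell_snd (Cell x y) = y"

inductive eval :: "program \<Rightarrow> val list \<Rightarrow> expr \<Rightarrow> val \<Rightarrow> nat \<Rightarrow> bool"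
  and evals :: "program \<Rightarrow> val list \<Rightarrow> expr list \<Rightarrow> val list \<Rightarrow> nat \<Rightarrow> bool"
  for P :: program where
  Var: "i < length env \<Longrightarrow> eval P env (EVar i) (env ! i) 1"
| Atom: "eval P env EAtom Atom 1"
| Cell: "eval P env a x m \<Longrightarrow> eval P env b y n \<Longrightarrow> eval P env (ECell a b) (Cell x y) (m + n + 1)"
| Fst: "eval P env a x m \<Longrightarrow> eval P env (EFst a) (cell_fst x) (m + 1)"
| Snd: "eval P env a x m \<Longrightarrow> eval P env (ESnd a) (cell_snd x) (m + 1)"
| If_Cell: "eval P env a (Cell x y) m \<Longrightarrow> eval P env b z n \<Longrightarrow> eval P env (EIf a b c) z (m + n + 1)"
| If_Atom: "eval P env a Atom m \<Longrightarrow> eval P env c z n \<Longrightarrow> eval P env (EIf a b c) z (m + n + 1)"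
| Call: "j < length P \<Longrightarrow> evals P env as xs m \<Longrightarrow> eval P xs (P ! j) z n \<Longrightarrow>
    eval P env (ECall j as) z (m + n + 1)"
| Args_Nil: "evals P env [] [] 0"
| Args_Cons: "eval P env a x m \<Longrightarrow> evals P env as xs n \<Longrightarrow> evals P env (a # as) (x # xs) (m + n)"

definition runs :: "program \<Rightarrow> val list \<Rightarrow> val \<Rightarrow> nat \<Rightarrow> bool" where
  "runs P xs y t \<longleftrightarrow> P \<noteq> [] \<and> eval P xs (P ! 0) y t"

inductive_cases eval_elims:
  "eval P env (EVar i) x n"
  "eval P env EAtom x n"
  "eval P env (ECell a b) x n"
  "eval P env (EFst a) x n"
  "eval P env (ESnd a) x n"
  "eval P env (EIf a b c) x n"
  "eval P env (ECall j as) x n"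

inductive_cases evals_elims:
  "evals P env [] xs n"
  "evals P env (a # as) xs n"

lemma eval_deterministic:
  "eval P env e x m \<Longrightarrow> eval P env e x' m' \<Longrightarrow> x' = x \<and> m' = m"
  "evals P env es xs n \<Longrightarrow> evals P env es xs' n' \<Longrightarrow> xs' = xs \<and> n' = n"
proof (induction arbitrary: x' m' and xs' n' rule: eval_evals.inducts)
  case (Var i env)
  then show ?case by (auto elim: eval_elims(1))
next
  case (Atom env)
  then show ?case by (auto elim: eval_elims(2))
next
  case (Cell env a x m b y n)
  from Cell.prems show ?case
    by (rule eval_elims(3)) (auto dest: Cell.IH(2,4))
next
  case (Fst env a x m)
  from Fst.prems show ?case
    by (rule eval_elims(4)) (auto dest: Fst.IH(2))
next
  case (Snd env a x m)
  from Snd.prems show ?case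
    by (rule eval_elims(5)) (auto dest: Snd.IH(2))
next
  case (If_Cell env a x y m b z n c)
  from If_Cell.prems show ?case
    by (rule eval_elims(6)) (auto dest: If_Cell.IH(2,4))
next
  case (If_Atom env a m c z n b)
  from If_Atom.prems show ?case
    by (rule eval_elims(6)) (auto dest: If_Atom.IH(2,4))
next
  case (Call j env as xs m z n)
  from Call.prems obtain xs' k l where
    "evals P env as xs' k" "eval P xs' (P ! j) x' l" "m' = k + l + 1"
    by (auto elim: eval_elims(7))
  with Call.IH show ?case by blast
next
  case (Args_Nil env)
  then show ?case by (auto elim: evals_elims(1))
next
  case (Args_Cons env a x m as xs n)
  from Args_Cons.prems show ?case
    by (rule evals_elims(2)) (auto dest: Args_Cons.IH(2,4))
qed

subsection \<open>Encodings\<close>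

fun enc_bool :: "bool \<Rightarrow> val" where
  "enc_bool False = Atom"
| "enc_bool True = Cell Atom Atom"

text \<open>Binary representation, least significant bit first.\<close>

fun enc_nat :: "nat \<Rightarrow> val" where
  "enc_nat n = (if n = 0 then Atom else Cell (enc_bool (odd n)) (enc_nat (n div 2)))"

declare enc_nat.simps [simp del]

fun enc_list :: "('a \<Rightarrow> val) \<Rightarrow> 'a list \<Rightarrow> val" where
  "enc_list enc [] = Atom"
| "enc_list enc (x # xs) = Cell (enc x) (enc_list enc xs)"

definition enc_nat_set :: "nat set \<Rightarrow> val" where
  "enc_nat_set A = enc_list enc_nat (sorted_list_of_set A)"

definition enc_instance ::
  "nat graph \<Rightarrow> (nat \<Rightarrow> nat set) \<Rightarrow> (nat \<Rightarrow> nat) \<Rightarrow> (nat \<Rightarrow> nat) \<Rightarrow> val" where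
  "enc_instance G L f\<^sub>0 f\<^sub>t =
     enc_list
       (\<lambda>v. Cell (enc_nat v) (Cell (enc_nat_set (neighbours G v))
              (Cell (enc_nat_set (L v)) (Cell (enc_nat (f\<^sub>0 v)) (enc_nat (f\<^sub>t v))))))
       (sorted_list_of_set (verts G))"

fun val_size :: "val \<Rightarrow> nat" where
  "val_size Atom = 1"
| "val_size (Cell x y) = val_size x + val_size y + 1"

definition computable2 :: "(nat \<Rightarrow> nat \<Rightarrow> nat) \<Rightarrow> bool" where
  "computable2 g \<longleftrightarrow>
     (\<exists>P. \<forall>a b. \<exists>t. runs P [enc_nat a, enc_nat b] (enc_nat (g a b)) t)"

end

theory Submission
  imports Defs
begin

text \<open>Two disjoint vertex sets with the same labels (list, start color, target color), the same
  inner edges and the same outer neighbours are twins; one of them can be deleted, because it can be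
  recolored by imitating the other one. To find twins in polynomial time no modular decomposition is
  computed: if \<open>u\<close> and \<open>w\<close> lie in different components of a module, then the component of \<open>u\<close> in this
  module is the component of \<open>u\<close> in the graph without the neighbours of \<open>w\<close>. So all pairs \<open>u\<close>, \<open>w\<close>
  are tried until no twins are left.

  The MD-tree only serves to bound the size of the remaining graph. By induction over the tree, with
  the number \<open>c\<close> of colors that the start coloring uses on the node: at a series or prime node there
  are at most \<open>k + mw\<close> children and each of them uses at most \<open>c - 1\<close> colors; hence the components of
  a node have bounded size, so there are boundedly many codes of components, and components with the
  same code would be twins. The remaining graph is solved by searching all its colorings.

  Programs are written in a small language whose only recursion is a fold over lists, so that they
  terminate and their cost is a function which can be bounded compositionally.\<close>

section \<open>Programs with structural recursion\<close>

text \<open>Running time counts evaluation steps of a concrete program, so every step must be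
  written down and its cost bounded; this favours trying all vertex pairs over computing a
  decomposition. Soundness and size are separated: a deletion is justified by comparing two codes
  alone, and modules enter only when the number of remaining vertices is bounded. The tree stays
  that of the input graph and is intersected with the remaining vertices, so no reduced graph needs
  a tree of its own. Colors get lost from a series or prime node to a child because a vertex of a
  neighbouring child has a color that the child cannot use. A parallel node may have unboundedly
  many children without losing a color, which is why components are bounded and compared. The search
  handles exponentially many colorings, so its cost is polynomial only in the size of the table of
  assignments; the bound on the kernel is inserted at the end. The parameter function is a power of
  2 because its binary form is easy to write once the exponent is known in unary.\<close>

datatype tm =
    TVar nat
  | TAtom
  | TCell tm tm
  | TFst tm
  | TSnd tm
  | TIf tm tm tm
  | TEq tm tm
  | TApp tm "tm list"
  | TFold tm tm tm

fun fold_val :: "(val \<Rightarrow> val \<Rightarrow> val) \<Rightarrow> val \<Rightarrow> val \<Rightarrow> val" where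
  "fold_val f a Atom = a"
| "fold_val f a (Cell x r) = f x (fold_val f a r)"

text \<open>A fold extends the environment at its end, so variables keep their index under binders.\<close>

fun den :: "tm \<Rightarrow> val list \<Rightarrow> val" where
  "den (TVar i) env = env ! i"
| "den TAtom env = Atom"
| "den (TCell a b) env = Cell (den a env) (den b env)"
| "den (TFst a) env = cell_fst (den a env)"
| "den (TSnd a) env = cell_snd (den a env)"
| "den (TIf a b c) env = (if den a env = Atom then den c env else den b env)"
| "den (TEq a b) env = enc_bool (den a env = den b env)"
| "den (TApp f as) env = den f (map (\<lambda>a. den a env) as)"
| "den (TFold b a l) env =
     fold_val (\<lambda>x y. den b (env @ [x, y])) (den a env) (den l env)"

fun eq_cost :: "val \<Rightarrow> val \<Rightarrow> nat" where
  "eq_cost Atom Atom = 7"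
| "eq_cost Atom (Cell u v) = 5"
| "eq_cost (Cell x y) Atom = 5"
| "eq_cost (Cell x y) (Cell u v) =
     (if x = u then eq_cost x u + eq_cost y v + 15 else eq_cost x u + 11)"

text \<open>Each round copies the \<open>n\<close> outer variables twice, once for the recursive
  call on the tail and once for the call of the body; this is the summand
  \<open>2 * n\<close>.\<close>

fun fold_cost :: "nat \<Rightarrow> (val \<Rightarrow> val \<Rightarrow> nat) \<Rightarrow> (val \<Rightarrow> val \<Rightarrow> val) \<Rightarrow> val \<Rightarrow> val \<Rightarrow> nat" where
  "fold_cost n k f a Atom = 3"
| "fold_cost n k f a (Cell x r) = 2 * n + 9 + k x (fold_val f a r) + fold_cost n k f a r"

fun cost :: "tm \<Rightarrow> val list \<Rightarrow> nat" where
  "cost (TVar i) env = 1"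
| "cost TAtom env = 1"
| "cost (TCell a b) env = cost a env + cost b env + 1"
| "cost (TFst a) env = cost a env + 1"
| "cost (TSnd a) env = cost a env + 1"
| "cost (TIf a b c) env =
     cost a env + (if den a env = Atom then cost c env else cost b env) + 1"
| "cost (TEq a b) env = cost a env + cost b env + eq_cost (den a env) (den b env) + 1"
| "cost (TApp f as) env =
     sum_list (map (\<lambda>a. cost a env) as) + cost f (map (\<lambda>a. den a env) as) + 1"
| "cost (TFold b a l) env = length env + cost l env + cost a env + 1 +
     fold_cost (length env) (\<lambda>x y. cost b (env @ [x, y])) (\<lambda>x y. den b (env @ [x, y]))
       (den a env) (den l env)"

fun wf_tm :: "tm \<Rightarrow> nat \<Rightarrow> bool" where
  "wf_tm (TVar i) n \<longleftrightarrow> i < n"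
| "wf_tm TAtom n \<longleftrightarrow> True"
| "wf_tm (TCell a b) n \<longleftrightarrow> wf_tm a n \<and> wf_tm b n"
| "wf_tm (TFst a) n \<longleftrightarrow> wf_tm a n"
| "wf_tm (TSnd a) n \<longleftrightarrow> wf_tm a n"
| "wf_tm (TIf a b c) n \<longleftrightarrow> wf_tm a n \<and> wf_tm b n \<and> wf_tm c n"
| "wf_tm (TEq a b) n \<longleftrightarrow> wf_tm a n \<and> wf_tm b n"
| "wf_tm (TApp f as) n \<longleftrightarrow> wf_tm f (length as) \<and> (\<forall>a\<in>set as. wf_tm a n)"
| "wf_tm (TFold b a l) n \<longleftrightarrow> wf_tm b (n + 2) \<and> wf_tm a n \<and> wf_tm l n"

section \<open>Compilation into the language of the running time model\<close>

definition vars :: "nat \<Rightarrow> expr list" where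
  "vars n = map EVar [0..<n]"

text \<open>Equality is a primitive of the small language because it descends in two trees at once,
  which a fold along one spine does not do. Second components are compared only if the first ones
  agree.\<close>

definition eq_body :: "nat \<Rightarrow> expr" where
  "eq_body k = EIf (EVar 0)
     (EIf (EVar 1)
       (EIf (ECall k [EFst (EVar 0), EFst (EVar 1)])
         (ECall k [ESnd (EVar 0), ESnd (EVar 1)]) EAtom)
       EAtom)
     (EIf (EVar 1) EAtom (ECell EAtom EAtom))"

definition fold_body :: "nat \<Rightarrow> nat \<Rightarrow> expr" where
  "fold_body n k = EIf (EVar n)
     (ECall (Suc k) (vars n @ [EFst (EVar n), ECall k (vars n @ [ESnd (EVar n), EVar (Suc n)])]))
     (EVar (Suc n))"

text \<open>\<open>n\<close> is the length of the environment and \<open>k\<close> the address from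
  which the emitted bodies will stand; the result is the code of the term together with these
  bodies. Equality, application and folds become calls, so they take the first addresses for
  themselves and pass the later ones to their subterms.\<close>

fun compile :: "tm \<Rightarrow> nat \<Rightarrow> nat \<Rightarrow> expr \<times> expr list"
  and compiles :: "tm list \<Rightarrow> nat \<Rightarrow> nat \<Rightarrow> expr list \<times> expr list" where
  "compile (TVar i) n k = (EVar i, [])"
| "compile TAtom n k = (EAtom, [])"
| "compile (TCell a b) n k =
     (let (ea, pa) = compile a n k; (eb, pb) = compile b n (k + length pa) in (ECell ea eb, pa @ pb))"
| "compile (TFst a) n k = (let (ea, pa) = compile a n k in (EFst ea, pa))"
| "compile (TSnd a) n k = (let (ea, pa) = compile a n k in (ESnd ea, pa))"
| "compile (TIf a b c) n k =
     (let (ea, pa) = compile a n k; (eb, pb) = compile b n (k + length pa);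
          (ec, pc) = compile c n (k + length pa + length pb)
      in (EIf ea eb ec, pa @ pb @ pc))"
| "compile (TEq a b) n k =
     (let (ea, pa) = compile a n (Suc k); (eb, pb) = compile b n (Suc k + length pa)
      in (ECall k [ea, eb], eq_body k # pa @ pb))"
| "compile (TApp f as) n k =
     (let (es, ps) = compiles as n (Suc k); (ef, pf) = compile f (length as) (Suc k + length ps)
      in (ECall k es, ef # ps @ pf))"
| "compile (TFold b a l) n k =
     (let (el, pl) = compile l n (Suc (Suc k)); (ea, pa) = compile a n (Suc (Suc k) + length pl);
          (eb, pb) = compile b (n + 2) (Suc (Suc k) + length pl + length pa)
      in (ECall k (vars n @ [el, ea]), fold_body n k # eb # pl @ pa @ pb))"
| "compiles [] n k = ([], [])"
| "compiles (a # as) n k =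
     (let (ea, pa) = compile a n k; (es, ps) = compiles as n (k + length pa) in (ea # es, pa @ ps))"

definition placed :: "program \<Rightarrow> nat \<Rightarrow> expr list \<Rightarrow> bool" where
  "placed P k bs \<longleftrightarrow> (\<forall>i<length bs. k + i < length P \<and> P ! (k + i) = bs ! i)"

lemma placed_Nil [simp]: "placed P k []"
  by (simp add: placed_def)

lemma placed_Cons [simp]:
  "placed P k (b # bs) \<longleftrightarrow> k < length P \<and> P ! k = b \<and> placed P (Suc k) bs"
  unfolding placed_def by (auto simp: All_less_Suc2)

lemma placed_append [simp]:
  "placed P k (bs @ cs) \<longleftrightarrow> placed P k bs \<and> placed P (k + length bs) cs"
  by (induction bs arbitrary: k) auto

lemma evals_append:
  "evals P env as xs m \<Longrightarrow> evals P env bs ys n \<Longrightarrow> evals P env (as @ bs) (xs @ ys) (m + n)"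
proof (induction as arbitrary: xs m)
  case Nil
  then show ?case by (auto elim: evals_elims(1))
next
  case (Cons a as)
  from Cons.prems(1) obtain x xs' m1 m2 where
    "xs = x # xs'" "m = m1 + m2" "eval P env a x m1" "evals P env as xs' m2"
    by (auto elim: evals_elims(2))
  with Cons.IH[of xs' m2] Cons.prems(2) show ?case
    using Args_Cons[of P env a x m1 "as @ bs" "xs' @ ys" "m2 + n"] by (simp add: add.assoc)
qed

lemma evals_vars: "n \<le> length env \<Longrightarrow> evals P env (vars n) (take n env) n"
proof (induction n)
  case 0
  then show ?case by (simp add: vars_def Args_Nil)
next
  case (Suc n)
  have "evals P env [EVar n] [env ! n] 1"
    using Args_Cons[OF Var Args_Nil] Suc.prems by (metis Suc_le_lessD add_0_right)
  from evals_append[OF Suc.IH this] Suc.prems show ?case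
    by (simp add: vars_def take_Suc_conv_app_nth)
qed

lemma evals_2:
  "eval P env a x m \<Longrightarrow> eval P env b y n \<Longrightarrow> evals P env [a, b] [x, y] (m + n)"
  using Args_Cons[OF _ Args_Cons[OF _ Args_Nil]] by fastforce

lemma eval_cong: "eval P env e x m \<Longrightarrow> m = n \<Longrightarrow> eval P env e x n"
  by simp

lemma eval_eq_body:
  assumes "k < length P" "P ! k = eq_body k"
  shows "eval P [x, y] (eq_body k) (enc_bool (x = y)) (eq_cost x y)"
proof (induction x y rule: eq_cost.induct)
  case 1
  have "eval P [Atom, Atom] (eq_body k) (Cell Atom Atom) (1 + (1 + (1 + 1 + 1) + 1) + 1)"
    unfolding eq_body_def
    by (intro If_Atom[where m = 1 and n = "1 + (1 + 1 + 1) + 1"]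
        If_Atom[where m = 1 and n = "1 + 1 + 1"] eval_evals.Cell eval_evals.Atom)
       (use Var[of 0 "[Atom, Atom]" P] Var[of 1 "[Atom, Atom]" P] in simp_all)
  then show ?case by (auto elim!: eval_cong)
next
  case (2 u v)
  have "eval P [Atom, Cell u v] (eq_body k) Atom (1 + (1 + 1 + 1) + 1)"
    unfolding eq_body_def
    by (intro If_Atom[where m = 1 and n = "1 + 1 + 1"] If_Cell[where m = 1 and n = 1 and x = u and y = v]
        eval_evals.Atom)
       (use Var[of 0 "[Atom, Cell u v]" P] Var[of 1 "[Atom, Cell u v]" P] in simp_all)
  then show ?case by (auto elim!: eval_cong)
next
  case (3 x y)
  have "eval P [Cell x y, Atom] (eq_body k) Atom (1 + (1 + 1 + 1) + 1)"
    unfolding eq_body_def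
    by (intro If_Cell[where m = 1 and n = "1 + 1 + 1" and x = x and y = y] If_Atom[where m = 1 and n = 1]
        eval_evals.Atom)
       (use Var[of 0 "[Cell x y, Atom]" P] Var[of 1 "[Cell x y, Atom]" P] in simp_all)
  then show ?case by (auto elim!: eval_cong)
next
  case (4 x y u v)
  let ?env = "[Cell x y, Cell u v]"
  have v: "eval P ?env (EVar 0) (Cell x y) 1" "eval P ?env (EVar 1) (Cell u v) 1"
    using Var[of 0 ?env P] Var[of 1 ?env P] by simp_all
  have "eval P [x, u] (eq_body k) (enc_bool (x = u)) (eq_cost x u)"
    using 4(1,3) by blast
  then have c1: "eval P ?env (ECall k [EFst (EVar 0), EFst (EVar 1)]) (enc_bool (x = u))
      ((1 + 1) + (1 + 1) + eq_cost x u + 1)"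
    using Call[OF assms(1) evals_2[OF Fst[OF v(1)] Fst[OF v(2)]]] assms(2) by simp
  show ?case
  proof (cases "x = u")
    case True
    then have "eval P [y, v] (eq_body k) (enc_bool (y = v)) (eq_cost y v)"
      using 4(2) by blast
    then have c2: "eval P ?env (ECall k [ESnd (EVar 0), ESnd (EVar 1)]) (enc_bool (y = v))
      ((1 + 1) + (1 + 1) + eq_cost y v + 1)"
      using Call[OF assms(1) evals_2[OF Snd[OF v(1)] Snd[OF v(2)]]] assms(2) by simp
    have "eval P ?env (ECall k [EFst (EVar 0), EFst (EVar 1)]) (Cell Atom Atom)
      ((1 + 1) + (1 + 1) + eq_cost x u + 1)"
      using c1 True by simp
    from If_Cell[OF v(1) If_Cell[OF v(2) If_Cell[OF this c2]]]
    have "eval P ?env (eq_body k) (enc_bool (y = v))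
      (1 + (1 + (((1 + 1) + (1 + 1) + eq_cost x u + 1) + ((1 + 1) + (1 + 1) + eq_cost y v + 1) + 1) + 1) + 1)"
      unfolding eq_body_def .
    from eval_cong[OF this, of "eq_cost (Cell x y) (Cell u v)"] True show ?thesis by simp
  next
    case False
    then have "eval P ?env (ECall k [EFst (EVar 0), EFst (EVar 1)]) Atom
      ((1 + 1) + (1 + 1) + eq_cost x u + 1)"
      using c1 by (cases "x = u") simp_all
    from If_Cell[OF v(1) If_Cell[OF v(2) If_Atom[OF this eval_evals.Atom]]]
    have "eval P ?env (eq_body k) Atom
      (1 + (1 + (((1 + 1) + (1 + 1) + eq_cost x u + 1) + 1 + 1) + 1) + 1)"
      unfolding eq_body_def .
    then show ?thesis using False by (auto elim!: eval_cong)
  qed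
qed

lemma eval_fold_body:
  assumes "k < length P" "P ! k = fold_body (length env) k" "Suc k < length P"
    and step: "\<And>x y. eval P (env @ [x, y]) (P ! Suc k) (f x y) (c x y)"
  shows "eval P (env @ [l, a]) (fold_body (length env) k) (fold_val f a l)
    (fold_cost (length env) c f a l)"
proof (induction l)
  case Atom
  let ?n = "length env"
  have "eval P (env @ [Atom, a]) (fold_body ?n k) a (1 + 1 + 1)"
    unfolding fold_body_def
    using Var[of ?n "env @ [Atom, a]" P] Var[of "Suc ?n" "env @ [Atom, a]" P]
    by (intro If_Atom) (simp_all add: nth_append)
  then show ?case by (simp add: numeral_3_eq_3)
next
  case (Cell x r)
  let ?n = "length env"
  let ?env = "env @ [Cell x r, a]"
  have v: "eval P ?env (EVar ?n) (Cell x r) 1" "eval P ?env (EVar (Suc ?n)) a 1"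
    using Var[of ?n ?env P] Var[of "Suc ?n" ?env P] by (simp_all add: nth_append)
  have vs: "evals P ?env (vars ?n) env ?n"
    using evals_vars[of ?n ?env P] by simp
  have c1: "eval P ?env (ECall k (vars ?n @ [ESnd (EVar ?n), EVar (Suc ?n)])) (fold_val f a r)
      ((?n + ((1 + 1) + 1)) + fold_cost ?n c f a r + 1)"
    using Call[OF assms(1) evals_append[OF vs evals_2[OF Snd[OF v(1)] v(2)]]] Cell(2) assms(2) by simp
  have "eval P (env @ [x, fold_val f a r]) (P ! Suc k) (f x (fold_val f a r)) (c x (fold_val f a r))"
    by (rule step)
  then have "eval P ?env (ECall (Suc k) (vars ?n @ [EFst (EVar ?n),
        ECall k (vars ?n @ [ESnd (EVar ?n), EVar (Suc ?n)])])) (f x (fold_val f a r))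
      ((?n + ((1 + 1) + ((?n + ((1 + 1) + 1)) + fold_cost ?n c f a r + 1))) + c x (fold_val f a r) + 1)"
    using Call[OF assms(3) evals_append[OF vs evals_2[OF Fst[OF v(1)] c1]]] by simp
  from If_Cell[OF v(1) this, of "EVar (Suc ?n)"] show ?case
    unfolding fold_body_def by (auto elim!: eval_cong)
qed

text \<open>The only assumption on the program is that the emitted bodies stand at their addresses.
  It passes to subterms, so one simultaneous induction on terms and argument lists works inside any
  surrounding program. The step count is exact.\<close>

lemma compile_correct:
  "wf_tm t n \<Longrightarrow> length env = n \<Longrightarrow> placed P k (snd (compile t n k)) \<Longrightarrow>
     eval P env (fst (compile t n k)) (den t env) (cost t env)"
  "\<forall>a\<in>set as. wf_tm a n \<Longrightarrow> length env = n \<Longrightarrow> placed P k (snd (compiles as n k)) \<Longrightarrow>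
     evals P env (fst (compiles as n k)) (map (\<lambda>a. den a env) as) (sum_list (map (\<lambda>a. cost a env) as))"
proof (induction t n k and as n k arbitrary: env and env rule: compile_compiles.induct)
  case (1 i n k)
  then show ?case using Var[of i env P] by simp
next
  case (2 n k)
  then show ?case using eval_evals.Atom[of P env] by simp
next
  case (3 a b n k)
  then show ?case
    using eval_evals.Cell[of P env "fst (compile a n k)"] by (fastforce simp: Let_def split: prod.splits)
next
  case (4 a n k)
  then show ?case by (auto simp: Let_def split: prod.splits simp del: One_nat_def add_Suc_right intro!: eval_evals.Fst)
next
  case (5 a n k)
  then show ?case by (auto simp: Let_def split: prod.splits simp del: One_nat_def add_Suc_right intro!: eval_evals.Snd)
next
  case (6 a b c n k)
  obtain ea pa where a: "compile a n k = (ea, pa)" by fastforce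
  obtain eb pb where b: "compile b n (k + length pa) = (eb, pb)" by fastforce
  obtain ec pc where c: "compile c n (k + length pa + length pb) = (ec, pc)" by fastforce
  from 6 a b c have ih: "eval P env ea (den a env) (cost a env)"
    "eval P env eb (den b env) (cost b env)" "eval P env ec (den c env) (cost c env)"
    by (simp_all add: add.assoc)
  show ?case
  proof (cases "den a env")
    case Atom
    then show ?thesis using ih If_Atom[of P env ea] by (simp add: a b c)
  next
    case (Cell x y)
    then show ?thesis using ih If_Cell[of P env ea] by (simp add: a b c)
  qed
next
  case (7 a b n k)
  obtain ea pa where a: "compile a n (Suc k) = (ea, pa)" by fastforce
  obtain eb pb where b: "compile b n (Suc k + length pa) = (eb, pb)" by fastforce
  from 7 a b have ih: "eval P env ea (den a env) (cost a env)"
    "eval P env eb (den b env) (cost b env)" "k < length P" "P ! k = eq_body k"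
    by simp_all
  show ?case
    using Call[OF ih(3) evals_2[OF ih(1,2)]] eval_eq_body[OF ih(3,4)] ih(4) b by (simp add: a)
next
  case (8 f as n k)
  obtain es ps where a: "compiles as n (Suc k) = (es, ps)" by fastforce
  obtain ef pf where f: "compile f (length as) (Suc k + length ps) = (ef, pf)" by fastforce
  from 8 a f have ih: "evals P env es (map (\<lambda>a. den a env) as) (sum_list (map (\<lambda>a. cost a env) as))"
    "eval P (map (\<lambda>a. den a env) as) ef (den f (map (\<lambda>a. den a env) as)) (cost f (map (\<lambda>a. den a env) as))"
    "k < length P" "P ! k = ef"
    by simp_all
  show ?case using Call[OF ih(3) ih(1)] ih(2,4) f by (simp add: a)
next
  case (9 b a l n k)
  obtain el pl where l: "compile l n (Suc (Suc k)) = (el, pl)" by fastforce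
  obtain ea pa where a: "compile a n (Suc (Suc k) + length pl) = (ea, pa)" by fastforce
  obtain eb pb where b: "compile b (n + 2) (Suc (Suc k) + length pl + length pa) = (eb, pb)" by fastforce
  from 9 a b l have ih: "eval P env ea (den a env) (cost a env)" "eval P env el (den l env) (cost l env)"
    "\<And>x y. eval P (env @ [x, y]) eb (den b (env @ [x, y])) (cost b (env @ [x, y]))"
    "k < length P" "P ! k = fold_body n k" "Suc k < length P" "P ! Suc k = eb" "length env = n"
    by simp_all
  have "eval P (env @ [den l env, den a env]) (fold_body (length env) k)
     (fold_val (\<lambda>x y. den b (env @ [x, y])) (den a env) (den l env))
     (fold_cost (length env) (\<lambda>x y. cost b (env @ [x, y])) (\<lambda>x y. den b (env @ [x, y])) (den a env) (den l env))"
    using ih by (intro eval_fold_body) simp_all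
  moreover have args: "evals P env (vars n @ [el, ea]) (env @ [den l env, den a env]) (n + (cost l env + cost a env))"
    using evals_append[OF _ evals_2[OF ih(2,1)]] evals_vars[of n env P] ih(8) by simp
  ultimately have "eval P env (ECall k (vars n @ [el, ea]))
     (fold_val (\<lambda>x y. den b (env @ [x, y])) (den a env) (den l env)) (n + (cost l env + cost a env) +
     fold_cost (length env) (\<lambda>x y. cost b (env @ [x, y])) (\<lambda>x y. den b (env @ [x, y])) (den a env) (den l env) + 1)"
    using Call[OF ih(4) args] ih(5,8) by simp
  then show ?case using ih(8) a b l by (simp add: add.assoc)
next
  case (10 n k)
  then show ?case by (simp add: Args_Nil)
next
  case (11 a as n k)
  then show ?case by (auto simp: Let_def split: prod.splits intro!: Args_Cons)
qed

text \<open>The entry expression takes address \<open>0\<close>, hence the auxiliary bodies are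
  emitted from 1 on.\<close>

definition program_of :: "tm \<Rightarrow> nat \<Rightarrow> program" where
  "program_of t n = fst (compile t n 1) # snd (compile t n 1)"

lemma runs_program_of:
  assumes "wf_tm t (length xs)"
  shows "runs (program_of t (length xs)) xs (den t xs) (cost t xs)"
proof -
  have "placed (program_of t (length xs)) 0 (program_of t (length xs))"
    by (simp add: placed_def)
  then have "placed (program_of t (length xs)) 1 (snd (compile t (length xs) 1))"
    by (subst (asm) (2) program_of_def) simp
  from compile_correct(1)[OF assms refl this] show ?thesis
    by (simp add: runs_def program_of_def)
qed

section \<open>Polynomial bounds\<close>

text \<open>A single power stands for an arbitrary polynomial: with a base of at least 2, constants
  and sums are absorbed by a larger exponent.\<close>

definition poly_bdd :: "'a set \<Rightarrow> ('a \<Rightarrow> nat) \<Rightarrow> ('a \<Rightarrow> nat) \<Rightarrow> bool" where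
  "poly_bdd A f W \<longleftrightarrow> (\<exists>c. \<forall>x\<in>A. f x \<le> (W x + 2) ^ c)"

lemma poly_bddI: "(\<And>x. x \<in> A \<Longrightarrow> f x \<le> (W x + 2) ^ c) \<Longrightarrow> poly_bdd A f W"
  by (auto simp: poly_bdd_def)

lemma poly_bdd_mono: "poly_bdd A g W \<Longrightarrow> (\<And>x. x \<in> A \<Longrightarrow> f x \<le> g x) \<Longrightarrow> poly_bdd A f W"
  unfolding poly_bdd_def by (meson order_trans)

lemma poly_bdd_const [simp]: "poly_bdd A (\<lambda>x. c) W"
proof (rule poly_bddI)
  fix x
  have "c \<le> 2 ^ c" by (simp add: less_imp_le)
  also have "\<dots> \<le> (W x + 2) ^ c" by (simp add: power_mono)
  finally show "c \<le> (W x + 2) ^ c" .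
qed

lemma poly_bdd_self: "poly_bdd A W W"
  by (rule poly_bddI[where c = 1]) simp

lemma poly_bdd_add:
  assumes "poly_bdd A f W" "poly_bdd A g W"
  shows "poly_bdd A (\<lambda>x. f x + g x) W"
proof -
  obtain c d where c: "\<And>x. x \<in> A \<Longrightarrow> f x \<le> (W x + 2) ^ c" and d: "\<And>x. x \<in> A \<Longrightarrow> g x \<le> (W x + 2) ^ d"
    using assms by (auto simp: poly_bdd_def)
  show ?thesis
  proof (rule poly_bddI[where c = "c + d + 1"])
    fix x assume x: "x \<in> A"
    have "f x + g x \<le> (W x + 2) ^ (c + d) + (W x + 2) ^ (c + d)"
      using c[OF x] d[OF x] power_increasing[of c "c + d" "W x + 2"] power_increasing[of d "c + d" "W x + 2"]
      by (meson add_mono le_add1 le_add2 order_trans one_le_numeral)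
    also have "\<dots> \<le> (W x + 2) ^ (c + d + 1)" by simp
    finally show "f x + g x \<le> (W x + 2) ^ (c + d + 1)" .
  qed
qed

lemma poly_bdd_mult:
  assumes "poly_bdd A f W" "poly_bdd A g W"
  shows "poly_bdd A (\<lambda>x. f x * g x) W"
proof -
  obtain c d where "\<And>x. x \<in> A \<Longrightarrow> f x \<le> (W x + 2) ^ c" "\<And>x. x \<in> A \<Longrightarrow> g x \<le> (W x + 2) ^ d"
    using assms by (auto simp: poly_bdd_def)
  then show ?thesis
    by (intro poly_bddI[where c = "c + d"]) (simp add: mult_mono power_add)
qed

lemma poly_bdd_power: "poly_bdd A f W \<Longrightarrow> poly_bdd A (\<lambda>x. f x ^ c) W"
  by (induction c) (auto intro: poly_bdd_mult)

lemma poly_bdd_trans: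
  assumes "poly_bdd A f V" "poly_bdd A V W"
  shows "poly_bdd A f W"
proof -
  obtain c where "\<And>x. x \<in> A \<Longrightarrow> f x \<le> (V x + 2) ^ c"
    using assms(1) by (auto simp: poly_bdd_def)
  moreover have "poly_bdd A (\<lambda>x. (V x + 2) ^ c) W"
    using assms(2) by (intro poly_bdd_power poly_bdd_add) simp_all
  ultimately show ?thesis by (rule poly_bdd_mono[rotated])
qed

lemma poly_bdd_comp:
  assumes "poly_bdd B f V" "\<And>x. x \<in> A \<Longrightarrow> h x \<in> B" "poly_bdd A (\<lambda>x. V (h x)) W"
  shows "poly_bdd A (\<lambda>x. f (h x)) W"
  using assms(1,2) by (intro poly_bdd_trans[OF _ assms(3)]) (auto simp: poly_bdd_def)

lemma poly_bdd_sum_list: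
  "(\<And>a. a \<in> set as \<Longrightarrow> poly_bdd A (f a) W) \<Longrightarrow> poly_bdd A (\<lambda>x. sum_list (map (\<lambda>a. f a x) as)) W"
  by (induction as) (auto intro: poly_bdd_add)

lemmas poly_bdd_intros = poly_bdd_const poly_bdd_self poly_bdd_add poly_bdd_mult poly_bdd_power

section \<open>Cost and size bounds for terms\<close>

definition env_size :: "val list \<Rightarrow> nat" where
  "env_size env = sum_list (map val_size env)"

lemma env_size_simps [simp]:
  "env_size [] = 0" "env_size (x # env) = val_size x + env_size env"
  "env_size (env @ env') = env_size env + env_size env'"
  by (simp_all add: env_size_def)

text \<open>The size of the value is bounded along with the cost, since it is the input size of
  whatever consumes the value. The measure \<open>W\<close> is a parameter because the exhaustive
  search is not polynomial in the size of its input.\<close>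

definition pbd :: "tm \<Rightarrow> nat \<Rightarrow> (val list \<Rightarrow> nat) \<Rightarrow> bool" where
  "pbd t n W \<longleftrightarrow> wf_tm t n \<and> poly_bdd {env. length env = n} (cost t) W \<and>
     poly_bdd {env. length env = n} (\<lambda>env. val_size (den t env)) W"

abbreviation ptime :: "tm \<Rightarrow> nat \<Rightarrow> bool" where
  "ptime t n \<equiv> pbd t n env_size"

lemma pbdD:
  assumes "pbd t n W"
  shows "wf_tm t n" "poly_bdd {env. length env = n} (cost t) W"
    "poly_bdd {env. length env = n} (\<lambda>env. val_size (den t env)) W"
  using assms by (simp_all add: pbd_def)

lemma pbdI:
  assumes "wf_tm t n" "poly_bdd {env. length env = n} (\<lambda>env. cost t env) W"
    "poly_bdd {env. length env = n} (\<lambda>env. val_size (den t env)) W"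
  shows "pbd t n W"
  using assms by (simp add: pbd_def)

lemma val_size_pos [simp]: "0 < val_size x"
  by (cases x) auto

lemma val_size_fst: "val_size (cell_fst x) \<le> val_size x"
  by (cases x) auto

lemma val_size_snd: "val_size (cell_snd x) \<le> val_size x"
  by (cases x) auto

lemma val_size_enc_bool: "val_size (enc_bool b) \<le> 3"
  by (cases b) auto

lemma enc_bool_simps [simp]:
  "enc_bool b = Atom \<longleftrightarrow> \<not> b" "enc_bool b = enc_bool b' \<longleftrightarrow> b = b'"
  by (cases b; cases b'; simp)+

lemma eq_cost_le: "eq_cost x y \<le> 16 * val_size x"
  by (induction x y rule: eq_cost.induct) auto

lemma nth_size_le: "i < length env \<Longrightarrow> val_size (env ! i) \<le> env_size env"
  unfolding env_size_def by (rule member_le_sum_list) auto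

lemma pbd_TVar [intro]: "i < n \<Longrightarrow> ptime (TVar i) n"
  by (rule pbdI) (auto intro!: poly_bdd_const[of _ 1, simplified] poly_bdd_mono[OF poly_bdd_self] nth_size_le)

lemma pbd_TAtom [intro]: "pbd TAtom n W"
  by (rule pbdI) (auto intro!: poly_bdd_const[of _ 1, simplified])

lemma pbd_TCell [intro]: "pbd a n W \<Longrightarrow> pbd b n W \<Longrightarrow> pbd (TCell a b) n W"
  using pbdD[of a n W] pbdD[of b n W]
  by (intro pbdI) (auto simp del: One_nat_def add_Suc_right intro!: poly_bdd_intros)

lemma pbd_TFst [intro]: "pbd a n W \<Longrightarrow> pbd (TFst a) n W"
  using pbdD[of a n W]
  by (intro pbdI) (auto simp del: One_nat_def add_Suc_right intro!: poly_bdd_intros intro: poly_bdd_mono val_size_fst)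

lemma pbd_TSnd [intro]: "pbd a n W \<Longrightarrow> pbd (TSnd a) n W"
  using pbdD[of a n W]
  by (intro pbdI) (auto simp del: One_nat_def add_Suc_right intro!: poly_bdd_intros intro: poly_bdd_mono val_size_snd)

lemma pbd_TIf [intro]:
  assumes "pbd a n W" "pbd b n W" "pbd c n W"
  shows "pbd (TIf a b c) n W"
proof -
  have "poly_bdd {env. length env = n} (\<lambda>env. cost a env + (cost c env + cost b env) + 1) W"
    "poly_bdd {env. length env = n} (\<lambda>env. val_size (den b env) + val_size (den c env)) W"
    using assms by (auto simp: pbd_def simp del: One_nat_def add_Suc_right intro!: poly_bdd_intros)
  from poly_bdd_mono[OF this(1), of "cost (TIf a b c)"]
    poly_bdd_mono[OF this(2), of "\<lambda>env. val_size (den (TIf a b c) env)"] assms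
  show ?thesis by (auto simp: pbd_def)
qed

lemma pbd_TEq [intro]:
  assumes "pbd a n W" "pbd b n W"
  shows "pbd (TEq a b) n W"
proof -
  have "poly_bdd {env. length env = n} (\<lambda>env. cost a env + cost b env + 16 * val_size (den a env) + 1) W"
    using assms by (auto simp: pbd_def simp del: One_nat_def add_Suc_right intro!: poly_bdd_intros)
  then have "poly_bdd {env. length env = n} (cost (TEq a b)) W"
    by (rule poly_bdd_mono) (simp add: eq_cost_le)
  moreover have "poly_bdd {env. length env = n} (\<lambda>env. val_size (den (TEq a b) env)) W"
    using poly_bdd_const[of _ 3] by (rule poly_bdd_mono) (simp add: val_size_enc_bool)
  ultimately show ?thesis using assms by (auto simp: pbd_def)
qed

lemma pbd_TApp [intro]:
  assumes f: "pbd f (length as) V" and as: "\<And>a. a \<in> set as \<Longrightarrow> pbd a n W"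
    and V: "poly_bdd {env. length env = n} (\<lambda>env. V (map (\<lambda>a. den a env) as)) W"
  shows "pbd (TApp f as) n W"
proof -
  have "poly_bdd {env. length env = n} (\<lambda>env. sum_list (map (\<lambda>a. cost a env) as)) W"
    using as by (intro poly_bdd_sum_list) (auto simp: pbd_def)
  moreover have "poly_bdd {env. length env = n} (\<lambda>env. cost f (map (\<lambda>a. den a env) as)) W"
    by (rule poly_bdd_comp[OF pbdD(2)[OF f] _ V]) simp
  moreover have "poly_bdd {env. length env = n} (\<lambda>env. val_size (den f (map (\<lambda>a. den a env) as))) W"
    using poly_bdd_comp[OF pbdD(3)[OF f] _ V] by simp
  ultimately show ?thesis
    using pbdD(1)[OF f] pbdD(1)[OF as]
    by (intro pbdI) (auto simp del: One_nat_def add_Suc_right intro!: poly_bdd_intros)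
qed

lemma ptime_TApp [intro]:
  assumes f: "ptime f (length as)" and as: "\<And>a. a \<in> set as \<Longrightarrow> pbd a n W"
  shows "pbd (TApp f as) n W"
proof (rule pbd_TApp[OF f as])
  have "poly_bdd {env. length env = n} (\<lambda>env. sum_list (map (\<lambda>a. val_size (den a env)) as)) W"
    using as by (intro poly_bdd_sum_list) (auto simp: pbd_def)
  then show "poly_bdd {env. length env = n} (\<lambda>env. env_size (map (\<lambda>a. den a env) as)) W"
    by (simp add: env_size_def o_def)
qed

lemmas pbd_intros = pbd_TVar pbd_TAtom pbd_TCell pbd_TFst pbd_TSnd pbd_TIf pbd_TEq

section \<open>Resource bounds for folds\<close>

fun tails :: "val \<Rightarrow> val set" where
  "tails Atom = {Atom}"
| "tails (Cell x r) = insert (Cell x r) (tails r)"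

lemma tails_self [simp]: "v \<in> tails v"
  by (cases v) auto

lemma finite_tails [simp]: "finite (tails v)"
  by (induction v) auto

lemma tails_trans: "u \<in> tails v \<Longrightarrow> w \<in> tails u \<Longrightarrow> w \<in> tails v"
  by (induction v) auto

lemma val_size_tails: "u \<in> tails v \<Longrightarrow> val_size u \<le> val_size v"
  by (induction v) auto

lemma fold_cost_le:
  "(\<And>x r. Cell x r \<in> tails l \<Longrightarrow> k x (fold_val f a r) \<le> M) \<Longrightarrow>
     fold_cost n k f a l \<le> 3 + val_size l * (2 * n + 9 + M)"
proof (induction l)
  case Atom
  then show ?case by simp
next
  case (Cell x r)
  have "fold_cost n k f a r \<le> 3 + val_size r * (2 * n + 9 + M)"
    using Cell.prems by (intro Cell.IH(2)) auto
  moreover have "k x (fold_val f a r) \<le> M"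
    using Cell.prems by simp
  ultimately show ?case by (simp add: algebra_simps)
qed

text \<open>Iterating a polynomial body may blow up the accumulator exponentially, so a bound
  \<open>M\<close> on all accumulators has to be supplied; they are the folds over suffixes of the
  list. Given \<open>M\<close>, each round is polynomial and the size of the list bounds the number
  of rounds.\<close>

lemma pbd_TFold:
  assumes b: "ptime b (n + 2)" and a: "pbd a n W" and l: "pbd l n W"
    and W: "\<And>env. length env = n \<Longrightarrow> env_size env \<le> W env"
    and acc: "poly_bdd {env. length env = n} M W"
      "\<And>env r. length env = n \<Longrightarrow> r \<in> tails (den l env) \<Longrightarrow>
        val_size (fold_val (\<lambda>x y. den b (env @ [x, y])) (den a env) r) \<le> M env"
  shows "pbd (TFold b a l) n W"
proof -
  obtain c where c: "\<And>env. length env = n + 2 \<Longrightarrow> cost b env \<le> (env_size env + 2) ^ c"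
    using pbdD(2)[OF b] by (auto simp: poly_bdd_def)
  let ?K = "\<lambda>env. (W env + val_size (den l env) + M env + 2) ^ c"
  have "poly_bdd {env. length env = n}
     (\<lambda>env. n + cost l env + cost a env + 1 + (3 + val_size (den l env) * (2 * n + 9 + ?K env))) W"
    using pbdD[OF a] pbdD[OF l] acc(1) by (intro poly_bdd_intros)
  then have "poly_bdd {env. length env = n} (cost (TFold b a l)) W"
  proof (rule poly_bdd_mono)
    fix env :: "val list"
    assume "env \<in> {env. length env = n}"
    then have n: "length env = n" by simp
    have "fold_cost n (\<lambda>x y. cost b (env @ [x, y])) (\<lambda>x y. den b (env @ [x, y])) (den a env) (den l env)
       \<le> 3 + val_size (den l env) * (2 * n + 9 + ?K env)"
    proof (rule fold_cost_le)
      fix x r assume xr: "Cell x r \<in> tails (den l env)"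
      let ?y = "fold_val (\<lambda>x y. den b (env @ [x, y])) (den a env) r"
      have "r \<in> tails (den l env)" using tails_trans[OF xr] by simp
      then have "val_size ?y \<le> M env" by (rule acc(2)[OF n])
      moreover have "val_size x \<le> val_size (den l env)"
        using val_size_tails[OF xr] by simp
      ultimately have "env_size (env @ [x, ?y]) + 2 \<le> W env + val_size (den l env) + M env + 2"
        using W[OF n] by simp
      then have "(env_size (env @ [x, ?y]) + 2) ^ c \<le> ?K env" by (rule power_mono) simp
      with c[of "env @ [x, ?y]"] n show "cost b (env @ [x, ?y]) \<le> ?K env" by simp
    qed
    with n show "cost (TFold b a l) env \<le> n + cost l env + cost a env + 1 +
        (3 + val_size (den l env) * (2 * n + 9 + ?K env))"
      by simp
  qed
  moreover have "poly_bdd {env. length env = n} (\<lambda>env. val_size (den (TFold b a l) env)) W"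
    using acc(1) by (rule poly_bdd_mono) (use acc(2) in simp)
  ultimately show ?thesis
    using a b l by (simp add: pbd_def)
qed

text \<open>Covers loops whose accumulator only shrinks or stays within the size of the environment,
  such as repeated deletion.\<close>

lemma pbd_TFold_max:
  assumes b: "ptime b (n + 2)" and a: "pbd a n W" and l: "pbd l n W"
    and W: "\<And>env. length env = n \<Longrightarrow> env_size env \<le> W env"
    and step: "\<And>env x y. length env = n \<Longrightarrow> val_size (den b (env @ [x, y])) \<le> max (val_size y) (env_size env)"
  shows "pbd (TFold b a l) n W"
proof (rule pbd_TFold[OF b a l W, where M = "\<lambda>env. val_size (den a env) + W env"])
  show "poly_bdd {env. length env = n} (\<lambda>env. val_size (den a env) + W env) W"
    using pbdD[OF a] by (intro poly_bdd_intros)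
  fix env :: "val list" and r assume n: "length env = n"
  show "val_size (fold_val (\<lambda>x y. den b (env @ [x, y])) (den a env) r) \<le> val_size (den a env) + W env"
  proof (induction r)
    case (Cell x r)
    then show ?case
      using W[OF n] step[OF n, of x "fold_val (\<lambda>x y. den b (env @ [x, y])) (den a env) r"] by simp
  qed simp
qed simp

lemma fold_val_size_add:
  assumes "\<And>x r y. Cell x r \<in> tails l \<Longrightarrow> val_size (f x y) \<le> val_size y + B"
  shows "val_size (fold_val f a l) \<le> val_size a + val_size l * B"
  using assms
proof (induction l)
  case (Cell x r)
  have "val_size (fold_val f a r) \<le> val_size a + val_size r * B"
    using Cell.prems by (intro Cell.IH(2)) auto
  moreover have "val_size (f x (fold_val f a r)) \<le> val_size (fold_val f a r) + B"
    using Cell.prems[of x r] by simp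
  ultimately show ?case by (simp add: algebra_simps)
qed simp

text \<open>Covers loops in which the growth per round depends on the current element but not on the
  accumulator: \<open>q\<close> sees only \<open>env @ [x]\<close>, so the growth adds up instead of
  compounding.\<close>

lemma pbd_TFold_add:
  assumes b: "ptime b (n + 2)" and a: "pbd a n W" and l: "pbd l n W"
    and W: "\<And>env. length env = n \<Longrightarrow> env_size env \<le> W env"
    and q: "poly_bdd {env. length env = Suc n} q env_size"
    and step: "\<And>env x y. length env = n \<Longrightarrow>
      val_size (den b (env @ [x, y])) \<le> val_size y + q (env @ [x])"
  shows "pbd (TFold b a l) n W"
proof -
  obtain c where c: "\<And>env. length env = Suc n \<Longrightarrow> q env \<le> (env_size env + 2) ^ c"
    using q by (auto simp: poly_bdd_def)
  let ?B = "\<lambda>env. (W env + val_size (den l env) + 2) ^ c"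
  show ?thesis
  proof (rule pbd_TFold[OF b a l W, where M = "\<lambda>env. val_size (den a env) + val_size (den l env) * ?B env"])
    show "poly_bdd {env. length env = n} (\<lambda>env. val_size (den a env) + val_size (den l env) * ?B env) W"
      using pbdD[OF a] pbdD[OF l] by (intro poly_bdd_intros)
    fix env :: "val list" and r
    assume n: "length env = n" and r: "r \<in> tails (den l env)"
    have "val_size (fold_val (\<lambda>x y. den b (env @ [x, y])) (den a env) r)
      \<le> val_size (den a env) + val_size r * ?B env"
    proof (rule fold_val_size_add)
      fix x r' y assume "Cell x r' \<in> tails r"
      then have "val_size x \<le> val_size (den l env)"
        using val_size_tails[OF tails_trans[OF r]] by fastforce
      then have "(env_size (env @ [x]) + 2) ^ c \<le> ?B env"
        using W[OF n] by (intro power_mono) auto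
      then show "val_size (den b (env @ [x, y])) \<le> val_size y + ?B env"
        using step[OF n, of x y] c[of "env @ [x]"] n by simp
    qed
    also have "\<dots> \<le> val_size (den a env) + val_size (den l env) * ?B env"
      using val_size_tails[OF r] by simp
    finally show "val_size (fold_val (\<lambda>x y. den b (env @ [x, y])) (den a env) r)
      \<le> val_size (den a env) + val_size (den l env) * ?B env" .
  qed simp
qed

section \<open>List operations and Boolean connectives as terms\<close>

fun vlist :: "val \<Rightarrow> val list" where
  "vlist Atom = []"
| "vlist (Cell x r) = x # vlist r"

lemma vlist_enc_list [simp]: "vlist (enc_list e xs) = map e xs"
  by (induction xs) auto

lemma enc_list_vlist [simp]: "enc_list (\<lambda>x. x) (vlist v) = v"
  by (induction v) auto

lemma fold_val_foldr: "fold_val f a v = foldr f (vlist v) a"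
  by (induction v) auto

definition tvars :: "nat \<Rightarrow> tm list" where
  "tvars n = map TVar [0..<n]"

lemma length_tvars [simp]: "length (tvars n) = n"
  by (simp add: tvars_def)

lemma den_tvars: "n \<le> length env \<Longrightarrow> map (\<lambda>a. den a env) (tvars n) = take n env"
  by (auto simp: tvars_def intro: nth_equalityI)

definition TTrue :: tm where
  "TTrue = TCell TAtom TAtom"

definition TNot :: "tm \<Rightarrow> tm" where
  "TNot a = TIf a TAtom TTrue"

definition TAnd :: "tm \<Rightarrow> tm \<Rightarrow> tm" where
  "TAnd a b = TIf a b TAtom"

definition TOr :: "tm \<Rightarrow> tm \<Rightarrow> tm" where
  "TOr a b = TIf a TTrue b"

text \<open>The application to \<open>tvars (Suc n)\<close> hides the accumulator from
  \<open>p\<close>, which therefore is a term over the environment and the current element. The same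
  device serves \<open>TMap\<close> and \<open>TEx\<close>, and it makes the additive fold bound
  applicable.\<close>

definition TFilter :: "nat \<Rightarrow> tm \<Rightarrow> tm \<Rightarrow> tm" where
  "TFilter n p l =
     TFold (TIf (TApp p (tvars (Suc n))) (TCell (TVar n) (TVar (Suc n))) (TVar (Suc n))) TAtom l"

definition TMap :: "nat \<Rightarrow> tm \<Rightarrow> tm \<Rightarrow> tm" where
  "TMap n p l = TFold (TCell (TApp p (tvars (Suc n))) (TVar (Suc n))) TAtom l"

definition TEx :: "nat \<Rightarrow> tm \<Rightarrow> tm \<Rightarrow> tm" where
  "TEx n p l = TFold (TIf (TApp p (tvars (Suc n))) TTrue (TVar (Suc n))) TAtom l"

lemma den_logic [simp]:
  "den TTrue env = enc_bool True"
  "den (TNot a) env = enc_bool (den a env = Atom)"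
  "den (TAnd a b) env = (if den a env = Atom then Atom else den b env)"
  "den (TOr a b) env = (if den a env = Atom then den b env else enc_bool True)"
  by (simp_all add: TTrue_def TNot_def TAnd_def TOr_def)

lemma den_TFilter [simp]:
  assumes "length env = n"
  shows "den (TFilter n p l) env =
    enc_list (\<lambda>x. x) (filter (\<lambda>x. den p (env @ [x]) \<noteq> Atom) (vlist (den l env)))"
proof -
  have "foldr (\<lambda>x y. den (TIf (TApp p (tvars (Suc n))) (TCell (TVar n) (TVar (Suc n))) (TVar (Suc n))) (env @ [x, y])) xs Atom
    = enc_list (\<lambda>x. x) (filter (\<lambda>x. den p (env @ [x]) \<noteq> Atom) xs)" for xs
    using assms by (induction xs) (auto simp: den_tvars nth_append)
  then show ?thesis by (simp add: TFilter_def fold_val_foldr)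
qed

lemma den_TMap [simp]:
  assumes "length env = n"
  shows "den (TMap n p l) env =
    enc_list (\<lambda>x. x) (map (\<lambda>x. den p (env @ [x])) (vlist (den l env)))"
proof -
  have "foldr (\<lambda>x y. den (TCell (TApp p (tvars (Suc n))) (TVar (Suc n))) (env @ [x, y])) xs Atom
    = enc_list (\<lambda>x. x) (map (\<lambda>x. den p (env @ [x])) xs)" for xs
    using assms by (induction xs) (auto simp: den_tvars nth_append)
  then show ?thesis by (simp add: TMap_def fold_val_foldr)
qed

lemma den_TEx [simp]:
  assumes "length env = n"
  shows "den (TEx n p l) env = enc_bool (\<exists>x\<in>set (vlist (den l env)). den p (env @ [x]) \<noteq> Atom)"
proof -
  have "foldr (\<lambda>x y. den (TIf (TApp p (tvars (Suc n))) TTrue (TVar (Suc n))) (env @ [x, y])) xs Atom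
    = enc_bool (\<exists>x\<in>set xs. den p (env @ [x]) \<noteq> Atom)" for xs
    using assms by (induction xs) (auto simp: den_tvars nth_append)
  then show ?thesis by (simp add: TEx_def fold_val_foldr)
qed

lemma pbd_logic [intro]:
  "pbd TTrue n W"
  "pbd a n W \<Longrightarrow> pbd (TNot a) n W"
  "pbd a n W \<Longrightarrow> pbd b n W \<Longrightarrow> pbd (TAnd a b) n W"
  "pbd a n W \<Longrightarrow> pbd b n W \<Longrightarrow> pbd (TOr a b) n W"
  by (auto simp: TTrue_def TNot_def TAnd_def TOr_def)

lemma ptime_tvars: "ptime p (Suc n) \<Longrightarrow> ptime (TApp p (tvars (Suc n))) (n + 2)"
  by (rule ptime_TApp) (auto simp: tvars_def)

lemma pbd_TFilter [intro]:
  assumes "ptime p (Suc n)" "ptime l n"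
  shows "ptime (TFilter n p l) n"
  unfolding TFilter_def
proof (rule pbd_TFold_add[where q = "\<lambda>env. env_size env + 1"])
  show "ptime (TIf (TApp p (tvars (Suc n))) (TCell (TVar n) (TVar (Suc n))) (TVar (Suc n))) (n + 2)"
    using ptime_tvars[OF assms(1)] by (intro pbd_intros) simp_all
  show "poly_bdd {env. length env = Suc n} (\<lambda>env. env_size env + 1) env_size"
    by (intro poly_bdd_intros)
qed (auto simp: assms nth_append den_tvars)

lemma pbd_TMap [intro]:
  assumes "ptime p (Suc n)" "ptime l n"
  shows "ptime (TMap n p l) n"
  unfolding TMap_def
proof (rule pbd_TFold_add[where q = "\<lambda>env. val_size (den p env) + 1"])
  show "ptime (TCell (TApp p (tvars (Suc n))) (TVar (Suc n))) (n + 2)"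
    using ptime_tvars[OF assms(1)] by (intro pbd_intros) simp_all
  show "poly_bdd {env. length env = Suc n} (\<lambda>env. val_size (den p env) + 1) env_size"
    using pbdD(3)[OF assms(1)] by (intro poly_bdd_intros)
qed (auto simp: assms nth_append den_tvars)

lemma pbd_TEx [intro]:
  assumes "ptime p (Suc n)" "ptime l n"
  shows "ptime (TEx n p l) n"
  unfolding TEx_def
proof (rule pbd_TFold_add[where q = "\<lambda>env. 3"])
  show "ptime (TIf (TApp p (tvars (Suc n))) TTrue (TVar (Suc n))) (n + 2)"
    using ptime_tvars[OF assms(1)] by (intro pbd_intros pbd_logic) simp_all
qed (auto simp: assms nth_append den_tvars)

section \<open>Deleting twins\<close>

definition colorings :: "'a graph \<Rightarrow> ('a \<Rightarrow> 'c set) \<Rightarrow> 'a set \<Rightarrow> ('a \<Rightarrow> 'c) set" where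
  "colorings G L V = {f \<in> \<Pi>\<^sub>E v\<in>V. L v. \<forall>v\<in>V. \<forall>w\<in>V. {v, w} \<in> edges G \<longrightarrow> f v \<noteq> f w}"

text \<open>In contrast to \<open>adjacent_colorings\<close> a step may be void. So a recoloring
  that becomes invisible under restriction to fewer vertices is still a step.\<close>

definition recol :: "'a graph \<Rightarrow> ('a \<Rightarrow> 'c set) \<Rightarrow> 'a set \<Rightarrow> (('a \<Rightarrow> 'c) \<times> ('a \<Rightarrow> 'c)) set" where
  "recol G L V = {(f, g). f \<in> colorings G L V \<and> g \<in> colorings G L V \<and> (\<exists>v. \<forall>x. x \<noteq> v \<longrightarrow> f x = g x)}"

definition reach :: "'a graph \<Rightarrow> ('a \<Rightarrow> 'c set) \<Rightarrow> ('a \<Rightarrow> 'c) \<Rightarrow> ('a \<Rightarrow> 'c) \<Rightarrow> 'a set \<Rightarrow> bool" where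
  "reach G L f g V \<longleftrightarrow> (restrict f V, restrict g V) \<in> (recol G L V)\<^sup>*"

lemma recoloringsI:
  "f \<in> colorings G L V \<Longrightarrow> g \<in> colorings G L V \<Longrightarrow> (\<And>x. x \<noteq> v \<Longrightarrow> f x = g x) \<Longrightarrow> (f, g) \<in> recol G L V"
  by (auto simp: recol_def)

lemma colorings_verts: "simple_graph G \<Longrightarrow> f \<in> colorings G L (verts G) \<longleftrightarrow> list_coloring G L f"
  unfolding colorings_def list_coloring_def simple_graph_def by fast

lemma recolorings_diff_Id:
  assumes "simple_graph G"
  shows "(f, g) \<in> recol G L (verts G) - Id \<longleftrightarrow>
    list_coloring G L f \<and> list_coloring G L g \<and> adjacent_colorings G f g"
proof -
  have "f \<noteq> g \<and> (\<exists>v. \<forall>x. x \<noteq> v \<longrightarrow> f x = g x) \<longleftrightarrow> adjacent_colorings G f g"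
    if "list_coloring G L f" "list_coloring G L g"
  proof -
    have out: "f x = g x" if "x \<notin> verts G" for x
      using \<open>list_coloring G L f\<close> \<open>list_coloring G L g\<close> that
      by (auto simp: list_coloring_def PiE_iff extensional_def)
    show ?thesis
    proof
      assume "f \<noteq> g \<and> (\<exists>v. \<forall>x. x \<noteq> v \<longrightarrow> f x = g x)"
      then obtain v y where "\<And>x. x \<noteq> v \<Longrightarrow> f x = g x" "f y \<noteq> g y" by (auto simp: fun_eq_iff)
      then show "adjacent_colorings G f g"
        unfolding adjacent_colorings_def using out by metis
    next
      assume "adjacent_colorings G f g"
      then show "f \<noteq> g \<and> (\<exists>v. \<forall>x. x \<noteq> v \<longrightarrow> f x = g x)"
        unfolding adjacent_colorings_def using out by metis
    qed
  qed
  then show ?thesis by (auto simp: recol_def colorings_verts[OF assms])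
qed

lemma restrict_coloring: "list_coloring G L f \<Longrightarrow> restrict f (verts G) = f"
  by (auto simp: list_coloring_def PiE_iff extensional_restrict)

lemma reconfigurable_iff_reachable:
  assumes G: "simple_graph G" and f: "list_coloring G L f" "list_coloring G L g"
  shows "reconfigurable G L f g \<longleftrightarrow> reach G L f g (verts G)"
proof -
  let ?R = "recol G L (verts G) - Id"
  have R: "(recol G L (verts G))\<^sup>* = ?R\<^sup>*" by (simp add: rtrancl_r_diff_Id)
  have "reconfigurable G L f g \<longleftrightarrow> (f, g) \<in> ?R\<^sup>*"
  proof
    assume "reconfigurable G L f g"
    then obtain l s where s: "s 0 = f" "s l = g" "\<And>i. i \<le> l \<Longrightarrow> list_coloring G L (s i)"
      "\<And>i. i < l \<Longrightarrow> adjacent_colorings G (s i) (s (Suc i))"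
      by (auto simp: reconfigurable_def)
    have "(s i, s (Suc i)) \<in> ?R" if "i < l" for i
      using s that by (subst recolorings_diff_Id[OF G]) auto
    with s(1,2) have "(f, g) \<in> ?R ^^ l" by (auto simp: relpow_fun_conv)
    then show "(f, g) \<in> ?R\<^sup>*" by (rule relpow_imp_rtrancl)
  next
    assume "(f, g) \<in> ?R\<^sup>*"
    then obtain l s where s: "s 0 = f" "s l = g" and i: "\<And>i. i < l \<Longrightarrow> (s i, s (Suc i)) \<in> ?R"
      by (auto simp: rtrancl_power relpow_fun_conv)
    from i have i: "\<And>i. i < l \<Longrightarrow> list_coloring G L (s i) \<and> adjacent_colorings G (s i) (s (Suc i))"
      by (subst (asm) recolorings_diff_Id[OF G]) auto
    \<comment> \<open>The steps vouch only for indices below \<open>l\<close>; the last coloring is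
      the given \<open>g\<close>, which also covers \<open>l = 0\<close>.\<close>
    then have "list_coloring G L (s i)" if "i \<le> l" for i
      using that f s by (cases "i = l") auto
    with s i show "reconfigurable G L f g"
      unfolding reconfigurable_def by blast
  qed
  then show ?thesis by (simp add: reach_def R restrict_coloring[OF f(1)] restrict_coloring[OF f(2)])
qed

lemma colorings_restrict:
  assumes "f \<in> colorings G L V" "U \<subseteq> V"
  shows "restrict f U \<in> colorings G L U"
proof -
  have "f v \<noteq> f w" if "v \<in> U" "w \<in> U" "{v, w} \<in> edges G" for v w
    using assms that unfolding colorings_def by blast
  moreover have "f v \<in> L v" if "v \<in> U" for v
    using assms that unfolding colorings_def by blast
  ultimately show ?thesis by (simp add: colorings_def)
qed

lemma recolorings_restrict:
  assumes "(f, g) \<in> (recol G L V)\<^sup>*" "U \<subseteq> V"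
  shows "(restrict f U, restrict g U) \<in> (recol G L U)\<^sup>*"
  using assms(1)
proof (induction rule: rtrancl_induct)
  case (step g h)
  then obtain v where "g \<in> colorings G L V" "h \<in> colorings G L V" "\<And>x. x \<noteq> v \<Longrightarrow> g x = h x"
    by (auto simp: recol_def)
  then have "(restrict g U, restrict h U) \<in> recol G L U"
    using assms(2) by (intro recoloringsI[of _ _ _ _ _ v] colorings_restrict) (auto simp: restrict_def)
  with step.IH show ?case by (rule rtrancl_into_rtrancl)
qed simp

text \<open>Whenever the vertex \<open>p y\<close> changes its color, its twin \<open>y\<close> follows in the next step. This is
  possible since no edge joins \<open>H\<close> to its image under \<open>p\<close>.\<close>

lemma reachable_delete_twin:
  assumes G: "simple_graph G" and H: "H \<subseteq> V" and p: "p ` H \<subseteq> V - H" "inj_on p H"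
    and lab: "\<And>y. y \<in> H \<Longrightarrow> L (p y) = L y \<and> f (p y) = f y \<and> g (p y) = g y"
    and ins: "\<And>y z. y \<in> H \<Longrightarrow> z \<in> H \<Longrightarrow> {y, z} \<in> edges G \<Longrightarrow> {p y, p z} \<in> edges G"
    and out: "\<And>y z. y \<in> H \<Longrightarrow> z \<in> V - H \<Longrightarrow> {y, z} \<in> edges G \<Longrightarrow> z \<notin> p ` H \<and> {p y, z} \<in> edges G"
  shows "reach G L f g V \<longleftrightarrow> reach G L f g (V - H)"
proof
  assume "reach G L f g V"
  from recolorings_restrict[OF this[unfolded reach_def], of "V - H"]
  show "reach G L f g (V - H)" by (simp add: reach_def Int_absorb1 Int_absorb2 Diff_subset)
next
  define ext where "ext f = (\<lambda>z. if z \<in> H then f (p z) else f z)" for f :: "'a \<Rightarrow> 'b"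
  \<comment> \<open>In \<open>h\<close> the vertices outside \<open>H\<close> already show
    \<open>b\<close>, while the copies in \<open>H\<close> still imitate \<open>a\<close>. This is
    proper because an edge leaving \<open>H\<close> never ends in an original, and elsewhere outside
    \<open>H\<close> the colorings \<open>a\<close> and \<open>b\<close> agree. The case
    \<open>a = b\<close> is plain imitation.\<close>
  have ext_colorings: "h \<in> colorings G L V"
    if b: "b \<in> colorings G L (V - H)" and h: "\<And>z. z \<notin> H \<Longrightarrow> h z = b z"
      and hH: "\<And>y. y \<in> H \<Longrightarrow> h y = a (p y)" and a: "a \<in> colorings G L (V - H)"
      and ab: "\<And>z. z \<notin> p ` H \<Longrightarrow> a z = b z" for a b h
  proof -
    have ap: "a (p y) \<noteq> a (p z)" if "y \<in> H" "z \<in> H" "{p y, p z} \<in> edges G" for y z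
      using a p(1) that unfolding colorings_def by blast
    have ap': "a (p y) \<noteq> a z" if "y \<in> H" "z \<in> V - H" "{p y, z} \<in> edges G" for y z
      using a p(1) that unfolding colorings_def by blast
    have 1: "h y \<noteq> h z" if "y \<in> H" "z \<in> V" "{y, z} \<in> edges G" for y z
    proof (cases "z \<in> H")
      case True
      with ins[OF that(1) True that(3)] ap that(1) hH show ?thesis by simp
    next
      case False
      with out[OF that(1) _ that(3)] that have "z \<notin> p ` H" "{p y, z} \<in> edges G" by auto
      with ap'[of y z] that hH h[OF False] ab[of z] False show ?thesis by simp
    qed
    have 3: "b y \<noteq> b z" if "y \<in> V - H" "z \<in> V - H" "{y, z} \<in> edges G" for y z
      using b that unfolding colorings_def by blast
    have 2: "h y \<noteq> h z" if "y \<in> V" "z \<in> V" "{y, z} \<in> edges G" for y z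
      using 1[of y z] 1[of z y] 3[of y z] that h
      by (cases "y \<in> H"; cases "z \<in> H") (simp_all add: insert_commute)
    have L: "h y \<in> L y" if "y \<in> V" for y
    proof (cases "y \<in> H")
      case True
      then have "a (p y) \<in> L (p y)" using a p(1) unfolding colorings_def by blast
      with True lab hH show ?thesis by simp
    next
      case False
      with that b have "b y \<in> L y" unfolding colorings_def by blast
      with False h show ?thesis by simp
    qed
    have und: "h y = undefined" if "y \<notin> V" for y
    proof -
      have "y \<notin> H" using that H by blast
      with b that h show ?thesis by (simp add: colorings_def PiE_iff extensional_def)
    qed
    show ?thesis unfolding colorings_def using 2 L und by (simp add: PiE_iff extensional_def)
  qed
  have ext_reach: "(ext a, ext b) \<in> (recol G L V)\<^sup>*" if "(a, b) \<in> recol G L (V - H)" for a b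
  proof -
    from that obtain v where ab: "a \<in> colorings G L (V - H)" "b \<in> colorings G L (V - H)"
      "\<And>x. x \<noteq> v \<Longrightarrow> a x = b x" by (auto simp: recol_def)
    have ea: "ext a \<in> colorings G L V" by (rule ext_colorings[of a _ a]) (use ab in \<open>auto simp: ext_def\<close>)
    have eb: "ext b \<in> colorings G L V" by (rule ext_colorings[of b _ b]) (use ab in \<open>auto simp: ext_def\<close>)
    show ?thesis
    proof (cases "v \<in> p ` H")
      case False
      then have "ext a x = ext b x" if "x \<noteq> v" for x
        using that ab(3)[of x] ab(3)[of "p x"] False by (auto simp: ext_def)
      with ea eb show ?thesis by (intro r_into_rtrancl recoloringsI[of _ _ _ _ _ v]) simp_all
    next
      case True
      then obtain u where u: "u \<in> H" "p u = v" by auto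
      define h where "h z = (if z \<in> H then a (p z) else b z)" for z
      have h: "h \<in> colorings G L V"
        by (rule ext_colorings[of b _ a]) (use ab True in \<open>auto simp: h_def\<close>)
      have "h x = ext a x" if "x \<noteq> v" for x
        using that ab(3) by (auto simp: h_def ext_def)
      with h ea have "(ext a, h) \<in> recol G L V" by (intro recoloringsI[of _ _ _ _ _ v]) simp_all
      \<comment> \<open>By injectivity of \<open>p\<close>, the vertex \<open>u\<close> is the only
        copy that has to follow \<open>v\<close>.\<close>
      moreover have "h x = ext b x" if "x \<noteq> u" for x
        using that ab(3) u inj_onD[OF p(2), of x u] by (auto simp: h_def ext_def)
      with h eb have "(h, ext b) \<in> recol G L V" by (intro recoloringsI[of _ _ _ _ _ u]) simp_all
      ultimately show ?thesis by (blast intro: rtrancl_into_rtrancl)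
    qed
  qed
  have ext_rtrancl: "(ext a, ext b) \<in> (recol G L V)\<^sup>*" if "(a, b) \<in> (recol G L (V - H))\<^sup>*" for a b
    using that
  proof (induction rule: rtrancl_induct)
    case (step b c)
    from rtrancl_trans[OF step.IH ext_reach[OF step.hyps(2)]] show ?case .
  qed simp
  have "ext (restrict f (V - H)) = restrict f V" if "\<And>y. y \<in> H \<Longrightarrow> f (p y) = f y" for f :: "'a \<Rightarrow> 'b"
  proof
    fix x
    show "ext (restrict f (V - H)) x = restrict f V x"
    proof (cases "x \<in> H")
      case True
      then have "p x \<in> V - H" "x \<in> V" using p(1) H by auto
      with True that show ?thesis by (simp add: ext_def)
    next
      case False
      then show ?thesis by (simp add: ext_def)
    qed
  qed
  moreover assume "reach G L f g (V - H)"
  ultimately show "reach G L f g V"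
    using ext_rtrancl lab unfolding reach_def by metis
qed

section \<open>Existence of the MD-tree\<close>

lemma simple_graph_edge:
  assumes "simple_graph G" "{v, w} \<in> edges G"
  shows "v \<in> verts G" "w \<in> verts G" "v \<noteq> w"
  using assms by (auto simp: simple_graph_def)

lemma simple_graph_edgeE:
  assumes "simple_graph G" "e \<in> edges G"
  obtains v w where "e = {v, w}" "v \<in> verts G" "w \<in> verts G" "v \<noteq> w"
proof -
  have "card e = 2" "e \<subseteq> verts G" using assms by (auto simp: simple_graph_def)
  then show ?thesis using that by (auto simp: card_2_iff)
qed

lemma is_module_iff:
  "is_module G M \<longleftrightarrow> M \<subseteq> verts G \<and>
     (\<forall>v\<in>M. \<forall>w\<in>M. \<forall>z. z \<notin> M \<longrightarrow> ({v, z} \<in> edges G \<longleftrightarrow> {w, z} \<in> edges G))"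
proof -
  have "neighbours G v - M = neighbours G w - M \<longleftrightarrow>
      (\<forall>z. z \<notin> M \<longrightarrow> ({v, z} \<in> edges G \<longleftrightarrow> {w, z} \<in> edges G))" for v w
    by (auto simp: neighbours_def set_eq_iff)
  then show ?thesis by (simp add: is_module_def)
qed

lemma is_moduleD:
  "is_module G M \<Longrightarrow> v \<in> M \<Longrightarrow> w \<in> M \<Longrightarrow> z \<notin> M \<Longrightarrow> {v, z} \<in> edges G \<longleftrightarrow> {w, z} \<in> edges G"
  unfolding is_module_iff by blast

section \<open>Induced graphs, connectedness and modular quotients\<close>

definition induced :: "'a graph \<Rightarrow> 'a set \<Rightarrow> 'a graph" where
  "induced G M = \<lparr>verts = M, edges = {e \<in> edges G. e \<subseteq> M}\<rparr>"

lemma induced_simps [simp]: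
  "verts (induced G M) = M" "{v, w} \<in> edges (induced G M) \<longleftrightarrow> {v, w} \<in> edges G \<and> v \<in> M \<and> w \<in> M"
  by (auto simp: induced_def)

lemma simple_induced: "simple_graph G \<Longrightarrow> M \<subseteq> verts G \<Longrightarrow> simple_graph (induced G M)"
  by (auto simp: simple_graph_def induced_def intro: finite_subset)

lemma induced_verts: "simple_graph G \<Longrightarrow> induced G (verts G) = G"
  by (cases G) (auto simp: simple_graph_def induced_def)

text \<open>The flag \<open>b\<close> selects the graph (\<open>True\<close>) or its complement (\<open>False\<close>).\<close>

definition related :: "'a graph \<Rightarrow> bool \<Rightarrow> 'a \<Rightarrow> 'a \<Rightarrow> bool" where
  "related G b x y \<longleftrightarrow> x \<noteq> y \<and> ({x, y} \<in> edges G) = b"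

text \<open>Connectedness in the form of cuts, since the proofs need a pair crossing a given set
  rather than paths.\<close>

definition conn_by :: "'a graph \<Rightarrow> bool \<Rightarrow> bool" where
  "conn_by G b \<longleftrightarrow> (\<forall>X \<subseteq> verts G. X \<noteq> {} \<longrightarrow> X \<noteq> verts G \<longrightarrow> (\<exists>x\<in>X. \<exists>y\<in>verts G - X. related G b x y))"

lemma conn_byE:
  assumes "conn_by G b" "X \<subseteq> verts G" "X \<noteq> {}" "X \<noteq> verts G"
  obtains x y where "x \<in> X" "y \<in> verts G" "y \<notin> X" "related G b x y"
  using assms unfolding conn_by_def by blast

definition modular_partition :: "'a graph \<Rightarrow> 'a set list \<Rightarrow> bool" where
  "modular_partition G Ms \<longleftrightarrow> (\<forall>M\<in>set Ms. is_module G M \<and> M \<noteq> {}) \<and> \<Union> (set Ms) = verts G \<and>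
     (\<forall>i<length Ms. \<forall>j<length Ms. i \<noteq> j \<longrightarrow> Ms ! i \<inter> Ms ! j = {})"

definition quot :: "'a graph \<Rightarrow> 'a set list \<Rightarrow> nat graph" where
  "quot G Ms = \<lparr>verts = {..<length Ms},
     edges = {{i, j} | i j. i < length Ms \<and> j < length Ms \<and> i \<noteq> j \<and>
       (\<exists>v\<in>Ms ! i. \<exists>w\<in>Ms ! j. {v, w} \<in> edges G)}\<rparr>"

lemma verts_quot [simp]: "verts (quot G Ms) = {..<length Ms}"
  by (simp add: quot_def)

lemma simple_quot: "simple_graph (quot G Ms)"
  by (auto simp: simple_graph_def quot_def card_2_iff)

lemma partition_index:
  assumes "modular_partition G Ms" "v \<in> verts G"
  obtains i where "i < length Ms" "v \<in> Ms ! i"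
  using assms by (auto simp: modular_partition_def) (metis UnionE in_set_conv_nth)

text \<open>Between two disjoint modules adjacency does not depend on the chosen vertices: move one
  endpoint within its module, then the other.\<close>

lemma quot_edge:
  assumes P: "modular_partition G Ms" and ij: "i < length Ms" "j < length Ms" "i \<noteq> j"
    and vw: "v \<in> Ms ! i" "w \<in> Ms ! j"
  shows "{i, j} \<in> edges (quot G Ms) \<longleftrightarrow> {v, w} \<in> edges G"
proof
  assume "{v, w} \<in> edges G"
  with ij vw show "{i, j} \<in> edges (quot G Ms)" by (auto simp: quot_def)
next
  have M: "is_module G (Ms ! i)" "is_module G (Ms ! j)"
    and disj: "Ms ! i \<inter> Ms ! j = {}"
    using P ij by (auto simp: modular_partition_def)
  assume "{i, j} \<in> edges (quot G Ms)"
  then obtain v' w' where v'w': "v' \<in> Ms ! i" "w' \<in> Ms ! j" "{v', w'} \<in> edges G"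
    using ij by (auto simp: quot_def doubleton_eq_iff insert_commute)
  have "{v, w'} \<in> edges G"
    using is_moduleD[OF M(1) vw(1) v'w'(1)] v'w' disj by blast
  then show "{v, w} \<in> edges G"
    using is_moduleD[OF M(2) vw(2) v'w'(2), of v] vw disj by (auto simp: insert_commute)
qed

section \<open>Graphs of substitution trees\<close>

lemma verts_tree_Node:
  "verts Q = {..<length ts} \<Longrightarrow>
    verts (tree_graph (Node Q ts)) = (\<Union>i<length ts. verts (tree_graph (ts ! i)))"
  by (auto simp: substitution_def)

lemma edges_tree_Node:
  assumes "verts Q = {..<length ts}"
  shows "e \<in> edges (tree_graph (Node Q ts)) \<longleftrightarrow> (\<exists>i<length ts. e \<in> edges (tree_graph (ts ! i))) \<or>
    (\<exists>i<length ts. \<exists>j<length ts. {i, j} \<in> edges Q \<and>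
      (\<exists>v\<in>verts (tree_graph (ts ! i)). \<exists>w\<in>verts (tree_graph (ts ! j)). e = {v, w}))"
  using assms by (simp add: substitution_def) fastforce

lemma tree_verts_nonempty: "substitution_tree t \<Longrightarrow> verts (tree_graph t) \<noteq> {}"
proof (induction t)
  case (Node Q ts)
  then have "verts (tree_graph (ts ! 0)) \<noteq> {}" "0 < length ts" "verts Q = {..<length ts}"
    by (cases ts; simp)+
  then show ?case by (subst verts_tree_Node) auto
qed simp

lemma simple_tree_graph: "substitution_tree t \<Longrightarrow> simple_graph (tree_graph t)"
proof (induction t)
  case (Leaf v)
  then show ?case by (simp add: simple_graph_def)
next
  case (Node Q ts)
  have Q: "verts Q = {..<length ts}" "simple_graph Q"
    and disj: "\<And>i j. i < length ts \<Longrightarrow> j < length ts \<Longrightarrow> i \<noteq> j \<Longrightarrow>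
      verts (tree_graph (ts ! i)) \<inter> verts (tree_graph (ts ! j)) = {}"
    and IH: "\<And>i. i < length ts \<Longrightarrow> simple_graph (tree_graph (ts ! i))"
    using Node by auto
  have "e \<subseteq> verts (tree_graph (Node Q ts)) \<and> card e = 2" if e: "e \<in> edges (tree_graph (Node Q ts))" for e
    using e unfolding edges_tree_Node[OF Q(1)] verts_tree_Node[OF Q(1)]
  proof
    assume "\<exists>i<length ts. e \<in> edges (tree_graph (ts ! i))"
    then show "e \<subseteq> (\<Union>i<length ts. verts (tree_graph (ts ! i))) \<and> card e = 2"
      using IH unfolding simple_graph_def by blast
  next
    assume "\<exists>i<length ts. \<exists>j<length ts. {i, j} \<in> edges Q \<and>
      (\<exists>v\<in>verts (tree_graph (ts ! i)). \<exists>w\<in>verts (tree_graph (ts ! j)). e = {v, w})"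
    then obtain i j v w where ij: "i < length ts" "j < length ts" "{i, j} \<in> edges Q"
      "v \<in> verts (tree_graph (ts ! i))" "w \<in> verts (tree_graph (ts ! j))" "e = {v, w}" by blast
    then have "v \<noteq> w" using disj[OF ij(1,2)] simple_graph_edge(3)[OF Q(2) ij(3)] by auto
    with ij show "e \<subseteq> (\<Union>i<length ts. verts (tree_graph (ts ! i))) \<and> card e = 2" by auto
  qed
  moreover have "finite (verts (tree_graph (Node Q ts)))"
    unfolding verts_tree_Node[OF Q(1)] using IH by (auto simp: simple_graph_def)
  ultimately show ?case unfolding simple_graph_def by blast
qed

lemma complete_graphD:
  "complete_graph G \<Longrightarrow> u \<in> verts G \<Longrightarrow> v \<in> verts G \<Longrightarrow> u \<noteq> v \<Longrightarrow> {u, v} \<in> edges G"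
  by (simp add: complete_graph_def)

text \<open>No related pair leaves the vertex set of the first child. The lemma serves to show that
  nodes of equal type are not adjacent: a child whose graph is connected cannot be parallel, and
  dually for series.\<close>

lemma parallel_series_not_connected:
  assumes t: "substitution_tree t" and b: "if b then parallel_node t else series_node t"
  shows "\<not> conn_by (tree_graph t) b"
proof
  assume conn_by: "conn_by (tree_graph t) b"
  obtain Q ts where N: "t = Node Q ts" using b by (cases t) (auto split: if_splits)
  have len: "2 \<le> length ts" and Q: "verts Q = {..<length ts}"
    and disj: "\<And>i j. i < length ts \<Longrightarrow> j < length ts \<Longrightarrow> i \<noteq> j \<Longrightarrow>
      verts (tree_graph (ts ! i)) \<inter> verts (tree_graph (ts ! j)) = {}"
    and ch: "\<And>i. i < length ts \<Longrightarrow> substitution_tree (ts ! i)"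
    using t N by auto
  let ?X = "verts (tree_graph (ts ! 0))"
  have ne: "?X \<noteq> {}" "verts (tree_graph (ts ! 1)) \<noteq> {}"
    using len by (auto intro!: tree_verts_nonempty ch)
  have sub: "verts (tree_graph (ts ! i)) \<subseteq> verts (tree_graph t)" if "i < length ts" for i
    unfolding N verts_tree_Node[OF Q] using that by auto
  have "?X \<subseteq> verts (tree_graph t)" using len by (intro sub) auto
  moreover have "verts (tree_graph (ts ! 1)) \<subseteq> verts (tree_graph t)" using len by (intro sub) auto
  moreover have "?X \<inter> verts (tree_graph (ts ! 1)) = {}" using len by (intro disj) auto
  ultimately obtain x y where xy: "x \<in> ?X" "y \<in> verts (tree_graph t)" "y \<notin> ?X" "related (tree_graph t) b x y"
    using ne by (elim conn_byE[OF conn_by, of ?X]) blast+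
  then obtain j where j: "j < length ts" "y \<in> verts (tree_graph (ts ! j))" "j \<noteq> 0"
    unfolding N verts_tree_Node[OF Q] by auto
  show False
  proof (cases b)
    case True
    then have e: "{x, y} \<in> edges (tree_graph (Node Q ts))" and "edges Q = {}"
      using xy(4) b N by (auto simp: related_def edgeless_graph_def)
    then obtain i where i: "i < length ts" "{x, y} \<in> edges (tree_graph (ts ! i))"
      unfolding edges_tree_Node[OF Q] by auto
    then have "x \<in> verts (tree_graph (ts ! i))" "y \<in> verts (tree_graph (ts ! i))"
      using simple_graph_edge[OF simple_tree_graph[OF ch[OF i(1)]]] by auto
    moreover have "ts \<noteq> []" using len by auto
    ultimately show False using disj[of 0 i] i(1) xy by (cases "i = 0") auto
  next
    case False
    then have "{0, j} \<in> edges Q"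
      using complete_graphD[of Q 0 j] b N j Q by (cases ts) simp_all
    then have "{x, y} \<in> edges (tree_graph (Node Q ts))"
      unfolding edges_tree_Node[OF Q] using xy(1) j len
      by (intro disjI2) (metis less_le_trans zero_less_numeral)
    then show False using xy(4) False N by (simp add: related_def)
  qed
qed

lemma md_tree_Node:
  assumes G: "simple_graph G" and P: "modular_partition G Ms" and len: "2 \<le> length Ms" "length ts = length Ms"
    and ch: "\<And>i. i < length Ms \<Longrightarrow> md_tree (induced G (Ms ! i)) (ts ! i)"
    and lab: "series_node (Node (quot G Ms) ts) \<or> parallel_node (Node (quot G Ms) ts) \<or>
      prime_node (Node (quot G Ms) ts)"
    "series_node (Node (quot G Ms) ts) \<Longrightarrow> \<forall>t\<in>set ts. \<not> series_node t"
    "parallel_node (Node (quot G Ms) ts) \<Longrightarrow> \<forall>t\<in>set ts. \<not> parallel_node t"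
  shows "md_tree G (Node (quot G Ms) ts)"
proof -
  let ?t = "Node (quot G Ms) ts"
  have g: "\<And>i. i < length Ms \<Longrightarrow> tree_graph (ts ! i) = induced G (Ms ! i)"
    and s: "\<And>t. t \<in> set ts \<Longrightarrow> substitution_tree t \<and> md_labelled t"
    using ch len by (auto simp: md_tree_def in_set_conv_nth)
  have Q: "verts (quot G Ms) = {..<length ts}" using len by simp
  have "verts (tree_graph ?t) = verts G"
  proof -
    have "(\<Union>i<length ts. verts (tree_graph (ts ! i))) = (\<Union>i<length Ms. Ms ! i)"
      using len g by auto
    also have "\<dots> = \<Union> (set Ms)" by (auto simp: set_conv_nth) 
    also have "\<dots> = verts G" using P by (simp add: modular_partition_def)
    finally show ?thesis unfolding verts_tree_Node[OF Q] .
  qed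
  moreover have "e \<in> edges (tree_graph ?t) \<longleftrightarrow> e \<in> edges G" for e
  proof
    assume "e \<in> edges (tree_graph ?t)"
    then show "e \<in> edges G"
      unfolding edges_tree_Node[OF Q]
    proof
      assume "\<exists>i<length ts. e \<in> edges (tree_graph (ts ! i))"
      then show ?thesis using g len by (auto simp: induced_def)
    next
      assume "\<exists>i<length ts. \<exists>j<length ts. {i, j} \<in> edges (quot G Ms) \<and>
        (\<exists>v\<in>verts (tree_graph (ts ! i)). \<exists>w\<in>verts (tree_graph (ts ! j)). e = {v, w})"
      then obtain i j v w where ij: "i < length Ms" "j < length Ms" "{i, j} \<in> edges (quot G Ms)"
        "v \<in> Ms ! i" "w \<in> Ms ! j" "e = {v, w}" using g len by auto
      then show ?thesis
        using quot_edge[OF P ij(1,2) _ ij(4,5)] simple_graph_edge(3)[OF simple_quot ij(3)] by simp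
    qed
  next
    assume e: "e \<in> edges G"
    then obtain v w where vw: "e = {v, w}" "v \<in> verts G" "w \<in> verts G"
      by (rule simple_graph_edgeE[OF G])
    from vw(2,3) obtain i j where ij: "i < length Ms" "v \<in> Ms ! i" "j < length Ms" "w \<in> Ms ! j"
      by (meson partition_index[OF P])
    show "e \<in> edges (tree_graph ?t)"
    proof (cases "i = j")
      case True
      then have "e \<in> edges (tree_graph (ts ! i))" using g ij vw e by simp
      then show ?thesis unfolding edges_tree_Node[OF Q] using ij len by auto
    next
      case False
      then have "{i, j} \<in> edges (quot G Ms)"
        using quot_edge[OF P ij(1,3) _ ij(2,4)] e vw by simp
      moreover have "v \<in> verts (tree_graph (ts ! i))" "w \<in> verts (tree_graph (ts ! j))"
        using g ij by auto
      ultimately show ?thesis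
        unfolding edges_tree_Node[OF Q] using ij len vw(1) by (intro disjI2) metis
    qed
  qed
  ultimately have "tree_graph ?t = G" by (intro graph.equality) (auto simp del: tree_graph.simps)
  moreover have "substitution_tree ?t"
    using len s g P simple_quot by (auto simp: modular_partition_def)
  moreover have "md_labelled ?t"
    using lab s by auto
  ultimately show ?thesis by (simp add: md_tree_def)
qed

text \<open>The parts are the components of the graph or of its complement, as classes of the
  reflexive transitive closure. They are modules because an outside vertex is adjacent to no vertex
  of a component, respectively to all of them.\<close>

lemma connected_partition:
  assumes G: "simple_graph G" and nc: "\<not> conn_by G b"
  obtains Ms where "modular_partition G Ms" "2 \<le> length Ms"
    "\<And>i. i < length Ms \<Longrightarrow> conn_by (induced G (Ms ! i)) b"
    "\<And>i j. i < length Ms \<Longrightarrow> j < length Ms \<Longrightarrow> i \<noteq> j \<Longrightarrow> ({i, j} \<in> edges (quot G Ms)) = (\<not> b)"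
proof -
  let ?V = "verts G"
  define r where "r = {(x, y). x \<in> ?V \<and> y \<in> ?V \<and> related G b x y}"
  define E where "E = r\<^sup>* \<inter> ?V \<times> ?V"
  have "sym r" by (auto simp: r_def sym_def related_def insert_commute)
  then have "sym (r\<^sup>*)" by (rule sym_rtrancl)
  then have eq: "equiv ?V E"
    by (auto simp: E_def equiv_def refl_on_def sym_def trans_def)
  have fin: "finite (?V // E)"
    using G by (intro finite_quotient) (auto simp: simple_graph_def E_def)
  then obtain Ms where Ms: "set Ms = ?V // E" "distinct Ms" using finite_distinct_list by blast
  have U: "\<Union> (set Ms) = ?V" using Union_quotient[OF eq] Ms by simp
  have disj: "Ms ! i \<inter> Ms ! j = {}" if "i < length Ms" "j < length Ms" "i \<noteq> j" for i j
    using quotient_disj[OF eq, of "Ms ! i" "Ms ! j"] that Ms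
    by (metis nth_eq_iff_index_eq nth_mem)
  have ne: "M \<noteq> {}" if "M \<in> set Ms" for M
    using that Ms in_quotient_imp_non_empty[OF eq] by auto
  have closed: "y \<in> M" if "M \<in> set Ms" "x \<in> M" "y \<in> ?V" "related G b x y" for M x y
  proof -
    have "x \<in> ?V" using that U by auto
    with that have "(x, y) \<in> E" by (auto simp: E_def r_def)
    with that show ?thesis using Ms in_quotient_imp_closed[OF eq] by metis
  qed
  have modl: "is_module G M" if M: "M \<in> set Ms" for M
    unfolding is_module_iff
  proof (intro conjI ballI allI impI)
    show "M \<subseteq> ?V" using U M by auto
    fix v w z assume vwz: "v \<in> M" "w \<in> M" "z \<notin> M"
    show "({v, z} \<in> edges G) = ({w, z} \<in> edges G)"
    proof (cases "z \<in> ?V")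
      case True
      with closed[OF M _ True] vwz show ?thesis unfolding related_def by metis
    next
      case False
      then show ?thesis using simple_graph_edge[OF G] by blast
    qed
  qed
  have P: "modular_partition G Ms"
    using modl ne U disj by (auto simp: modular_partition_def)
  have cn: "conn_by (induced G M) b" if M: "M \<in> set Ms" for M
    unfolding conn_by_def
  proof (intro allI impI)
    fix X assume X: "X \<subseteq> verts (induced G M)" "X \<noteq> {}" "X \<noteq> verts (induced G M)"
    then obtain x y where xy: "x \<in> X" "y \<in> M" "y \<notin> X" by auto
    have "(x, y) \<in> E" using in_quotient_imp_in_rel[OF eq, of M x y] M Ms xy X by auto
    then have "(x, y) \<in> r\<^sup>*" by (simp add: E_def)
    \<comment> \<open>A path from \<open>x\<close> in \<open>X\<close> to \<open>y\<close> outside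
      \<open>X\<close> contains a step that crosses the boundary.\<close>
    then have "y \<notin> X \<longrightarrow> (\<exists>u v. (x, u) \<in> r\<^sup>* \<and> (u, v) \<in> r \<and> u \<in> X \<and> v \<notin> X)"
      by (induction rule: rtrancl_induct) (use xy in blast)+
    with xy obtain u v where uv: "u \<in> X" "v \<notin> X" "(u, v) \<in> r" by blast
    then have "v \<in> M" using closed[OF M, of u v] X by (auto simp: r_def)
    moreover have "u \<in> M" "related G b u v" using uv X by (auto simp: r_def)
    ultimately have "v \<in> verts (induced G M) - X" "related (induced G M) b u v"
      using uv by (auto simp: related_def)
    with uv(1) show "\<exists>x\<in>X. \<exists>y\<in>verts (induced G M) - X. related (induced G M) b x y" by blast
  qed
  have len: "2 \<le> length Ms"
  proof (rule ccontr)
    assume "\<not> 2 \<le> length Ms"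
    moreover have "?V \<noteq> {}" using nc by (auto simp: conn_by_def)
    ultimately obtain M where M: "Ms = [M]" using U
      by (cases Ms; cases "tl Ms") auto
    then have "M = ?V" using U by simp
    then have "conn_by G b" using cn[of M] M induced_verts[OF G] by simp
    with nc show False ..
  qed
  have "({i, j} \<in> edges (quot G Ms)) = (\<not> b)" if ij: "i < length Ms" "j < length Ms" "i \<noteq> j" for i j
  proof -
    obtain v w where vw: "v \<in> Ms ! i" "w \<in> Ms ! j" using ne[of "Ms ! i"] ne[of "Ms ! j"] ij by auto
    then have "v \<noteq> w" "w \<notin> Ms ! i" "w \<in> ?V" using disj[OF ij] U ij by (auto intro: nth_mem)
    then have "({v, w} \<in> edges G) \<noteq> b"
      using closed[of "Ms ! i" v w] ij vw by (auto simp: related_def)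
    then show ?thesis using quot_edge[OF P ij vw] by auto
  qed
  with P len cn show ?thesis by (intro that) auto
qed

section \<open>Graphs that are connected and have a connected complement\<close>

lemma is_module_Un:
  assumes "is_module G M" "is_module G N" "M \<inter> N \<noteq> {}"
  shows "is_module G (M \<union> N)"
proof -
  obtain x where x: "x \<in> M" "x \<in> N" using assms(3) by auto
  have "({v, z} \<in> edges G) = ({x, z} \<in> edges G)" if "v \<in> M \<union> N" "z \<notin> M \<union> N" for v z
    using that is_moduleD[OF assms(1) _ x(1), of v z] is_moduleD[OF assms(2) _ x(2), of v z] by auto
  moreover have "M \<union> N \<subseteq> verts G" using assms(1,2) by (simp add: is_module_iff)
  ultimately show ?thesis unfolding is_module_iff by simp
qed

text \<open>If two overlapping proper modules covered everything, all pairs between \<open>M\<close>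
  and its complement would behave like \<open>m1\<close>, \<open>x0\<close>: first the end in
  \<open>M\<close> is moved to \<open>m1\<close>, which is outside \<open>N\<close>, then the other
  end is moved to \<open>x0\<close> within \<open>N\<close>. The cut at \<open>M\<close> would
  consist of edges only or of non-edges only.\<close>

lemma modules_not_cover:
  assumes c: "conn_by G True" "conn_by G False" and M: "is_module G M" "is_module G N"
    and ne: "M \<inter> N \<noteq> {}" "M \<noteq> verts G" "N \<noteq> verts G"
  shows "M \<union> N \<noteq> verts G"
proof
  assume U: "M \<union> N = verts G"
  obtain m0 where m0: "m0 \<in> M" "m0 \<in> N" using ne by auto
  obtain m1 where m1: "m1 \<in> M" "m1 \<notin> N" using U ne M by (auto simp: is_module_iff)
  obtain x0 where x0: "x0 \<in> N" "x0 \<notin> M" using U ne M by (auto simp: is_module_iff)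
  have *: "({m, x} \<in> edges G) = ({m1, x0} \<in> edges G)" if "m \<in> M" "x \<in> verts G" "x \<notin> M" for m x
  proof -
    have "({m, x} \<in> edges G) = ({m1, x} \<in> edges G)"
      by (rule is_moduleD[OF M(1)]) (use that m1 in auto)
    also have "\<dots> = ({m1, x0} \<in> edges G)"
      using is_moduleD[OF M(2), of x x0 m1] that U x0 m1 by (auto simp: insert_commute)
    finally show ?thesis .
  qed
  have "M \<subseteq> verts G" "M \<noteq> {}" using M m0 by (auto simp: is_module_iff)
  with c ne(2) have "\<exists>x\<in>M. \<exists>y\<in>verts G - M. related G b x y" for b
    by (cases b) (auto simp: conn_by_def)
  from this[of True] this[of False] show False
    using * by (auto simp: related_def)
qed

text \<open>The parts are the maximal proper modules. Two that meet have a union which is again a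
  proper module, so they coincide. A module of the quotient unites to a module of \<open>G\<close>;
  by maximality this is a single part or everything, so the quotient is prime.\<close>

lemma prime_partition:
  assumes G: "simple_graph G" and c: "conn_by G True" "conn_by G False" and card: "2 \<le> card (verts G)"
  obtains Ms where "modular_partition G Ms" "4 \<le> length Ms" "prime_graph (quot G Ms)"
    "\<not> complete_graph (quot G Ms)" "\<not> edgeless_graph (quot G Ms)"
proof -
  let ?V = "verts G"
  have finV: "finite ?V" using G by (simp add: simple_graph_def)
  define \<M> where "\<M> = {M. is_module G M \<and> M \<noteq> {} \<and> M \<noteq> ?V}"
  have sub: "\<M> \<subseteq> Pow ?V" by (auto simp: \<M>_def is_module_def)
  then have fin: "finite \<M>" using finV by (meson finite_Pow_iff finite_subset)
  define \<X> where "\<X> = {M \<in> \<M>. \<forall>N\<in>\<M>. M \<subseteq> N \<longrightarrow> N = M}"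
  have "finite \<X>" using fin by (simp add: \<X>_def)
  then obtain Ms where Ms: "set Ms = \<X>" "distinct Ms" using finite_distinct_list by blast
  have disj: "M = N" if "M \<in> \<X>" "N \<in> \<X>" "M \<inter> N \<noteq> {}" for M N
  proof -
    have MN: "is_module G M" "is_module G N" "M \<noteq> ?V" "N \<noteq> ?V"
      using that by (auto simp: \<X>_def \<M>_def)
    have "M \<union> N \<in> \<M>"
      using is_module_Un[OF MN(1,2) that(3)] modules_not_cover[OF c MN(1,2) that(3) MN(3,4)] that(3)
      by (auto simp: \<M>_def)
    moreover have "N' = M" if "N' \<in> \<M>" "M \<subseteq> N'" for N' using that \<open>M \<in> \<X>\<close> by (simp add: \<X>_def)
    moreover have "N' = N" if "N' \<in> \<M>" "N \<subseteq> N'" for N' using that \<open>N \<in> \<X>\<close> by (simp add: \<X>_def)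
    ultimately show ?thesis by (metis Un_upper1 Un_upper2)
  qed
  have U: "\<Union> (set Ms) = ?V"
  proof
    show "\<Union> (set Ms) \<subseteq> ?V" using sub by (auto simp: Ms \<X>_def)
    show "?V \<subseteq> \<Union> (set Ms)"
    proof
      fix v assume v: "v \<in> ?V"
      then have "{v} \<in> \<M>" using card by (cases "verts G = {v}") (auto simp: \<M>_def is_module_iff)
      from finite_has_maximal2[OF fin this] obtain M where
        M: "M \<in> \<M>" "{v} \<subseteq> M" "\<And>N. N \<in> \<M> \<Longrightarrow> M \<subseteq> N \<Longrightarrow> M = N"
        by metis
      then have "M \<in> \<X>" by (auto simp: \<X>_def)
      with M(2) show "v \<in> \<Union> (set Ms)" by (auto simp: Ms)
    qed
  qed
  have P: "modular_partition G Ms"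
    unfolding modular_partition_def
  proof (intro conjI allI impI)
    show "\<forall>M\<in>set Ms. is_module G M \<and> M \<noteq> {}" by (auto simp: Ms \<X>_def \<M>_def)
    fix i j assume "i < length Ms" "j < length Ms" "i \<noteq> j"
    then show "Ms ! i \<inter> Ms ! j = {}"
      using disj Ms by (metis nth_eq_iff_index_eq nth_mem)
  qed (rule U)
  \<comment> \<open>A part is a proper nonempty set, so connectedness of the graph and of its
    complement lets both an edge and a non-edge leave it.\<close>
  have cut: "\<exists>j<length Ms. j \<noteq> i \<and> ({i, j} \<in> edges (quot G Ms)) = b" if i: "i < length Ms" for i b
  proof -
    have "Ms ! i \<in> \<M>" using i Ms nth_mem[OF i] by (auto simp: \<X>_def)
    then obtain x y where xy: "x \<in> Ms ! i" "y \<in> ?V" "y \<notin> Ms ! i" "related G b x y"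
      using conn_byE[of G b "Ms ! i"] c sub by (cases b) (auto simp: \<M>_def is_module_def)
    obtain j where j: "j < length Ms" "y \<in> Ms ! j" using partition_index[OF P xy(2)] .
    have "i \<noteq> j" using j xy by auto
    with quot_edge[OF P i j(1) _ xy(1) j(2)] xy(4) j(1) show ?thesis by (auto simp: related_def)
  qed
  have pos: "0 < length Ms" using U card by (cases Ms) auto
  have len: "4 \<le> length Ms"
  proof (rule ccontr)
    assume "\<not> 4 \<le> length Ms"
    then consider "length Ms = 1" | "length Ms = 2" | "length Ms = 3" using pos by linarith
    then show False
    proof cases
      case 1
      then show False using cut[of 0 True] by simp
    next
      case 2
      then show False using cut[of 0 True] cut[of 0 False] by (auto simp: less_2_cases_iff)
    next
      case 3
      let ?e = "\<lambda>i j. {i, j} \<in> edges (quot G Ms)"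
      have l3: "j < 3 \<longleftrightarrow> j = 0 \<or> j = 1 \<or> j = 2" for j :: nat by auto
      have A: "?e 0 1 = b \<or> ?e 0 2 = b" for b
        using cut[of 0 b] unfolding 3 l3 by auto
      have B: "?e 0 1 = b \<or> ?e 1 2 = b" for b
        using cut[of 1 b] unfolding 3 l3 by (auto simp: insert_commute)
      have C: "?e 0 2 = b \<or> ?e 1 2 = b" for b
        using cut[of 2 b] unfolding 3 l3 by (auto simp: insert_commute)
      \<comment> \<open>Any two of the three pairs share a node and so would have to differ in
        adjacency, which two truth values do not allow.\<close>
      show False
        using A[of True] A[of False] B[of True] B[of False] C[of True] C[of False] by blast
    qed
  qed
  have "prime_graph (quot G Ms)"
    unfolding prime_graph_def
  proof (intro allI impI)
    fix I assume I: "is_module (quot G Ms) I"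
    then have Isub: "I \<subseteq> {..<length Ms}" by (auto simp: is_module_iff)
    let ?U = "\<Union>i\<in>I. Ms ! i"
    have "is_module G ?U"
      unfolding is_module_iff
    proof (intro conjI ballI allI impI)
      show "?U \<subseteq> ?V" using U Isub nth_mem by fastforce
      fix v w z assume v: "v \<in> ?U" and w: "w \<in> ?U" and z: "z \<notin> ?U"
      obtain i j where ij: "i \<in> I" "v \<in> Ms ! i" "j \<in> I" "w \<in> Ms ! j" using v w by auto
      then have l: "i < length Ms" "j < length Ms" using Isub by auto
      show "({v, z} \<in> edges G) = ({w, z} \<in> edges G)"
      proof (cases "z \<in> ?V")
        case True
        then obtain k where k: "k < length Ms" "z \<in> Ms ! k" using partition_index[OF P] by blast
        then have "k \<notin> I" using z by auto
        then show ?thesis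
          using quot_edge[OF P l(1) k(1) _ ij(2) k(2)] quot_edge[OF P l(2) k(1) _ ij(4) k(2)]
            is_moduleD[OF I ij(1,3)] ij by blast
      next
        case False
        then show ?thesis using simple_graph_edge[OF G] by blast
      qed
    qed
    show "trivial_module (quot G Ms) I"
    proof (cases "I = {}")
      case False
      then obtain i where i: "i \<in> I" by auto
      then have il: "i < length Ms" using Isub by auto
      have mi: "Ms ! i \<in> \<X>" using il Ms by (metis nth_mem)
      then have ne: "?U \<noteq> {}" using i by (auto simp: \<X>_def \<M>_def)
      have sub1: "k = i" if "k \<in> I" "?U = Ms ! i" for k
      proof -
        have k: "k < length Ms" using that Isub by auto
        have "Ms ! k \<noteq> {}" using Ms nth_mem[OF k] by (auto simp: \<X>_def \<M>_def)
        moreover have "Ms ! k \<subseteq> Ms ! i" using that by blast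
        ultimately have "Ms ! k \<inter> Ms ! i \<noteq> {}" by blast
        then show ?thesis using P k il unfolding modular_partition_def by blast
      qed
      show ?thesis
      proof (cases "?U = ?V")
        case True
        have "k \<in> I" if k: "k < length Ms" for k
        proof -
          obtain x where x: "x \<in> Ms ! k" using P k by (fastforce simp: modular_partition_def)
          then have "x \<in> ?V" using U nth_mem[OF k] by blast
          then obtain j where j: "j \<in> I" "x \<in> Ms ! j" using True by blast
          then have "Ms ! j \<inter> Ms ! k \<noteq> {}" "j < length Ms" using x Isub by auto
          then have "j = k" using P k unfolding modular_partition_def by blast
          with j show ?thesis by simp
        qed
        then show ?thesis using Isub by (auto simp: trivial_module_def)
      next
        case False
        then have "?U \<in> \<M>" using \<open>is_module G ?U\<close> ne by (simp add: \<M>_def)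
        moreover have "Ms ! i \<subseteq> ?U" using i by auto
        ultimately have U_i: "?U = Ms ! i" using mi unfolding \<X>_def by blast
        have "I = {i}" using sub1[OF _ U_i] i by blast
        then show ?thesis by (auto simp: trivial_module_def)
      qed
    qed (simp add: trivial_module_def)
  qed
  moreover have "\<not> complete_graph (quot G Ms)"
    using cut[OF pos, of False] pos complete_graphD[of "quot G Ms" 0] by auto
  moreover have "\<not> edgeless_graph (quot G Ms)"
    using cut[OF pos, of True] by (auto simp: edgeless_graph_def)
  ultimately show ?thesis using that[OF P len] by blast
qed

lemma partition_psubset:
  assumes "modular_partition G Ms" "2 \<le> length Ms" "i < length Ms"
  shows "Ms ! i \<subset> verts G"
proof -
  define j where "j = (if i = 0 then 1 else 0 :: nat)"
  have j: "j < length Ms" "j \<noteq> i" using assms by (auto simp: j_def)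
  have "Ms ! j \<noteq> {}" "Ms ! i \<inter> Ms ! j = {}" "Ms ! i \<subseteq> verts G" "Ms ! j \<subseteq> verts G"
    using assms j by (auto simp: modular_partition_def)
  then show ?thesis by blast
qed

text \<open>Gallai's trichotomy: a graph with several vertices is disconnected, or its complement
  is, or its maximal proper modules give a prime quotient. Existence makes the choice inside
  \<open>modular_width\<close> pick a genuine MD-tree.\<close>

lemma md_tree_exists:
  assumes "simple_graph G" "verts G \<noteq> {}"
  shows "\<exists>t. md_tree G t"
  using assms
proof (induction "card (verts G)" arbitrary: G rule: less_induct)
  case less
  note G = less.prems(1)
  have finV: "finite (verts G)" using G by (simp add: simple_graph_def)
  have children: "\<exists>ts. length ts = length Ms \<and> (\<forall>i<length Ms. md_tree (induced G (Ms ! i)) (ts ! i))"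
    if P: "modular_partition G Ms" "2 \<le> length Ms" for Ms
  proof -
    have "\<exists>t. md_tree (induced G (Ms ! i)) t" if i: "i < length Ms" for i
    proof (rule less.hyps)
      show "card (verts (induced G (Ms ! i))) < card (verts G)"
        using partition_psubset[OF P i] finV by (simp add: psubset_card_mono)
      show "simple_graph (induced G (Ms ! i))"
        using partition_psubset[OF P i] by (intro simple_induced[OF G]) auto
      show "verts (induced G (Ms ! i)) \<noteq> {}"
        using P i by (simp add: modular_partition_def)
    qed
    then obtain f where "\<And>i. i < length Ms \<Longrightarrow> md_tree (induced G (Ms ! i)) (f i)" by metis
    then show ?thesis by (intro exI[of _ "map f [0..<length Ms]"]) simp
  qed
  consider (one) v where "verts G = {v}" | (split) b where "\<not> conn_by G b"
    | (prime) "conn_by G True" "conn_by G False" "2 \<le> card (verts G)"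
  proof (cases "2 \<le> card (verts G)")
    case True
    then show ?thesis using that by blast
  next
    case False
    moreover have "0 < card (verts G)" using finV less.prems(2) by (simp add: card_gt_0_iff)
    ultimately have "card (verts G) = 1" by linarith
    then show ?thesis using that(1) by (auto simp: card_1_singleton_iff)
  qed
  then show ?case
  proof cases
    case one
    then have "edges G = {}"
      using simple_graph_edgeE[OF G] by (metis ex_in_conv singletonD)
    with one have "md_tree G (Leaf v)" by (simp add: md_tree_def)
    then show ?thesis ..
  next
    case split
    obtain Ms where Ms: "modular_partition G Ms" "2 \<le> length Ms"
      "\<And>i. i < length Ms \<Longrightarrow> conn_by (induced G (Ms ! i)) b"
      "\<And>i j. i < length Ms \<Longrightarrow> j < length Ms \<Longrightarrow> i \<noteq> j \<Longrightarrow> ({i, j} \<in> edges (quot G Ms)) = (\<not> b)"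
      using connected_partition[OF G split] by metis
    obtain ts where ts: "length ts = length Ms" "\<And>i. i < length Ms \<Longrightarrow> md_tree (induced G (Ms ! i)) (ts ! i)"
      using children[OF Ms(1,2)] by blast
    \<comment> \<open>The parts are connected with respect to \<open>b\<close>, and a node of the
      type being built is not; so no child repeats that type.\<close>
    have ch: "\<not> (if b then parallel_node t else series_node t)" if "t \<in> set ts" for t
      using that parallel_series_not_connected[of t b] Ms(3) ts by (auto simp: in_set_conv_nth md_tree_def)
    have 01: "({0, 1} \<in> edges (quot G Ms)) = (\<not> b)" using Ms(2) by (intro Ms(4)) auto
    have "md_tree G (Node (quot G Ms) ts)"
    proof (rule md_tree_Node[OF G Ms(1,2) ts])
      show "series_node (Node (quot G Ms) ts) \<or> parallel_node (Node (quot G Ms) ts) \<or>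
        prime_node (Node (quot G Ms) ts)"
      proof (cases b)
        case True
        have "edges (quot G Ms) = {}"
        proof (rule ccontr)
          assume "edges (quot G Ms) \<noteq> {}"
          then obtain e where "e \<in> edges (quot G Ms)" by blast
          then obtain i j where "{i, j} \<in> edges (quot G Ms)" "i < length Ms" "j < length Ms" "i \<noteq> j"
            by (metis simple_graph_edgeE[OF simple_quot] lessThan_iff verts_quot)
          then show False using Ms(4) True by blast
        qed
        then show ?thesis by (simp add: edgeless_graph_def)
      next
        case False
        then show ?thesis using Ms(4) by (simp add: complete_graph_def)
      qed
      show "\<forall>t\<in>set ts. \<not> series_node t" if "series_node (Node (quot G Ms) ts)"
        using complete_graphD[of "quot G Ms" 0 1] that 01 Ms(2) ch less_le_trans[OF _ Ms(2), of 0] by (cases b) auto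
      show "\<forall>t\<in>set ts. \<not> parallel_node t" if "parallel_node (Node (quot G Ms) ts)"
        using that 01 ch by (cases b) (auto simp: edgeless_graph_def)
    qed
    then show ?thesis ..
  next
    case prime
    obtain Ms where Ms: "modular_partition G Ms" "4 \<le> length Ms" "prime_graph (quot G Ms)"
      "\<not> complete_graph (quot G Ms)" "\<not> edgeless_graph (quot G Ms)"
      using prime_partition[OF G prime] by metis
    have len: "2 \<le> length Ms" using Ms(2) by simp
    obtain ts where ts: "length ts = length Ms" "\<And>i. i < length Ms \<Longrightarrow> md_tree (induced G (Ms ! i)) (ts ! i)"
      using children[OF Ms(1) len] by blast
    have "md_tree G (Node (quot G Ms) ts)"
      by (rule md_tree_Node[OF G Ms(1) len ts]) (use Ms in simp_all)
    then show ?thesis ..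
  qed
qed

section \<open>Size of reduced graphs\<close>

definition component :: "'a graph \<Rightarrow> 'a set \<Rightarrow> 'a \<Rightarrow> 'a set" where
  "component G X x = {y. (x, y) \<in> {(u, v). u \<in> X \<and> v \<in> X \<and> {u, v} \<in> edges G}\<^sup>*}"

lemma component_self [simp]: "x \<in> component G X x"
  by (simp add: component_def)

lemma component_step: "y \<in> component G X x \<Longrightarrow> y \<in> X \<Longrightarrow> z \<in> X \<Longrightarrow> {y, z} \<in> edges G \<Longrightarrow> z \<in> component G X x"
  unfolding component_def by (auto intro: rtrancl_into_rtrancl)

lemma component_induct [consumes 1, case_names self step]:
  assumes "y \<in> component G X x" "P x"
    "\<And>y z. y \<in> component G X x \<Longrightarrow> y \<in> X \<Longrightarrow> z \<in> X \<Longrightarrow> {y, z} \<in> edges G \<Longrightarrow> P y \<Longrightarrow> P z"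
  shows "P y"
  using assms(1)[unfolded component_def mem_Collect_eq]
  by (induction rule: rtrancl_induct) (use assms(2,3) in \<open>auto simp: component_def\<close>)

lemma component_subset: "x \<in> X \<Longrightarrow> component G X x \<subseteq> X"
proof
  fix y assume "x \<in> X" "y \<in> component G X x"
  from this(2,1) show "y \<in> X" by (induction rule: component_induct) auto
qed

lemma component_eq:
  assumes "y \<in> component G X x"
  shows "component G X y = component G X x"
proof -
  let ?R = "{(u, v). u \<in> X \<and> v \<in> X \<and> {u, v} \<in> edges G}"
  have "sym ?R" by (auto simp: sym_def insert_commute)
  then have "(y, x) \<in> ?R\<^sup>*" using assms by (auto simp: component_def intro: symD[OF sym_rtrancl])
  then show ?thesis using assms by (auto simp: component_def intro: rtrancl_trans)
qed

text \<open>Only the targets of steps are tested against \<open>w\<close>, so a vertex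
  \<open>u\<close> of \<open>V\<close> always belongs to its own set. A deletion triggered by
  remaining vertices therefore removes something.\<close>

definition comp_avoiding :: "'a graph \<Rightarrow> 'a set \<Rightarrow> 'a \<Rightarrow> 'a \<Rightarrow> 'a set" where
  "comp_avoiding G V u w = {y \<in> V. u \<in> V \<and>
     (u, y) \<in> {(y, x). y \<in> V \<and> x \<in> V \<and> {y, x} \<in> edges G \<and> {w, x} \<notin> edges G}\<^sup>*}"

text \<open>If \<open>u\<close> and \<open>w\<close> lie in different components of a module, then the component of \<open>u\<close> in the
  module is the component of \<open>u\<close> after removing the neighbours of \<open>w\<close>: outside of the module \<open>u\<close>
  and \<open>w\<close> have the same neighbours. Hence these components are found without knowing the module.\<close>

lemma comp_avoiding_eq_component:
  assumes T: "is_module G T" and u: "u \<in> T \<inter> V" and w: "w \<in> T \<inter> V" "w \<notin> component G (T \<inter> V) u"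
  shows "comp_avoiding G V u w = component G (T \<inter> V) u"
proof
  let ?R = "{(y, x). y \<in> V \<and> x \<in> V \<and> {y, x} \<in> edges G \<and> {w, x} \<notin> edges G}"
  show "comp_avoiding G V u w \<subseteq> component G (T \<inter> V) u"
  proof
    fix y assume "y \<in> comp_avoiding G V u w"
    then have "(u, y) \<in> ?R\<^sup>*" by (simp add: comp_avoiding_def)
    then show "y \<in> component G (T \<inter> V) u"
    proof (induction rule: rtrancl_induct)
      case (step y z)
      have y: "y \<in> T \<inter> V" using step.IH component_subset[OF u] by blast
      \<comment> \<open>A step out of the module would end in a neighbour of \<open>y\<close>, hence
        of \<open>w\<close>, and those are excluded.\<close>
      have "z \<in> T" using is_moduleD[OF T, of y w z] step.hyps(2) y w(1) by auto
      then show ?case using component_step[OF step.IH y, of z] step.hyps(2) by auto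
    qed simp
  qed
  show "component G (T \<inter> V) u \<subseteq> comp_avoiding G V u w"
  proof
    fix y assume "y \<in> component G (T \<inter> V) u"
    then show "y \<in> comp_avoiding G V u w"
    proof (induction rule: component_induct)
      case self
      then show ?case using u by (simp add: comp_avoiding_def)
    next
      case (step y z)
      have z: "z \<in> component G (T \<inter> V) u" by (rule component_step[OF step.hyps])
      have "{w, z} \<notin> edges G"
        using component_step[OF z step.hyps(3) w(1)] w(2) by (auto simp: insert_commute)
      with step have "(y, z) \<in> ?R" by auto
      with step.IH step.hyps(3) show ?case
        unfolding comp_avoiding_def by (auto intro: rtrancl_into_rtrancl)
    qed
  qed
qed

text \<open>Equal codes state that matching the lists position by position preserves labels, inner
  edges and outer neighbours. For disjoint lists the last column also excludes edges between the
  two: an element of one list is masked in its own row entries, so it must not be a neighbour in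
  those of the other.\<close>

definition twin_code :: "'a graph \<Rightarrow> ('a \<Rightarrow> 'l) \<Rightarrow> 'a list \<Rightarrow> 'a list \<Rightarrow> ('l \<times> bool list \<times> bool list) list" where
  "twin_code G lab vs H = map (\<lambda>x. (lab x, map (\<lambda>z. {x, z} \<in> edges G) H,
     map (\<lambda>z. {x, z} \<in> edges G \<and> z \<notin> set H) vs)) H"

text \<open>Components are compared only in the order inherited from \<open>vs\<close>, so
  isomorphic ones may go undetected. This avoids isomorphism tests and is affordable, because the
  number of ordered codes of bounded length is bounded as well.\<close>

definition comp_list :: "'a graph \<Rightarrow> 'a list \<Rightarrow> 'a \<Rightarrow> 'a \<Rightarrow> 'a list" where
  "comp_list G vs u w = filter (\<lambda>y. y \<in> comp_avoiding G (set vs) u w) vs"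

lemma set_comp_list: "set (comp_list G vs u w) = comp_avoiding G (set vs) u w"
  by (auto simp: comp_list_def comp_avoiding_def)

definition reduced :: "'a graph \<Rightarrow> ('a \<Rightarrow> 'l) \<Rightarrow> 'a list \<Rightarrow> bool" where
  "reduced G lab vs \<longleftrightarrow> (\<forall>u\<in>set vs. \<forall>w\<in>set vs.
     set (comp_list G vs u w) \<inter> set (comp_list G vs w u) = {} \<longrightarrow>
     twin_code G lab vs (comp_list G vs u w) \<noteq> twin_code G lab vs (comp_list G vs w u))"

text \<open>A row of a short code is one of \<open>a\<close> labels with a set of positions below
  \<open>s\<close>. The power bounds the lists of such rows of each length up to \<open>s\<close>,
  the factor \<open>s + 1\<close> counts the lengths, and the leading \<open>s\<close> is the size
  of a component. The 1 in the base makes its powers monotone in the exponent.\<close>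

definition cbound :: "nat \<Rightarrow> nat \<Rightarrow> nat" where
  "cbound a s = s * ((s + 1) * (a * 2 ^ s + 1) ^ s)"

text \<open>In a reduced graph distinct components of a module already differ in the short code
  \<open>\<kappa>\<close>, which drops the column of outer neighbours. That column agrees
  automatically: inside the module a component has no further neighbours, and outside of it all
  vertices of the module have the same ones. It remains to count short codes.\<close>

lemma card_components_le:
  assumes red: "reduced G lab vs" and dist: "distinct vs"
    and lab: "lab ` set vs \<subseteq> A" "finite A" "card A \<le> a"
    and T: "is_module G T" and X: "X = T \<inter> set vs"
    and s: "\<And>x. x \<in> X \<Longrightarrow> card (component G X x) \<le> s"
  shows "card X \<le> cbound a s"
proof -
  let ?D = "\<lambda>D. filter (\<lambda>y. y \<in> D) vs"
  \<comment> \<open>The condition \<open>j < s\<close> puts all rows into one fixed finite set;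
    components have at most \<open>s\<close> elements, so no adjacency is lost.\<close>
  define row where "row D x = (lab x, {j. j < s \<and> j < length (?D D) \<and> {x, ?D D ! j} \<in> edges G})" for D x
  define \<kappa> where "\<kappa> D = map (row D) (?D D)" for D
  have len: "length (?D (component G X x)) \<le> s" and setD: "set (?D (component G X x)) = component G X x"
    if x: "x \<in> X" for x
  proof -
    show *: "set (?D (component G X x)) = component G X x"
      using component_subset[OF x] X by auto
    show "length (?D (component G X x)) \<le> s"
      using s[OF x] dist * distinct_card[of "?D (component G X x)"] by simp
  qed
  have inj: "inj_on \<kappa> (component G X ` X)"
  proof (rule inj_onI, safe del: equalityI)
    fix u w assume uw: "u \<in> X" "w \<in> X" and eq: "\<kappa> (component G X u) = \<kappa> (component G X w)"
    show "component G X u = component G X w"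
    proof (rule ccontr)
      assume ne: "component G X u \<noteq> component G X w"
      let ?U = "?D (component G X u)" and ?W = "?D (component G X w)"
      have disj: "component G X u \<inter> component G X w = {}" using ne component_eq by (metis disjoint_iff)
      have nw: "w \<notin> component G X u" "u \<notin> component G X w" using disj component_self by (metis disjoint_iff)+
      have c: "comp_avoiding G (set vs) u w = component G X u" "comp_avoiding G (set vs) w u = component G X w"
        using comp_avoiding_eq_component[OF T, of u "set vs" w] comp_avoiding_eq_component[OF T, of w "set vs" u] uw nw X by auto
      have l: "length ?U = length ?W" using eq unfolding \<kappa>_def by (metis length_map)
      have row: "row (component G X u) (?U ! i) = row (component G X w) (?W ! i)" if "i < length ?U" for i
        using arg_cong[OF eq, of "\<lambda>l. l ! i"] that l by (simp add: \<kappa>_def)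
      have "twin_code G lab vs ?U = twin_code G lab vs ?W"
      proof (rule nth_equalityI)
        fix i assume "i < length (twin_code G lab vs ?U)"
        then have i: "i < length ?U" by (simp add: twin_code_def)
        have m: "?U ! i \<in> component G X u" "?W ! i \<in> component G X w"
          using nth_mem[of i ?U] nth_mem[of i ?W] i l by auto
        then have mX: "?U ! i \<in> X" "?W ! i \<in> X"
          using component_subset[OF uw(1), of G] component_subset[OF uw(2), of G] by auto
        have "map (\<lambda>z. {?U ! i, z} \<in> edges G) ?U = map (\<lambda>z. {?W ! i, z} \<in> edges G) ?W"
        proof (rule nth_equalityI)
          fix j assume "j < length (map (\<lambda>z. {?U ! i, z} \<in> edges G) ?U)"
          then have j: "j < length ?U" by simp
          then have "j < s" using len[OF uw(1)] by simp
          with row[OF i] j l show "map (\<lambda>z. {?U ! i, z} \<in> edges G) ?U ! j = map (\<lambda>z. {?W ! i, z} \<in> edges G) ?W ! j"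
            unfolding row_def by (auto simp: set_eq_iff)
        qed (use l in simp)
        moreover have "({?U ! i, z} \<in> edges G \<and> z \<notin> component G X u) \<longleftrightarrow> ({?W ! i, z} \<in> edges G \<and> z \<notin> component G X w)"
          if z: "z \<in> set vs" for z
        proof (cases "z \<in> T")
          case True
          then have "z \<in> X" using z X by simp
          then show ?thesis using component_step[OF m(1) mX(1), of z] component_step[OF m(2) mX(2), of z] by blast
        next
          case False
          then have "z \<notin> X" using X by auto
          then have "z \<notin> component G X u" "z \<notin> component G X w"
            using component_subset[OF uw(1), of G] component_subset[OF uw(2), of G] by auto
          moreover have "({?U ! i, z} \<in> edges G) = ({?W ! i, z} \<in> edges G)"
            using is_moduleD[OF T _ _ False, of "?U ! i" "?W ! i"] mX X by simp
          ultimately show ?thesis by simp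
        qed
        ultimately show "twin_code G lab vs ?U ! i = twin_code G lab vs ?W ! i"
          using i l row[OF i] setD[OF uw(1)] setD[OF uw(2)] by (simp add: twin_code_def row_def)
      qed (use l in \<open>simp add: twin_code_def\<close>)
      moreover have "set ?U \<inter> set ?W = {}" using disj by auto
      moreover have "comp_list G vs u w = ?U" "comp_list G vs w u = ?W" by (simp_all add: comp_list_def c)
      ultimately show False
        using red[unfolded reduced_def, rule_format, of u w] uw X by simp
    qed
  qed
  let ?S = "A \<times> Pow {..<s}"
  have finS: "finite ?S" using lab(2) by simp
  have "\<kappa> D \<in> {xs. set xs \<subseteq> ?S \<and> length xs \<le> s}" if "D \<in> component G X ` X" for D
    using that len lab(1) by (auto simp: \<kappa>_def row_def)
  then have "card (component G X ` X) \<le> card {xs. set xs \<subseteq> ?S \<and> length xs \<le> s}"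
    by (intro card_inj_on_le[OF inj] finite_lists_length_le finS) auto
  also have "\<dots> = (\<Sum>i\<le>s. card ?S ^ i)" by (rule card_lists_length_le[OF finS])
  also have "\<dots> \<le> (\<Sum>i\<le>s. (a * 2 ^ s + 1) ^ s)"
  proof (rule sum_mono)
    fix i assume "i \<in> {..s}"
    have "card A * 2 ^ s \<le> a * 2 ^ s" using lab(3) by simp
    moreover have "card ?S = card A * 2 ^ s" by (simp add: card_cartesian_product card_Pow)
    ultimately have "card ?S \<le> a * 2 ^ s + 1" by linarith
    with \<open>i \<in> {..s}\<close> show "card ?S ^ i \<le> (a * 2 ^ s + 1) ^ s"
      by (meson atMost_iff le_add2 order_trans power_increasing power_mono zero_le)
  qed
  also have "\<dots> = (s + 1) * (a * 2 ^ s + 1) ^ s" by simp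
  finally have num: "card (component G X ` X) \<le> (s + 1) * (a * 2 ^ s + 1) ^ s" .
  have fin: "finite X" using X by simp
  have "X \<subseteq> \<Union> (component G X ` X)" by auto
  then have "card X \<le> card (\<Union> (component G X ` X))"
    using fin by (intro card_mono) (auto intro: finite_subset[OF component_subset])
  also have "\<dots> \<le> (\<Sum>D\<in>component G X ` X. card D)" by (rule card_Union_le_sum_card)
  also have "\<dots> \<le> (\<Sum>D\<in>component G X ` X. s)" by (rule sum_mono) (use s in auto)
  also have "\<dots> \<le> s * ((s + 1) * (a * 2 ^ s + 1) ^ s)" using num by (simp add: mult.commute)
  finally show ?thesis by (simp add: cbound_def)
qed

section \<open>Induction over the MD-tree\<close>

lemma tree_edge:
  assumes t: "substitution_tree (Node Q ts)" and ij: "i < length ts" "j < length ts"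
    and xy: "x \<in> verts (tree_graph (ts ! i))" "y \<in> verts (tree_graph (ts ! j))"
  shows "{x, y} \<in> edges (tree_graph (Node Q ts)) \<longleftrightarrow>
    (if i = j then {x, y} \<in> edges (tree_graph (ts ! i)) else {i, j} \<in> edges Q)"
proof -
  have Q: "verts Q = {..<length ts}" "simple_graph Q" using t by auto
  have disj: "i = j" if "i < length ts" "j < length ts" "v \<in> verts (tree_graph (ts ! i))"
    "v \<in> verts (tree_graph (ts ! j))" for i j v
    using t that unfolding substitution_tree.simps by blast
  have s: "simple_graph (tree_graph (ts ! i))" if "i < length ts" for i
    using t that by (intro simple_tree_graph) simp
  have 1: "l = i \<and> l = j" if "l < length ts" "{x, y} \<in> edges (tree_graph (ts ! l))" for l
    using simple_graph_edge[OF s[OF that(1)] that(2)] disj that(1) ij xy by blast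
  have 2: "{i, j} \<in> edges Q"
    if "l < length ts" "m < length ts" "{l, m} \<in> edges Q" "v \<in> verts (tree_graph (ts ! l))"
      "w \<in> verts (tree_graph (ts ! m))" "{x, y} = {v, w}" for l m v w
  proof -
    have "x = v \<and> y = w \<or> x = w \<and> y = v" using that(6) by (auto simp: doubleton_eq_iff)
    then have "i = l \<and> j = m \<or> i = m \<and> j = l" using disj ij xy that(1,2,4,5) by blast
    with that(3) show ?thesis by (auto simp: insert_commute)
  qed
  have "{i, j} \<notin> edges Q" if "i = j" using simple_graph_edge(3)[OF Q(2), of i j] that by auto
  moreover have "{x, y} \<in> edges (tree_graph (Node Q ts)) \<longleftrightarrow>
      (i = j \<and> {x, y} \<in> edges (tree_graph (ts ! i))) \<or> {i, j} \<in> edges Q"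
    unfolding edges_tree_Node[OF Q(1)] using 1 2 ij xy by blast
  ultimately show ?thesis by auto
qed

text \<open>If \<open>i\<close> were isolated, the other nodes would form a module, and with at
  least three elements but without \<open>i\<close> it would be nontrivial.\<close>

lemma prime_neighbour:
  assumes Q: "simple_graph Q" "prime_graph Q" "4 \<le> card (verts Q)" and i: "i \<in> verts Q"
  obtains j where "{i, j} \<in> edges Q"
proof (rule ccontr)
  assume "\<not> thesis"
  then have no: "{i, j} \<notin> edges Q" for j using that by blast
  let ?M = "verts Q - {i}"
  have fin: "finite (verts Q)" using Q(1) by (simp add: simple_graph_def)
  have "{v, z} \<notin> edges Q" if "z \<notin> ?M" for v z
    using that no[of v] simple_graph_edge[OF Q(1), of v z] by (cases "z = i") (auto simp: insert_commute)
  then have "is_module Q ?M" unfolding is_module_iff by simp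
  then have "trivial_module Q ?M" using Q(2) by (simp add: prime_graph_def)
  moreover have "card ?M \<ge> 3" using Q(3) i fin by simp
  moreover have "?M \<noteq> verts Q" using i by blast
  ultimately show False unfolding trivial_module_def by fastforce
qed

text \<open>The last argument counts colors. With one color more, a component lies in at most
  \<open>q\<close> children bounded by the previous value; the added 1 accounts for a leaf, where
  that previous value may be 0.\<close>

fun kbound :: "nat \<Rightarrow> nat \<Rightarrow> nat \<Rightarrow> nat" where
  "kbound a q 0 = 0"
| "kbound a q (Suc c) = cbound a (q * kbound a q c + 1)"

text \<open>Both bounds are carried together: a parallel node takes over the component bound of a
  child for the same \<open>c\<close>, whereas a series or prime node adds up the vertex bounds of
  its children for \<open>c - 1\<close>. Counting components then turns the first bound into the
  second.\<close>

lemma tree_bound: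
  fixes f :: "'a \<Rightarrow> 'c"
  assumes red: "reduced G lab vs" and dist: "distinct vs"
    and lab: "lab ` set vs \<subseteq> A" "finite A" "card A \<le> a"
    and f: "\<And>v w. {v, w} \<in> edges G \<Longrightarrow> f v \<noteq> f w" "f ` verts G \<subseteq> C" "finite C" "card C \<le> k"
  shows "substitution_tree t \<Longrightarrow> md_labelled t \<Longrightarrow> prime_arities t \<subseteq> {..m} \<Longrightarrow>
    is_module G (verts (tree_graph t)) \<Longrightarrow>
    (\<And>x y. x \<in> verts (tree_graph t) \<Longrightarrow> y \<in> verts (tree_graph t) \<Longrightarrow>
      {x, y} \<in> edges G \<longleftrightarrow> {x, y} \<in> edges (tree_graph t)) \<Longrightarrow>
    card (f ` verts (tree_graph t)) \<le> c \<Longrightarrow>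
    (\<forall>x \<in> verts (tree_graph t) \<inter> set vs.
      card (component G (verts (tree_graph t) \<inter> set vs) x) \<le> (k + m) * kbound a (k + m) (c - 1) + 1) \<and>
    card (verts (tree_graph t) \<inter> set vs) \<le> kbound a (k + m) c"
proof (induction t arbitrary: c)
  case (Leaf v)
  let ?X = "{v} \<inter> set vs"
  have "card (component G ?X x) \<le> (k + m) * kbound a (k + m) (c - 1) + 1" if "x \<in> ?X" for x
    using card_mono[OF _ component_subset[OF that, of G]] card_mono[of "{v}" ?X] by simp
  moreover from this have "card ?X \<le> cbound a ((k + m) * kbound a (k + m) (c - 1) + 1)"
    using Leaf by (intro card_components_le[OF red dist lab, of "{v}"]) auto
  moreover have "c = Suc (c - 1)" using Leaf by simp
  ultimately show ?case by (metis kbound.simps(2) tree_graph.simps(1) select_convs(1))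
next
  case (Node Q ts)
  let ?q = "k + m"
  define T where "T = verts (tree_graph (Node Q ts))"
  define Ti where "Ti i = verts (tree_graph (ts ! i))" for i
  have st: "substitution_tree (Node Q ts)" by fact
  have Q: "verts Q = {..<length ts}" "simple_graph Q" "2 \<le> length ts"
    and disj: "\<And>i j. i < length ts \<Longrightarrow> j < length ts \<Longrightarrow> i \<noteq> j \<Longrightarrow> Ti i \<inter> Ti j = {}"
    and ch: "\<And>i. i < length ts \<Longrightarrow> substitution_tree (ts ! i) \<and> md_labelled (ts ! i)"
    using Node.prems(1,2) by (auto simp: Ti_def)
  have ne: "Ti i \<noteq> {}" if "i < length ts" for i
    unfolding Ti_def using tree_verts_nonempty ch that by blast
  have T: "T = (\<Union>i<length ts. Ti i)" unfolding T_def Ti_def verts_tree_Node[OF Q(1)] ..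
  have mT: "is_module G T" using Node.prems(4) by (simp only: T_def)
  have TV: "T \<subseteq> verts G" using mT by (simp add: is_module_def)
  have eT: "{x, y} \<in> edges G \<longleftrightarrow> {x, y} \<in> edges (tree_graph (Node Q ts))" if "x \<in> T" "y \<in> T" for x y
    using Node.prems(5) that unfolding T_def by blast
  have edge: "{x, y} \<in> edges G \<longleftrightarrow> {i, j} \<in> edges Q"
    if "i < length ts" "j < length ts" "i \<noteq> j" "x \<in> Ti i" "y \<in> Ti j" for x y i j
    using eT[of x y] tree_edge[OF st that(1,2), of x y] that T by (auto simp: Ti_def simp del: tree_graph.simps)
  have modi: "is_module G (Ti i)" if i: "i < length ts" for i
    unfolding is_module_iff
  proof (intro conjI ballI allI impI)
    show "Ti i \<subseteq> verts G" using TV T i by auto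
    fix v w z assume vwz: "v \<in> Ti i" "w \<in> Ti i" "z \<notin> Ti i"
    show "({v, z} \<in> edges G) = ({w, z} \<in> edges G)"
    proof (cases "z \<in> T")
      case True
      then obtain j where "j < length ts" "z \<in> Ti j" unfolding T by auto
      moreover from this have "i \<noteq> j" using vwz by auto
      ultimately show ?thesis using edge[OF i _ _ vwz(1)] edge[OF i _ _ vwz(2)] by simp
    next
      case False
      moreover have "v \<in> T" "w \<in> T" using vwz T i by auto
      ultimately show ?thesis using is_moduleD[OF mT] by blast
    qed
  qed
  have IH: "(\<forall>x \<in> Ti i \<inter> set vs. card (component G (Ti i \<inter> set vs) x) \<le> ?q * kbound a ?q (c' - 1) + 1) \<and>
      card (Ti i \<inter> set vs) \<le> kbound a ?q c'" if i: "i < length ts" and c': "card (f ` Ti i) \<le> c'" for i c'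
    unfolding Ti_def
  proof (rule Node.IH)
    show "ts ! i \<in> set ts" "substitution_tree (ts ! i)" "md_labelled (ts ! i)" using i ch by auto
    show "prime_arities (ts ! i) \<subseteq> {..m}" using Node.prems(3) i nth_mem[OF i] by fastforce
    show "is_module G (verts (tree_graph (ts ! i)))" using modi[OF i] by (simp add: Ti_def)
    fix x y assume xy: "x \<in> verts (tree_graph (ts ! i))" "y \<in> verts (tree_graph (ts ! i))"
    then have "x \<in> T" "y \<in> T" using T i by (auto simp: Ti_def)
    then show "{x, y} \<in> edges G \<longleftrightarrow> {x, y} \<in> edges (tree_graph (ts ! i))"
      using eT[of x y] tree_edge[OF st i i xy] by simp
  qed (use c' in \<open>simp add: Ti_def\<close>)
  have fin_f: "finite (f ` T)" using f(2,3) TV by (meson finite_subset image_mono)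
  have c: "card (f ` T) \<le> c" using Node.prems(6) by (simp only: T_def)
  \<comment> \<open>A node contains a vertex and hence a color, so \<open>c\<close> is positive and
    the recursion for \<open>kbound\<close> unfolds.\<close>
  have "f ` T \<noteq> {}" using T ne[of 0] Q(3) by fastforce
  with c fin_f have c1: "c = Suc (c - 1)" by (cases c) auto
  have main: "card (component G (T \<inter> set vs) x) \<le> ?q * kbound a ?q (c - 1) + 1" if x: "x \<in> T \<inter> set vs" for x
  proof (cases "edgeless_graph Q")
    case True
    obtain i where i: "i < length ts" "x \<in> Ti i" using x unfolding T by auto
    have "component G (T \<inter> set vs) x \<subseteq> component G (Ti i \<inter> set vs) x"
    proof
      fix y assume "y \<in> component G (T \<inter> set vs) x"
      then show "y \<in> component G (Ti i \<inter> set vs) x"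
      proof (induction rule: component_induct)
        case (step y z)
        have y: "y \<in> Ti i \<inter> set vs" using step.IH component_subset[of x "Ti i \<inter> set vs" G] i x by blast
        obtain j where j: "j < length ts" "z \<in> Ti j" using step.hyps(3) unfolding T by auto
        \<comment> \<open>No edge joins different children of a parallel node, so a path stays in
          the child where it starts.\<close>
        have "i = j" using edge[OF i(1) j(1) _ _ j(2), of y] y step.hyps(4) True
          by (auto simp: edgeless_graph_def)
        then show ?case using component_step[OF step.IH y _ step.hyps(4)] j step.hyps(3) by blast
      qed simp
    qed
    moreover have "finite (component G (Ti i \<inter> set vs) x)"
      using component_subset[of x "Ti i \<inter> set vs" G] i x by (auto intro: finite_subset)
    ultimately have "card (component G (T \<inter> set vs) x) \<le> card (component G (Ti i \<inter> set vs) x)"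
      by (intro card_mono)
    moreover have "f ` Ti i \<subseteq> f ` T" using i T by auto
    then have "card (f ` Ti i) \<le> c" using card_mono[OF fin_f] c by (meson order_trans)
    then have "card (component G (Ti i \<inter> set vs) x) \<le> ?q * kbound a ?q (c - 1) + 1"
      using IH[OF i(1)] i x by blast
    ultimately show ?thesis by simp
  next
    case False
    then have lbl: "complete_graph Q \<or> (prime_graph Q \<and> 4 \<le> card (verts Q))"
      using Node.prems(2) by simp
    have nb: "\<exists>j<length ts. j \<noteq> i \<and> {i, j} \<in> edges Q" if i: "i < length ts" for i
      using lbl
    proof
      assume "complete_graph Q"
      define j where "j = (if i = 0 then 1 else 0 :: nat)"
      have "j < length ts" "j \<noteq> i" using Q(3) by (auto simp: j_def)
      with \<open>complete_graph Q\<close> i Q(1) show ?thesis using complete_graphD[of Q i j] by auto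
    next
      assume "prime_graph Q \<and> 4 \<le> card (verts Q)"
      then obtain j where j: "{i, j} \<in> edges Q" using prime_neighbour[OF Q(2)] i Q(1) by blast
      then show ?thesis using simple_graph_edge[OF Q(2) j] Q(1) by auto
    qed
    have p: "length ts \<le> ?q"
      using lbl
    proof
      assume cg: "complete_graph Q"
      \<comment> \<open>Representatives of the children of a series node form a clique;
        \<open>f\<close> gives them different colors, so there are at most \<open>k\<close>
        children.\<close>
      define r where "r i = (SOME x. x \<in> Ti i)" for i
      have r: "r i \<in> Ti i" if "i < length ts" for i using ne[OF that] by (auto simp: r_def some_in_eq)
      have "inj_on (\<lambda>i. f (r i)) {..<length ts}"
      proof (rule inj_onI, rule ccontr)
        fix i j assume ij: "i \<in> {..<length ts}" "j \<in> {..<length ts}" "f (r i) = f (r j)" "i \<noteq> j"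
        then have "{r i, r j} \<in> edges G"
          using edge[of i j "r i" "r j"] r complete_graphD[OF cg, of i j] Q(1) by auto
        with f(1) ij(3) show False by blast
      qed
      moreover have "(\<lambda>i. f (r i)) ` {..<length ts} \<subseteq> C" using r T TV f(2) by blast
      ultimately have "card {..<length ts} \<le> card C" using f(3) by (intro card_inj_on_le) auto
      then show ?thesis using f(4) by simp
    next
      assume "prime_graph Q \<and> 4 \<le> card (verts Q)"
      then have "length ts \<in> prime_arities (Node Q ts)" by simp
      then show ?thesis using Node.prems(3) by auto
    qed
    have small: "card (Ti i \<inter> set vs) \<le> kbound a ?q (c - 1)" if i: "i < length ts" for i
    proof -
      obtain j where j: "j < length ts" "j \<noteq> i" "{i, j} \<in> edges Q" using nb[OF i] by blast
      obtain y where y: "y \<in> Ti j" using ne[OF j(1)] by blast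
      \<comment> \<open>The vertex \<open>y\<close> is adjacent to all of child \<open>i\<close>, so
        its color is missing there; this is the loss of one color.\<close>
      have "f y \<notin> f ` Ti i" using edge[OF i j(1) _ _ y] j f(1) by fastforce
      moreover have "f y \<in> f ` T" "f ` Ti i \<subseteq> f ` T" using y j i T by auto
      ultimately have "card (f ` Ti i) < card (f ` T)" using fin_f by (intro psubset_card_mono) auto
      then show ?thesis using IH[OF i, of "c - 1"] c by simp
    qed
    have "card (T \<inter> set vs) \<le> card (\<Union>i<length ts. Ti i \<inter> set vs)"
      unfolding T by (intro card_mono) auto
    also have "\<dots> \<le> (\<Sum>i<length ts. card (Ti i \<inter> set vs))" by (rule card_UN_le) simp
    also have "\<dots> \<le> (\<Sum>i<length ts. kbound a ?q (c - 1))" by (rule sum_mono) (use small in auto)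
    also have "\<dots> \<le> ?q * kbound a ?q (c - 1)" using p by simp
    finally have "card (T \<inter> set vs) \<le> ?q * kbound a ?q (c - 1)" .
    moreover have "card (component G (T \<inter> set vs) x) \<le> card (T \<inter> set vs)"
      using component_subset[OF x] by (intro card_mono) auto
    ultimately show ?thesis by simp
  qed
  then have "card (T \<inter> set vs) \<le> cbound a (?q * kbound a ?q (c - 1) + 1)"
    by (intro card_components_le[OF red dist lab mT]) auto
  with c1 have "card (T \<inter> set vs) \<le> kbound a ?q c" by (metis kbound.simps(2))
  with main show ?case unfolding T_def by blast
qed

lemma finite_prime_arities: "finite (prime_arities t)"
  by (induction t) auto

text \<open>The root of the chosen MD-tree carries all of \<open>G\<close>, on which
  \<open>f\<close> uses at most \<open>k\<close> colors; so the induction over the tree starts with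
  \<open>c = k\<close>.\<close>

lemma kernel_bound:
  assumes G: "simple_graph G" and mw: "modular_width G \<le> m"
    and vs: "set vs \<subseteq> verts G" "distinct vs" "reduced G lab vs"
    and lab: "lab ` set vs \<subseteq> A" "finite A" "card A \<le> a"
    and f: "\<And>v w. {v, w} \<in> edges G \<Longrightarrow> f v \<noteq> f w" "f ` verts G \<subseteq> C" "finite C" "card C \<le> k"
  shows "length vs \<le> kbound a (k + m) k"
proof (cases "verts G = {}")
  case False
  define t where "t = (SOME t. md_tree G t)"
  have "md_tree G t" unfolding t_def by (rule someI_ex[OF md_tree_exists[OF G False]])
  then have t: "substitution_tree t" "md_labelled t" "tree_graph t = G" by (auto simp: md_tree_def)
  have "Max (insert 0 (prime_arities t)) \<le> m"
    using mw False by (simp add: modular_width_def t_def)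
  then have m: "prime_arities t \<subseteq> {..m}" by (auto simp: finite_prime_arities)
  have "is_module G (verts G)" by (auto simp: is_module_iff dest: simple_graph_edge(2)[OF G])
  moreover have "card (f ` verts G) \<le> k" using card_mono[OF f(3,2)] f(4) by simp
  ultimately have "card (verts G \<inter> set vs) \<le> kbound a (k + m) k"
    using tree_bound[OF vs(3,2) lab f t(1,2) m, of k] t(3) by auto
  moreover have "verts G \<inter> set vs = set vs" using vs(1) by auto
  ultimately show ?thesis using distinct_card[OF vs(2)] by simp
qed (use vs in simp)

section \<open>The algorithm\<close>

lemma pbd_mono:
  assumes "pbd t n V" "\<And>env. length env = n \<Longrightarrow> V env \<le> W env"
  shows "pbd t n W"
proof -
  have "poly_bdd {env. length env = n} V W"
    by (rule poly_bdd_mono[OF poly_bdd_self]) (simp add: assms(2))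
  then show ?thesis using pbdD[OF assms(1)] by (intro pbdI) (auto intro: poly_bdd_trans)
qed

lemma pbd_TApp_list:
  "ptime f k \<Longrightarrow> length as = k \<Longrightarrow> (\<forall>a\<in>set as. pbd a n W) \<Longrightarrow> pbd (TApp f as) n W"
  using ptime_TApp by blast

definition t_mem :: tm where
  "t_mem = TEx 2 (TEq (TVar 0) (TVar 2)) (TVar 1)"

text \<open>A vertex is passed around as its whole record of the instance: name, neighbour list,
  color list, start color, target color. Adjacency then needs no table lookup; neighbour lists keep
  the names of deleted vertices.\<close>

definition t_adj :: tm where
  "t_adj = TApp t_mem [TFst (TVar 1), TFst (TSnd (TVar 0))]"

text \<open>The arguments of \<open>t_close r\<close> are a list, a start element and a parameter of the relation \<open>r\<close>.\<close>

definition t_close :: "tm \<Rightarrow> tm" where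
  "t_close r = TFold
     (TFilter 5 (TEx 6 (TApp r [TVar 6, TVar 5, TVar 2]) (TVar 4)) (TVar 0))
     (TFilter 3 (TEq (TVar 3) (TVar 1)) (TVar 0)) (TVar 0)"

definition t_rel_component :: tm where
  "t_rel_component = TOr (TEq (TVar 0) (TVar 1))
     (TAnd (TNot (TApp t_adj [TVar 2, TVar 1])) (TApp t_adj [TVar 0, TVar 1]))"

definition t_component :: tm where
  "t_component = TApp (t_close t_rel_component) [TVar 0, TVar 1, TVar 2]"

definition t_code :: tm where
  "t_code = TMap 2
     (TCell (TSnd (TSnd (TVar 2)))
       (TCell (TMap 3 (TApp t_adj [TVar 2, TVar 3]) (TVar 1))
         (TMap 3 (TAnd (TApp t_adj [TVar 2, TVar 3]) (TNot (TApp t_mem [TVar 3, TVar 1]))) (TVar 0))))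
     (TVar 1)"

definition t_delete :: tm where
  "t_delete = TIf (TEx 3 (TApp t_mem [TVar 3, TVar 2]) (TVar 1)) (TVar 0)
     (TIf (TEq (TApp t_code [TVar 0, TVar 1]) (TApp t_code [TVar 0, TVar 2]))
       (TFilter 3 (TNot (TApp t_mem [TVar 3, TVar 2])) (TVar 0)) (TVar 0))"

definition t_step :: tm where
  "t_step = TApp t_delete [TVar 0, TApp t_component [TVar 0, TVar 1, TVar 2],
     TApp t_component [TVar 0, TVar 2, TVar 1]]"

text \<open>Pairs are drawn from the unchanged input list \<open>TVar 0\<close>. A vertex deleted
  meanwhile has an empty component, since \<open>comp_avoiding\<close> asks for membership, and thus
  causes no deletion.\<close>

definition t_pass :: tm where
  "t_pass = TFold (TFold (TApp t_step [TVar 5, TVar 2, TVar 4]) (TVar 3) (TVar 0)) (TVar 1) (TVar 0)"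

definition t_kernel :: tm where
  "t_kernel = TFold (TApp t_pass [TVar 0, TVar 2]) (TVar 0) (TVar 0)"

text \<open>An assignment lists pairs of record and color in the order of the vertices, so equal
  colorings are equal values and can be compared by \<open>TEq\<close>.\<close>

definition t_assignments :: tm where
  "t_assignments = TFold
     (TFold (TFold (TCell (TCell (TCell (TVar 1) (TVar 3)) (TVar 5)) (TVar 6)) (TVar 4) (TVar 2))
       TAtom (TFst (TSnd (TSnd (TVar 1)))))
     (TCell TAtom TAtom) (TVar 0)"

definition t_proper :: tm where
  "t_proper = TNot (TEx 1 (TEx 2
     (TAnd (TApp t_adj [TFst (TVar 1), TFst (TVar 2)]) (TEq (TSnd (TVar 1)) (TSnd (TVar 2))))
     (TVar 0)) (TVar 0))"

text \<open>At most one pair of the first assignment is missing from the second: a list has at most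
  one element iff its \<open>cell_snd\<close> is \<open>Atom\<close>.\<close>

definition t_near :: tm where
  "t_near = TNot (TSnd (TFilter 3 (TNot (TApp t_mem [TVar 3, TVar 1])) (TVar 0)))"

definition t_search :: tm where
  "t_search = TApp t_mem
     [TMap 2 (TCell (TVar 2) (TSnd (TSnd (TSnd (TSnd (TVar 2)))))) (TVar 0),
      TApp (t_close t_near)
        [TFilter 2 (TApp t_proper [TVar 2]) (TVar 1),
         TMap 2 (TCell (TVar 2) (TFst (TSnd (TSnd (TSnd (TVar 2)))))) (TVar 0), TAtom]]"

definition t_brute_force :: tm where
  "t_brute_force = TApp t_search [TVar 0, TApp t_assignments [TVar 0]]"

definition t_main :: tm where
  "t_main = TApp t_brute_force [TApp t_kernel [TVar 0]]"

section \<open>Values and costs of the subprograms\<close>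

lemma den_t_mem [simp]: "den t_mem [x, l] = enc_bool (x \<in> set (vlist l))"
  by (auto simp: t_mem_def)

lemma den_t_adj:
  "den t_adj [x, y] = enc_bool (cell_fst y \<in> set (vlist (cell_fst (cell_snd x))))"
  by (simp add: t_adj_def)

lemma foldr_const: "foldr (\<lambda>_. f) xs a = (f ^^ length xs) a"
  by (induction xs) auto

lemma foldr_enc:
  assumes "\<And>x ys. f x (enc_list e ys) = enc_list e (g x ys)"
  shows "foldr f xs (enc_list e ys) = enc_list e (foldr g xs ys)"
  by (induction xs) (auto simp: assms)

lemma funpow_fixpoint:
  assumes "\<And>x. I x \<Longrightarrow> I (f x)" "\<And>x. I x \<Longrightarrow> f x \<noteq> x \<Longrightarrow> m (f x) < (m x :: nat)" "I x" "m x \<le> n"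
  shows "f ((f ^^ n) x) = (f ^^ n) x"
  using assms(3,4)
proof (induction n arbitrary: x)
  case 0
  then show ?case using assms(2) by force
next
  case (Suc n)
  have *: "(f ^^ Suc n) x = (f ^^ n) (f x)" by (simp add: funpow_swap1)
  show ?case
  proof (cases "f x = x")
    case True
    have "(f ^^ k) x = x" for k by (induction k) (auto simp: True)
    then show ?thesis using True by metis
  next
    case False
    then show ?thesis unfolding * using Suc.prems assms(1,2) by (intro Suc.IH) fastforce+
  qed
qed

lemma length_filter_mono:
  "(\<And>x. x \<in> set xs \<Longrightarrow> P x \<Longrightarrow> Q x) \<Longrightarrow> length (filter P xs) \<le> length (filter Q xs)"
  by (induction xs) (auto intro: le_SucI)

lemma filter_length_eq:
  "(\<And>x. x \<in> set xs \<Longrightarrow> P x \<Longrightarrow> Q x) \<Longrightarrow> length (filter Q xs) \<le> length (filter P xs) \<Longrightarrow>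
    filter Q xs = filter P xs"
proof (induction xs)
  case (Cons x xs)
  have "length (filter P xs) \<le> length (filter Q xs)"
    using Cons.prems(1) by (intro length_filter_mono) simp
  with Cons.prems(2) Cons.prems(1)[of x]
  have "P x = Q x" "length (filter Q xs) \<le> length (filter P xs)"
    by (cases "P x"; cases "Q x"; simp)+
  moreover from this have "filter Q xs = filter P xs"
    using Cons.prems(1) by (intro Cons.IH) simp_all
  ultimately show ?case by simp
qed simp

text \<open>By reflexivity a round only adds elements, and a round that changes the set lowers the
  number of missing ones, so \<open>length xs\<close> rounds reach a fixpoint. All stages are
  filters of the same list, so two nested stages of equal length are equal.\<close>

lemma closure_list:
  assumes refl: "\<And>x. x \<in> set xs \<Longrightarrow> R x x"
  shows "((\<lambda>A. filter (\<lambda>x. \<exists>y\<in>set A. R y x) xs) ^^ length xs) (filter (\<lambda>x. x = s) xs) =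
    filter (\<lambda>x. s \<in> set xs \<and> (s, x) \<in> {(y, x). y \<in> set xs \<and> x \<in> set xs \<and> R y x}\<^sup>*) xs"
proof -
  let ?F = "\<lambda>A. filter (\<lambda>x. \<exists>y\<in>set A. R y x) xs" and ?A = "filter (\<lambda>x. x = s) xs"
  let ?S = "{(y, x). y \<in> set xs \<and> x \<in> set xs \<and> R y x}"
  define B where "B = (?F ^^ length xs) ?A"
  have grow: "set A \<subseteq> set (?F A)" if "set A \<subseteq> set xs" for A
    using that refl by auto
  have fixp: "?F B = B"
    unfolding B_def
  proof (rule funpow_fixpoint[where I = "\<lambda>A. \<exists>P. A = filter P xs" and m = "\<lambda>A. length xs - length A"])
    fix A assume A: "\<exists>P. A = filter P xs" "?F A \<noteq> A"
    then obtain P where P: "A = filter P xs" by blast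
    have "\<not> length (?F A) \<le> length A"
    proof
      assume "length (?F A) \<le> length A"
      then have "?F A = A"
        using filter_length_eq[of xs P "\<lambda>x. \<exists>y\<in>set A. R y x"] grow[of A] unfolding P by auto
      with A(2) show False by simp
    qed
    moreover have "length (?F A) \<le> length xs" by (rule length_filter_le)
    ultimately show "length xs - length (?F A) < length xs - length A" by linarith
  qed auto
  have sub: "(?F ^^ i) ?A = filter (\<lambda>x. x \<in> set ((?F ^^ i) ?A)) xs" for i
    by (cases i) (auto intro: filter_cong)
  have sub': "set ((?F ^^ i) ?A) \<subseteq> set xs" for i
    by (cases i) auto
  have sound: "x \<in> set ((?F ^^ i) ?A) \<Longrightarrow> s \<in> set xs \<and> (s, x) \<in> ?S\<^sup>*" for i x
  proof (induction i arbitrary: x)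
    case (Suc i)
    then obtain y where y: "y \<in> set ((?F ^^ i) ?A)" "R y x" "x \<in> set xs" by auto
    moreover have "y \<in> set xs" using y(1) sub'[of i] by blast
    ultimately have "(y, x) \<in> ?S" by simp
    with Suc.IH[OF y(1)] show ?case by (meson rtrancl_into_rtrancl)
  qed auto
  have start: "set ?A \<subseteq> set ((?F ^^ i) ?A)" for i
  proof (induction i)
    case (Suc i)
    from grow[OF sub'[of i]] Suc.IH show ?case by auto
  qed simp
  have complete: "x \<in> set B" if "s \<in> set xs" "(s, x) \<in> ?S\<^sup>*" for x
    using that(2)
  proof (induction rule: rtrancl_induct)
    case base
    then show ?case using start[of "length xs"] that(1) by (auto simp: B_def)
  next
    case (step y z)
    then have "z \<in> set (?F B)" by auto
    then show ?case by (simp only: fixp)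
  qed
  have "B = filter (\<lambda>x. x \<in> set B) xs" using sub[of "length xs"] by (simp add: B_def)
  also have "\<dots> = filter (\<lambda>x. s \<in> set xs \<and> (s, x) \<in> ?S\<^sup>*) xs"
    using sound[of _ "length xs"] complete by (intro filter_cong) (auto simp: B_def)
  finally show ?thesis by (simp add: B_def)
qed

lemma den_t_close:
  assumes "\<And>x. x \<in> set xs \<Longrightarrow> den r [x, x, p] \<noteq> Atom"
  shows "den (t_close r) [enc_list (\<lambda>x. x) xs, s, p] = enc_list (\<lambda>x. x)
    (filter (\<lambda>x. s \<in> set xs \<and> (s, x) \<in> {(y, x). y \<in> set xs \<and> x \<in> set xs \<and> den r [y, x, p] \<noteq> Atom}\<^sup>*) xs)"
proof -
  have "den (t_close r) [enc_list (\<lambda>x. x) xs, s, p] =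
    foldr (\<lambda>x y. enc_list (\<lambda>x. x) (filter (\<lambda>x. \<exists>y\<in>set (vlist y). den r [y, x, p] \<noteq> Atom) xs)) xs
     (enc_list (\<lambda>x. x) (filter (\<lambda>x. x = s) xs))"
    by (simp add: t_close_def fold_val_foldr)
  also have "\<dots> = enc_list (\<lambda>x. x)
     (foldr (\<lambda>x A. filter (\<lambda>x. \<exists>y\<in>set A. den r [y, x, p] \<noteq> Atom) xs) xs (filter (\<lambda>x. x = s) xs))"
    by (rule foldr_enc) simp
  finally show ?thesis
    using closure_list[of xs "\<lambda>y x. den r [y, x, p] \<noteq> Atom" s] assms by (simp add: foldr_const)
qed

lemma den_t_rel_component [simp]: "den t_rel_component [y, x, w] =
    enc_bool (y = x \<or> den t_adj [w, x] = Atom \<and> den t_adj [y, x] \<noteq> Atom)"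
  by (simp add: t_rel_component_def den_t_adj)

lemma val_size_filter: "val_size (enc_list e (filter P xs)) \<le> val_size (enc_list e xs)"
  by (induction xs) auto

lemma ptime_t_mem: "ptime t_mem 2"
  unfolding t_mem_def by (intro pbd_TEx pbd_intros) simp_all

lemma ptime_t_adj: "ptime t_adj 2"
  unfolding t_adj_def by (intro pbd_TApp_list[OF ptime_t_mem]) (auto intro!: pbd_intros)

text \<open>Every accumulator is a filter of the first argument, so iteration does not let it
  grow.\<close>

lemma ptime_t_close:
  assumes "ptime r 3"
  shows "ptime (t_close r) 3"
  unfolding t_close_def
proof (rule pbd_TFold_max)
  show "ptime (TFilter 5 (TEx 6 (TApp r [TVar 6, TVar 5, TVar 2]) (TVar 4)) (TVar 0)) (3 + 2)"
    by (auto intro!: pbd_TFilter pbd_TEx pbd_TApp_list[OF assms] pbd_intros)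
  fix env :: "val list" and x y
  assume "length env = 3"
  then obtain a b c where env: "env = [a, b, c]" by (auto simp: numeral_3_eq_3 length_Suc_conv)
  have "val_size (enc_list (\<lambda>x. x) (filter P (vlist a))) \<le> val_size a" for P
    using val_size_filter[of "\<lambda>x. x" P "vlist a"] by simp
  then show "val_size (den (TFilter 5 (TEx 6 (TApp r [TVar 6, TVar 5, TVar 2]) (TVar 4)) (TVar 0)) (env @ [x, y]))
      \<le> max (val_size y) (env_size env)"
    by (simp add: env le_max_iff_disj trans_le_add1)
qed (auto intro!: pbd_TFilter pbd_intros)

lemma ptime_t_rel_component: "ptime t_rel_component 3"
  unfolding t_rel_component_def
  by (intro pbd_logic pbd_TApp_list[OF ptime_t_adj] pbd_intros) (auto intro!: pbd_intros)

lemma ptime_t_component: "ptime t_component 3"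
  unfolding t_component_def
  by (intro pbd_TApp_list[OF ptime_t_close[OF ptime_t_rel_component]]) (auto intro!: pbd_intros)

lemma ptime_t_code: "ptime t_code 2"
  unfolding t_code_def
  by (auto intro!: pbd_TMap pbd_logic pbd_intros pbd_TApp_list[OF ptime_t_adj] pbd_TApp_list[OF ptime_t_mem])

lemma ptime_t_delete: "ptime t_delete 3"
  unfolding t_delete_def
  by (auto intro!: pbd_TEx pbd_TFilter pbd_logic pbd_intros pbd_TApp_list[OF ptime_t_mem]
      pbd_TApp_list[OF ptime_t_code])

lemma ptime_t_step: "ptime t_step 3"
  unfolding t_step_def
  by (intro pbd_TApp_list[OF ptime_t_delete]) (auto intro!: pbd_intros pbd_TApp_list[OF ptime_t_component])

text \<open>A step only deletes vertices. This monotonicity keeps the nested loops of the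
  kernelization polynomial.\<close>

lemma val_size_t_step: "val_size (den t_step [a, u, w]) \<le> val_size a"
  using val_size_filter[of "\<lambda>x. x" _ "vlist a"] by (simp add: t_step_def t_delete_def)

lemma fold_val_size_le:
  "(\<And>x y. val_size (f x y) \<le> val_size y) \<Longrightarrow> val_size (fold_val f a l) \<le> val_size a"
  by (induction l) (auto intro: order_trans)

lemma ptime_t_pass: "ptime t_pass 2"
  unfolding t_pass_def
proof (rule pbd_TFold_max)
  show "ptime (TFold (TApp t_step [TVar 5, TVar 2, TVar 4]) (TVar 3) (TVar 0)) (2 + 2)"
  proof (rule pbd_TFold_max)
    fix env :: "val list" and x y
    assume "length env = 2 + 2"
    then show "val_size (den (TApp t_step [TVar 5, TVar 2, TVar 4]) (env @ [x, y]))
      \<le> max (val_size y) (env_size env)"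
      using val_size_t_step by (simp add: nth_append le_max_iff_disj)
  qed (auto intro!: pbd_intros pbd_TApp_list[OF ptime_t_step])
  fix env :: "val list" and x y
  assume "length env = 2"
  then show "val_size (den (TFold (TApp t_step [TVar 5, TVar 2, TVar 4]) (TVar 3) (TVar 0)) (env @ [x, y]))
      \<le> max (val_size y) (env_size env)"
    using fold_val_size_le[of "\<lambda>a b. den t_step [b, x, a]" y "env ! 0"] val_size_t_step
    by (simp add: nth_append le_max_iff_disj)
qed (auto intro!: pbd_intros)

lemma val_size_t_pass: "val_size (den t_pass [a, b]) \<le> val_size b"
  unfolding t_pass_def by (auto intro!: fold_val_size_le val_size_t_step)

lemma ptime_t_kernel: "ptime t_kernel 1"
  unfolding t_kernel_def
proof (rule pbd_TFold_max)
  fix env :: "val list" and x y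
  assume "length env = 1"
  then show "val_size (den (TApp t_pass [TVar 0, TVar 2]) (env @ [x, y])) \<le> max (val_size y) (env_size env)"
    using val_size_t_pass by (simp add: nth_append le_max_iff_disj)
qed (auto intro!: pbd_intros pbd_TApp_list[OF ptime_t_pass])

lemma ptime_t_proper: "ptime t_proper 1"
proof -
  have "ptime (TEx 2 (TAnd (TApp t_adj [TFst (TVar 1), TFst (TVar 2)])
      (TEq (TSnd (TVar 1)) (TSnd (TVar 2)))) (TVar 0)) 2"
    by (auto intro!: pbd_TEx pbd_logic pbd_intros pbd_TApp_list[OF ptime_t_adj])
  then show ?thesis
    unfolding t_proper_def by (intro pbd_logic pbd_TEx pbd_intros) (simp_all only: Suc_1 zero_less_one)
qed

lemma ptime_t_near: "ptime t_near 3"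
  unfolding t_near_def
  by (auto intro!: pbd_TFilter pbd_logic pbd_intros pbd_TApp_list[OF ptime_t_mem])

lemma ptime_t_search: "ptime t_search 2"
  unfolding t_search_def
  by (auto intro!: pbd_TApp_list[OF ptime_t_mem] pbd_TApp_list[OF ptime_t_close[OF ptime_t_near]]
      pbd_TApp_list[OF ptime_t_proper] pbd_TMap pbd_TFilter pbd_intros)

text \<open>One round of the outer loop of \<open>t_assignments\<close>. The round is polynomial in
  its own input, although iterating it is not polynomial in the vertex list.\<close>

definition t_extend :: tm where
  "t_extend = TFold (TFold (TCell (TCell (TCell (TVar 1) (TVar 3)) (TVar 5)) (TVar 6)) (TVar 4) (TVar 2))
       TAtom (TFst (TSnd (TSnd (TVar 1))))"

lemma ptime_t_extend: "ptime t_extend 3"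
  unfolding t_extend_def
proof (rule pbd_TFold_add)
  let ?b = "TCell (TCell (TCell (TVar 1) (TVar 3)) (TVar 5)) (TVar 6)"
  show "ptime (TFold ?b (TVar 4) (TVar 2)) (3 + 2)"
  proof (rule pbd_TFold_add)
    show "poly_bdd {env. length env = Suc (3 + 2)} (\<lambda>env. 3 * env_size env + 3) env_size"
      by (intro poly_bdd_intros)
    fix env :: "val list" and x y
    assume n: "length env = 3 + 2"
    then show "val_size (den ?b (env @ [x, y])) \<le> val_size y + (3 * env_size (env @ [x]) + 3)"
      using nth_size_le[of 1 env] nth_size_le[of 3 env] by (simp add: nth_append)
  qed (auto intro!: pbd_intros)
  show "poly_bdd {env. length env = Suc 3} (\<lambda>env. env_size env * (3 * env_size env + 3)) env_size"
    by (intro poly_bdd_intros)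
  fix env :: "val list" and x y
  assume n: "length env = 3"
  have "val_size (fold_val (\<lambda>p z. Cell (Cell (Cell (env ! 1) x) p) z) y (env ! 2))
      \<le> val_size y + val_size (env ! 2) * (3 * env_size (env @ [x]) + 3)"
  proof (rule fold_val_size_add)
    fix p r z assume "Cell p r \<in> tails (env ! 2)"
    then have "val_size p \<le> val_size (env ! 2)" using val_size_tails by fastforce
    then show "val_size (Cell (Cell (Cell (env ! 1) x) p) z) \<le> val_size z + (3 * env_size (env @ [x]) + 3)"
      using nth_size_le[of 1 env] nth_size_le[of 2 env] n by simp
  qed
  also have "\<dots> \<le> val_size y + env_size (env @ [x]) * (3 * env_size (env @ [x]) + 3)"
    using nth_size_le[of 2 env] n by (intro add_left_mono mult_right_mono) auto
  finally show "val_size (den (TFold ?b (TVar 4) (TVar 2)) (env @ [x, y]))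
      \<le> val_size y + env_size (env @ [x]) * (3 * env_size (env @ [x]) + 3)"
    using n by (simp add: nth_append)
qed (auto intro!: pbd_intros)

text \<open>The accumulators of \<open>t_assignments\<close> are the tables for the suffixes of the
  vertex list; with their maximal size as a measure, the exhaustive search counts as
  polynomial.\<close>

definition assignments_size :: "val list \<Rightarrow> nat" where
  "assignments_size env = env_size env +
     Max ((\<lambda>r. val_size (den t_assignments [r])) ` tails (env ! 0))"

lemma pbd_t_arg: "pbd (TVar 0) 1 assignments_size"
  by (rule pbd_mono[OF pbd_TVar]) (simp_all add: assignments_size_def)

lemma pbd_t_assignments: "pbd t_assignments 1 assignments_size"
proof -
  have "pbd (TFold t_extend (TCell TAtom TAtom) (TVar 0)) 1 assignments_size"
  proof (rule pbd_TFold)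
    show "ptime t_extend (1 + 2)" using ptime_t_extend by (simp add: numeral_3_eq_3)
    show "pbd (TVar 0) 1 assignments_size"
      by (rule pbd_t_arg)
    show "poly_bdd {env. length env = 1} assignments_size assignments_size" by (rule poly_bdd_self)
    fix env :: "val list" and r
    assume n: "length env = 1" and r: "r \<in> tails (den (TVar 0) env)"
    obtain v where env: "env = [v]" using n by (auto simp: length_Suc_conv)
    have "val_size (den t_assignments [r]) \<le> Max ((\<lambda>r. val_size (den t_assignments [r])) ` tails v)"
      using r env by (intro Max_ge) auto
    moreover have "fold_val (\<lambda>x y. den t_extend (env @ [x, y])) (den (TCell TAtom TAtom) env) r = den t_assignments [r]"
      by (simp add: env t_assignments_def t_extend_def)
    ultimately show "val_size (fold_val (\<lambda>x y. den t_extend (env @ [x, y])) (den (TCell TAtom TAtom) env) r)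
        \<le> assignments_size env"
      by (simp add: assignments_size_def env)
  qed (auto simp: assignments_size_def intro!: pbd_intros)
  then show ?thesis by (simp add: t_assignments_def t_extend_def)
qed

lemma pbd_t_brute_force: "pbd t_brute_force 1 assignments_size"
  unfolding t_brute_force_def
proof (intro pbd_TApp_list[OF ptime_t_search])
  have "pbd (TApp t_assignments [TVar 0]) 1 assignments_size"
  proof (rule pbd_TApp)
    show "poly_bdd {env. length env = 1} (\<lambda>env. assignments_size (map (\<lambda>a. den a env) [TVar 0])) assignments_size"
      by (rule poly_bdd_mono[OF poly_bdd_self]) (auto simp: length_Suc_conv)
    show "pbd t_assignments (length [TVar 0]) assignments_size" using pbd_t_assignments by simp
    show "\<And>a. a \<in> set [TVar 0] \<Longrightarrow> pbd a 1 assignments_size"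
      using pbd_t_arg by simp
  qed
  with pbd_t_arg show "\<forall>a\<in>set [TVar 0, TApp t_assignments [TVar 0]]. pbd a 1 assignments_size" by simp
qed simp

section \<open>Correctness of the kernelization\<close>

lemma enc_nat_inject [simp]: "enc_nat m = enc_nat n \<longleftrightarrow> m = n"
proof
  show "enc_nat m = enc_nat n \<Longrightarrow> m = n"
  proof (induction m arbitrary: n rule: less_induct)
    case (less m)
    show ?case
    proof (cases "m = 0 \<or> n = 0")
      case True
      then show ?thesis
        using less.prems enc_nat.simps[of m] enc_nat.simps[of n] by (auto split: if_splits)
    next
      case False
      then have "odd m = odd n" "enc_nat (m div 2) = enc_nat (n div 2)"
        using less.prems enc_nat.simps[of m] enc_nat.simps[of n] by auto
      moreover from this have "m div 2 = n div 2" using False by (intro less.IH) auto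
      ultimately show ?thesis by (metis even_two_times_div_two odd_two_times_div_two_succ)
    qed
  qed
qed simp

lemma vlist_enc_nat_set [simp]: "vlist (enc_nat_set A) = map enc_nat (sorted_list_of_set A)"
  by (simp add: enc_nat_set_def)

lemma enc_nat_set_inject: "finite A \<Longrightarrow> finite B \<Longrightarrow> enc_nat_set A = enc_nat_set B \<Longrightarrow> A = B"
proof -
  assume fin: "finite A" "finite B" and eq: "enc_nat_set A = enc_nat_set B"
  have "enc_nat ` A = enc_nat ` B"
    using arg_cong[OF eq, of "\<lambda>v. set (vlist v)"] fin by simp
  then show "A = B" by (subst (asm) inj_image_eq_iff) (simp_all add: inj_def)
qed

lemma enc_list_map [simp]: "enc_list e (map g xs) = enc_list (\<lambda>x. e (g x)) xs"
  by (induction xs) auto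

lemma enc_list_cong: "(\<And>x. x \<in> set xs \<Longrightarrow> d x = e x) \<Longrightarrow> enc_list d xs = enc_list e xs"
  by (induction xs) auto

text \<open>Transports reachability between vertices or colorings and their encodings: by
  injectivity a path of encodings lifts uniquely to a path in \<open>S\<close>.\<close>

lemma rtrancl_map_prod:
  assumes inj: "inj_on e A" and S: "S \<subseteq> A \<times> A" and ab: "a \<in> A" "b \<in> A"
  shows "(e a, e b) \<in> (map_prod e e ` S)\<^sup>* \<longleftrightarrow> (a, b) \<in> S\<^sup>*"
proof
  assume "(a, b) \<in> S\<^sup>*"
  then show "(e a, e b) \<in> (map_prod e e ` S)\<^sup>*"
  proof (induction rule: rtrancl_induct)
    case (step y z)
    then have "(e y, e z) \<in> map_prod e e ` S" by force
    with step.IH show ?case by (rule rtrancl_into_rtrancl)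
  qed simp
next
  assume "(e a, e b) \<in> (map_prod e e ` S)\<^sup>*"
  then have "\<exists>c\<in>A. e b = e c \<and> (a, c) \<in> S\<^sup>*"
  proof (induction rule: rtrancl_induct)
    case (step y z)
    then obtain c d d' where "c \<in> A" "y = e c" "(a, c) \<in> S\<^sup>*" "(d, d') \<in> S" "y = e d" "z = e d'" by auto
    moreover from this have "c = d" using inj S by (auto dest: inj_onD)
    ultimately show ?case using S by (auto intro: rtrancl_into_rtrancl)
  qed (use ab in auto)
  then show "(a, b) \<in> S\<^sup>*" using inj ab by (auto dest: inj_onD)
qed

lemma foldr_decreasing:
  assumes "\<And>x a. g x a = a \<or> m (g x a) < (m a :: nat)"
  shows "foldr g xs a = a \<or> m (foldr g xs a) < m a"
proof (induction xs)
  case (Cons x xs)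
  then show ?case using assms[of x "foldr g xs a"] by fastforce
qed simp

text \<open>A step that changed something would lower \<open>m\<close>, and no later step raises it
  again; so a pass without total effect consists of steps without effect.\<close>

lemma foldr_fixpoint:
  assumes g: "\<And>x a. g x a = a \<or> m (g x a) < (m a :: nat)" and "foldr g xs a = a" "x \<in> set xs"
  shows "g x a = a"
  using assms(2,3)
proof (induction xs)
  case (Cons y xs)
  let ?b = "foldr g xs a"
  have "?b = a"
    using Cons.prems(1) g[of y ?b] foldr_decreasing[of g m xs a, OF g] by fastforce
  with Cons show ?case by auto
qed simp

fun assignments :: "(nat \<Rightarrow> nat set) \<Rightarrow> nat list \<Rightarrow> (nat \<times> nat) list list" where
  "assignments L [] = [[]]"
| "assignments L (v # vs) =
     concat (map (\<lambda>c. map (\<lambda>p. (v, c) # p) (assignments L vs)) (sorted_list_of_set (L v)))"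

lemma set_assignments:
  "distinct vs \<Longrightarrow> (\<And>v. v \<in> set vs \<Longrightarrow> finite (L v)) \<Longrightarrow>
    set (assignments L vs) = {map (\<lambda>v. (v, f v)) vs | f. \<forall>v\<in>set vs. f v \<in> L v}"
proof (induction vs)
  case (Cons v vs)
  have IH: "set (assignments L vs) = {map (\<lambda>v. (v, f v)) vs | f. \<forall>v\<in>set vs. f v \<in> L v}"
    using Cons by simp
  show ?case
  proof (rule set_eqI, rule iffI)
    fix p assume "p \<in> set (assignments L (v # vs))"
    then obtain c q where c: "c \<in> L v" "q \<in> set (assignments L vs)" "p = (v, c) # q"
      using Cons.prems(2)[of v] by auto
    then obtain f where f: "q = map (\<lambda>v. (v, f v)) vs" "\<forall>v\<in>set vs. f v \<in> L v" using IH by auto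
    have "p = map (\<lambda>w. (w, (f(v := c)) w)) (v # vs)" using c f Cons.prems(1) by auto
    moreover have "\<forall>w\<in>set (v # vs). (f(v := c)) w \<in> L w" using c f by auto
    ultimately show "p \<in> {map (\<lambda>v. (v, f v)) (v # vs) | f. \<forall>w\<in>set (v # vs). f w \<in> L w}" by blast
  next
    fix p assume "p \<in> {map (\<lambda>v. (v, f v)) (v # vs) | f. \<forall>w\<in>set (v # vs). f w \<in> L w}"
    then obtain f where f: "p = map (\<lambda>v. (v, f v)) (v # vs)" "\<forall>w\<in>set (v # vs). f w \<in> L w" by blast
    then have "map (\<lambda>v. (v, f v)) vs \<in> set (assignments L vs)" using IH by auto
    then show "p \<in> set (assignments L (v # vs))" using f Cons.prems(2)[of v] by auto
  qed
qed auto

lemma length_assignments: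
  "(\<And>v. v \<in> set vs \<Longrightarrow> card (L v) \<le> k) \<Longrightarrow> length (assignments L vs) \<le> k ^ length vs"
proof (induction vs)
  case (Cons v vs)
  have "length (assignments L (v # vs)) = card (L v) * length (assignments L vs)"
    by (simp add: length_concat o_def sum_list_triv)
  also have "\<dots> \<le> k * k ^ length vs" using Cons by (intro mult_le_mono) auto
  finally show ?case by simp
qed simp

locale lcr_instance =
  fixes G :: "nat graph" and L :: "nat \<Rightarrow> nat set" and f\<^sub>0 f\<^sub>t :: "nat \<Rightarrow> nat" and C :: "nat set" and k :: nat
  assumes G: "simple_graph G" and C: "finite C" "card C \<le> k" and L: "\<And>v. v \<in> verts G \<Longrightarrow> L v \<subseteq> C"
    and f: "list_coloring G L f\<^sub>0" "list_coloring G L f\<^sub>t"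
begin

definition lab :: "nat \<Rightarrow> val" where
  "lab v = Cell (enc_nat_set (L v)) (Cell (enc_nat (f\<^sub>0 v)) (enc_nat (f\<^sub>t v)))"

definition entry :: "nat \<Rightarrow> val" where
  "entry v = Cell (enc_nat v) (Cell (enc_nat_set (neighbours G v)) (lab v))"

lemma enc_instance_eq: "enc_instance G L f\<^sub>0 f\<^sub>t = enc_list entry (sorted_list_of_set (verts G))"
proof -
  have "entry = (\<lambda>v. Cell (enc_nat v) (Cell (enc_nat_set (neighbours G v))
      (Cell (enc_nat_set (L v)) (Cell (enc_nat (f\<^sub>0 v)) (enc_nat (f\<^sub>t v))))))"
    by (simp add: fun_eq_iff entry_def lab_def)
  then show ?thesis by (simp add: enc_instance_def)
qed

lemma entry_inject [simp]: "entry v = entry w \<longleftrightarrow> v = w"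
  by (auto simp: entry_def)

lemma finite_L: "v \<in> verts G \<Longrightarrow> finite (L v)"
  using L C(1) finite_subset by blast

text \<open>Lists are known to be finite only on \<open>verts G\<close>; an infinite set would be
  encoded like the empty one.\<close>

lemma lab_inject:
  "v \<in> verts G \<Longrightarrow> w \<in> verts G \<Longrightarrow> lab v = lab w \<Longrightarrow> L v = L w \<and> f\<^sub>0 v = f\<^sub>0 w \<and> f\<^sub>t v = f\<^sub>t w"
  by (auto simp: lab_def dest: enc_nat_set_inject[OF finite_L finite_L])

lemma den_t_adj_entry [simp]: "den t_adj [entry u, entry v] = enc_bool ({u, v} \<in> edges G)"
proof -
  have "neighbours G u \<subseteq> verts G"
    using simple_graph_edge[OF G] by (auto simp: neighbours_def)
  moreover have "finite (verts G)" using G by (simp add: simple_graph_def)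
  ultimately have "finite (neighbours G u)" by (rule finite_subset)
  then show ?thesis by (auto simp: den_t_adj entry_def neighbours_def)
qed

lemma den_t_component [simp]:
  "den t_component [enc_list entry vs, entry u, entry w] = enc_list entry (comp_list G vs u w)"
proof -
  let ?S = "{(y, x). y \<in> set vs \<and> x \<in> set vs \<and> {y, x} \<in> edges G \<and> {w, x} \<notin> edges G}"
  let ?T = "{(y, x). y \<in> set vs \<and> x \<in> set vs \<and> (y = x \<or> {w, x} \<notin> edges G \<and> {y, x} \<in> edges G)}"
  let ?V = "{(y, x). y \<in> set (map entry vs) \<and> x \<in> set (map entry vs) \<and> den t_rel_component [y, x, entry w] \<noteq> Atom}"
  \<comment> \<open>The relation of the program contains the diagonal so that the rounds of the
    closure only add elements; the closure itself does not notice it.\<close>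
  have TS: "?T\<^sup>* = ?S\<^sup>*" by (rule rtrancl_subset) auto
  have R: "den t_rel_component [entry y, entry x, entry w] \<noteq> Atom \<longleftrightarrow>
      y = x \<or> {w, x} \<notin> edges G \<and> {y, x} \<in> edges G" for y x by simp
  have V: "?V = map_prod entry entry ` ?T"
  proof (rule set_eqI, rule iffI)
    fix p assume "p \<in> ?V"
    then obtain y x where "p = (entry y, entry x)" "y \<in> set vs" "x \<in> set vs"
      "den t_rel_component [entry y, entry x, entry w] \<noteq> Atom" by auto
    then have "(y, x) \<in> ?T" "p = map_prod entry entry (y, x)" using R by auto
    then show "p \<in> map_prod entry entry ` ?T" by blast
  next
    fix p assume "p \<in> map_prod entry entry ` ?T"
    then obtain y x where p: "p = (entry y, entry x)" and T: "(y, x) \<in> ?T" by auto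
    have "entry y \<in> set (map entry vs)" "entry x \<in> set (map entry vs)" using T by auto
    moreover have "den t_rel_component [entry y, entry x, entry w] \<noteq> Atom" using R[of y x] T by blast
    ultimately show "p \<in> ?V" unfolding p by (intro CollectI case_prodI conjI)
  qed
  have reach: "(entry u, entry y) \<in> ?V\<^sup>* \<longleftrightarrow> (u, y) \<in> ?S\<^sup>*" for y
    unfolding V TS[symmetric] by (rule rtrancl_map_prod[of entry UNIV]) (auto simp: inj_def)
  have mem: "entry u \<in> set (map entry vs) \<longleftrightarrow> u \<in> set vs" by auto
  have filter: "filter (\<lambda>x. entry u \<in> set (map entry vs) \<and> (entry u, x) \<in> ?V\<^sup>*) (map entry vs) =
      map entry (comp_list G vs u w)"
    unfolding comp_list_def comp_avoiding_def filter_map o_def reach mem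
    by (intro arg_cong[of _ _ "map entry"] filter_cong) simp_all
  have "den t_component [enc_list entry vs, entry u, entry w] =
      den (t_close t_rel_component) [enc_list (\<lambda>x. x) (map entry vs), entry u, entry w]"
    by (simp add: t_component_def)
  also have "\<dots> = enc_list (\<lambda>x. x) (map entry (comp_list G vs u w))"
    unfolding filter[symmetric] by (rule den_t_close) simp
  finally show ?thesis by simp
qed

definition vcode :: "(val \<times> bool list \<times> bool list) list \<Rightarrow> val" where
  "vcode = enc_list (\<lambda>(l, a, b). Cell l (Cell (enc_list enc_bool a) (enc_list enc_bool b)))"

lemma enc_list_inj: "inj e \<Longrightarrow> enc_list e xs = enc_list e ys \<longleftrightarrow> xs = ys"
  by (metis inj_map_eq_map vlist_enc_list)

lemma vcode_inject: "vcode xs = vcode ys \<longleftrightarrow> xs = ys"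
  unfolding vcode_def
proof (rule enc_list_inj)
  have "inj enc_bool" by (simp add: inj_def)
  then show "inj (\<lambda>(l, a, b). Cell l (Cell (enc_list enc_bool a) (enc_list enc_bool b)))"
    by (auto simp: inj_def enc_list_inj)
qed

lemma den_t_code [simp]:
  "den t_code [enc_list entry vs, enc_list entry H] = vcode (twin_code G lab vs H)"
proof -
  have [simp]: "cell_snd (cell_snd (entry x)) = lab x" for x by (simp add: entry_def)
  have "den t_code [enc_list entry vs, enc_list entry H] =
    enc_list (\<lambda>x. Cell (lab x) (Cell (enc_list (\<lambda>z. enc_bool ({x, z} \<in> edges G)) H)
      (enc_list (\<lambda>z. enc_bool ({x, z} \<in> edges G \<and> z \<notin> set H)) vs))) H"
    unfolding t_code_def by (auto intro!: enc_list_cong)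
  then show ?thesis by (simp add: vcode_def twin_code_def)
qed

definition twin_step :: "nat \<Rightarrow> nat \<Rightarrow> nat list \<Rightarrow> nat list" where
  "twin_step u w vs = (if set (comp_list G vs u w) \<inter> set (comp_list G vs w u) = {} \<and>
       twin_code G lab vs (comp_list G vs u w) = twin_code G lab vs (comp_list G vs w u)
     then filter (\<lambda>y. y \<notin> set (comp_list G vs w u)) vs else vs)"

lemma den_t_step: "den t_step [enc_list entry vs, entry u, entry w] = enc_list entry (twin_step u w vs)"
proof -
  have [simp]: "entry x \<in> entry ` A \<longleftrightarrow> x \<in> A" for x A by auto
  have "(\<exists>x\<in>A. x \<in> B) \<longleftrightarrow> A \<inter> B \<noteq> {}" for A B :: "nat set" by auto
  then show ?thesis
    by (simp add: t_step_def t_delete_def twin_step_def vcode_inject filter_map o_def)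
qed

lemma twin_step_decreasing: "twin_step u w vs = vs \<or> length (twin_step u w vs) < length vs"
proof (cases "twin_step u w vs = vs")
  case False
  then have "twin_step u w vs = filter (\<lambda>y. y \<notin> set (comp_list G vs w u)) vs" by (metis twin_step_def)
  with False show ?thesis by (metis length_filter_less filter_True)
qed simp

definition kernel :: "nat list \<Rightarrow> nat list" where
  "kernel vs = ((\<lambda>a. foldr (\<lambda>u a. foldr (\<lambda>w. twin_step u w) vs a) vs a) ^^ length vs) vs"

lemma den_t_kernel: "den t_kernel [enc_list entry vs] = enc_list entry (kernel vs)"
proof -
  have 1: "foldr (\<lambda>x y. den t_step [y, entry u, x]) (map entry xs) (enc_list entry a) =
      enc_list entry (foldr (\<lambda>w. twin_step u w) xs a)" for u a xs
    by (induction xs) (auto simp: den_t_step)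
  have 2: "foldr (\<lambda>u b. foldr (\<lambda>x y. den t_step [y, u, x]) (map entry vs) b) (map entry xs) (enc_list entry a) =
      enc_list entry (foldr (\<lambda>u a. foldr (\<lambda>w. twin_step u w) vs a) xs a)" for a xs
    by (induction xs) (auto simp: 1)
  have 3: "den t_pass [enc_list entry vs, enc_list entry a] =
      enc_list entry (foldr (\<lambda>u a. foldr (\<lambda>w. twin_step u w) vs a) vs a)" for a
    using 2 by (simp add: t_pass_def fold_val_foldr)
  have "foldr (\<lambda>x y. den t_pass [enc_list entry vs, y]) (map entry xs) (enc_list entry a) =
      enc_list entry (((\<lambda>a. foldr (\<lambda>u a. foldr (\<lambda>w. twin_step u w) vs a) vs a) ^^ length xs) a)" for xs a
    by (induction xs) (auto simp: 3)
  then show ?thesis by (simp add: t_kernel_def fold_val_foldr kernel_def)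
qed

definition good :: "nat list \<Rightarrow> bool" where
  "good vs \<longleftrightarrow> set vs \<subseteq> verts G \<and> distinct vs \<and>
     (reach G L f\<^sub>0 f\<^sub>t (set vs) \<longleftrightarrow> reach G L f\<^sub>0 f\<^sub>t (verts G))"

text \<open>Matching the two lists by position yields the map \<open>p\<close> for
  \<open>reachable_delete_twin\<close>. Labels give its condition on lists and colors, the second
  column the inner edges, the third the outer ones. The argument is independent of whether the lists
  are components of a module.\<close>

lemma good_twin_step:
  assumes "good vs"
  shows "good (twin_step u w vs) \<and> set (twin_step u w vs) \<subseteq> set vs"
proof (cases "twin_step u w vs = vs")
  case False
  define H1 where "H1 = comp_list G vs u w"
  define H2 where "H2 = comp_list G vs w u"
  have vs: "set vs \<subseteq> verts G" "distinct vs" using assms by (auto simp: good_def)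
  have st: "twin_step u w vs = filter (\<lambda>y. y \<notin> set H2) vs" and disj: "set H1 \<inter> set H2 = {}"
    and twin_code: "twin_code G lab vs H1 = twin_code G lab vs H2"
    using False unfolding twin_step_def H1_def H2_def by (auto split: if_splits)
  have sub: "set H1 \<subseteq> set vs" "set H2 \<subseteq> set vs" and dist: "distinct H1" "distinct H2"
    using vs by (auto simp: H1_def H2_def comp_list_def)
  have len: "length H1 = length H2" using arg_cong[OF twin_code, of length] by (simp add: twin_code_def)
  have row: "lab (H1 ! i) = lab (H2 ! i)"
    "\<And>j. j < length H2 \<Longrightarrow> ({H1 ! i, H1 ! j} \<in> edges G) = ({H2 ! i, H2 ! j} \<in> edges G)"
    "\<And>z. z \<in> set vs \<Longrightarrow> ({H1 ! i, z} \<in> edges G \<and> z \<notin> set H1) = ({H2 ! i, z} \<in> edges G \<and> z \<notin> set H2)"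
    if i: "i < length H2" for i
  proof -
    have "twin_code G lab vs H1 ! i = twin_code G lab vs H2 ! i" using twin_code by simp
    then have r: "lab (H1 ! i) = lab (H2 ! i)"
      "map (\<lambda>z. {H1 ! i, z} \<in> edges G) H1 = map (\<lambda>z. {H2 ! i, z} \<in> edges G) H2"
      "map (\<lambda>z. {H1 ! i, z} \<in> edges G \<and> z \<notin> set H1) vs = map (\<lambda>z. {H2 ! i, z} \<in> edges G \<and> z \<notin> set H2) vs"
      using i len unfolding twin_code_def by auto
    show "lab (H1 ! i) = lab (H2 ! i)" by fact
    show "({H1 ! i, H1 ! j} \<in> edges G) = ({H2 ! i, H2 ! j} \<in> edges G)" if "j < length H2" for j
      using arg_cong[OF r(2), of "\<lambda>l. l ! j"] that len by simp
    show "({H1 ! i, z} \<in> edges G \<and> z \<notin> set H1) = ({H2 ! i, z} \<in> edges G \<and> z \<notin> set H2)" if "z \<in> set vs" for z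
      using r(3) that by (simp add: map_eq_conv)
  qed
  define p where "p y = H1 ! (SOME i. i < length H2 \<and> H2 ! i = y)" for y
  have p: "p (H2 ! i) = H1 ! i" if "i < length H2" for i
  proof -
    have "(SOME j. j < length H2 \<and> H2 ! j = H2 ! i) = i"
      using that dist(2) by (intro some_equality) (auto simp: nth_eq_iff_index_eq)
    then show ?thesis by (simp add: p_def)
  qed
  have pH1: "p y \<in> set H1" if y: "y \<in> set H2" for y
    using y p len by (auto simp: in_set_conv_nth)
  have "reach G L f\<^sub>0 f\<^sub>t (set vs) \<longleftrightarrow> reach G L f\<^sub>0 f\<^sub>t (set vs - set H2)"
  proof (rule reachable_delete_twin[OF G sub(2), of p])
    show "p ` set H2 \<subseteq> set vs - set H2" using pH1 sub disj by blast
    show "inj_on p (set H2)"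
      using p dist len by (auto intro!: inj_onI simp: in_set_conv_nth nth_eq_iff_index_eq)
    show "L (p y) = L y \<and> f\<^sub>0 (p y) = f\<^sub>0 y \<and> f\<^sub>t (p y) = f\<^sub>t y" if y: "y \<in> set H2" for y
    proof (rule lab_inject)
      show "p y \<in> verts G" "y \<in> verts G" using pH1[OF y] y sub vs by auto
      show "lab (p y) = lab y" using y p row(1) by (auto simp: in_set_conv_nth)
    qed
    show "{p y, p z} \<in> edges G" if "y \<in> set H2" "z \<in> set H2" "{y, z} \<in> edges G" for y z
      using that p row(2) by (auto simp: in_set_conv_nth)
    show "z \<notin> p ` set H2 \<and> {p y, z} \<in> edges G"
      if y: "y \<in> set H2" and "z \<in> set vs - set H2" "{y, z} \<in> edges G" for y z
    proof -
      obtain i where i: "i < length H2" "y = H2 ! i" using y by (auto simp: in_set_conv_nth)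
      \<comment> \<open>As \<open>z\<close> is a neighbour of \<open>y\<close> outside
        \<open>H2\<close>, the third column yields both facts: \<open>z\<close> is a neighbour of
        the original and is itself no original.\<close>
      then have "{p y, z} \<in> edges G" "z \<notin> set H1" using row(3)[OF i(1), of z] that p by auto
      then show ?thesis using pH1 by auto
    qed
  qed
  moreover have "set (twin_step u w vs) = set vs - set H2" by (auto simp: st)
  ultimately show ?thesis using assms by (auto simp: good_def st)
qed (use assms in auto)

text \<open>Every effective pass shortens the list, so as many passes as there are vertices end in a
  fixpoint, which is then fixed by each single step. Equal codes would contradict this, since the
  step would delete \<open>w\<close> itself.\<close>

lemma kernel_good:
  assumes vs: "set vs = verts G" "distinct vs"
  shows "good (kernel vs)" and "reduced G lab (kernel vs)"
proof -
  let ?pass = "\<lambda>a. foldr (\<lambda>u a. foldr (\<lambda>w. twin_step u w) vs a) vs a"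
  have good_inner: "good a \<Longrightarrow> good (foldr (\<lambda>w. twin_step u w) xs a)" for u xs a
    by (induction xs) (auto simp: good_twin_step)
  have good_pass: "good a \<Longrightarrow> good (foldr (\<lambda>u a. foldr (\<lambda>w. twin_step u w) vs a) xs a)" for xs a
    by (induction xs) (auto simp: good_inner)
  have "good vs" using vs by (simp add: good_def)
  then have "good ((?pass ^^ n) vs)" for n by (induction n) (auto simp: good_pass)
  then show g: "good (kernel vs)" by (simp add: kernel_def)
  have dec1: "foldr (\<lambda>w. twin_step u w) xs a = a \<or> length (foldr (\<lambda>w. twin_step u w) xs a) < length a" for u xs a
    by (rule foldr_decreasing) (rule twin_step_decreasing)
  have dec2: "?pass a = a \<or> length (?pass a) < length a" for a
    by (rule foldr_decreasing) (rule dec1)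
  have "?pass (kernel vs) = kernel vs"
    unfolding kernel_def
    by (rule funpow_fixpoint[where I = "\<lambda>_. True" and m = length]) (use dec2 in auto)
  then have "foldr (\<lambda>w. twin_step u w) vs (kernel vs) = kernel vs" if "u \<in> set vs" for u
    using that by (rule foldr_fixpoint[where m = length, rotated]) (rule dec1)
  then have fixp: "twin_step u w (kernel vs) = kernel vs" if "u \<in> set vs" "w \<in> set vs" for u w
    using that by (intro foldr_fixpoint[where m = length and g = "twin_step u" and xs = vs] twin_step_decreasing) auto
  show "reduced G lab (kernel vs)"
    unfolding reduced_def
  proof (intro ballI impI notI)
    fix u w
    assume uw: "u \<in> set (kernel vs)" "w \<in> set (kernel vs)"
      "set (comp_list G (kernel vs) u w) \<inter> set (comp_list G (kernel vs) w u) = {}"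
      "twin_code G lab (kernel vs) (comp_list G (kernel vs) u w) = twin_code G lab (kernel vs) (comp_list G (kernel vs) w u)"
    have "set (kernel vs) \<subseteq> set vs" using g vs by (simp add: good_def)
    then have "twin_step u w (kernel vs) = kernel vs" using uw by (intro fixp) auto
    then have "filter (\<lambda>y. y \<notin> set (comp_list G (kernel vs) w u)) (kernel vs) = kernel vs"
      using uw(3,4) by (simp add: twin_step_def)
    then have "w \<notin> set (comp_list G (kernel vs) w u)" using uw(2) unfolding filter_id_conv by blast
    moreover have "w \<in> set (comp_list G (kernel vs) w u)"
      using uw(2) by (simp add: set_comp_list comp_avoiding_def)
    ultimately show False by simp
  qed
qed

end

section \<open>Correctness of the exhaustive search\<close>

lemma tails_enc_list: "r \<in> tails (enc_list e xs) \<Longrightarrow> \<exists>ys zs. r = enc_list e ys \<and> xs = zs @ ys"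
proof (induction xs)
  case (Cons x xs)
  then show ?case
  proof (cases "r = enc_list e (x # xs)")
    case True
    then show ?thesis by (intro exI[of _ "x # xs"] exI[of _ "[]"]) simp
  next
    case False
    then obtain ys zs where "r = enc_list e ys" "xs = zs @ ys" using Cons by auto
    then show ?thesis by (intro exI[of _ ys] exI[of _ "x # zs"]) simp
  qed
qed auto

lemma val_size_enc_list_le:
  "(\<And>x. x \<in> set xs \<Longrightarrow> val_size (e x) \<le> B) \<Longrightarrow> val_size (enc_list e xs) \<le> 1 + length xs * (1 + B)"
proof (induction xs)
  case (Cons x xs)
  have "val_size (e x) \<le> B" "val_size (enc_list e xs) \<le> 1 + length xs * (1 + B)" using Cons by auto
  then show ?case by simp
qed simp

lemma val_size_vlist: "x \<in> set (vlist v) \<Longrightarrow> val_size x \<le> val_size v"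
  by (induction v) auto

lemma cell_snd_enc_list: "cell_snd (enc_list e xs) = Atom \<longleftrightarrow> length xs \<le> 1"
  by (cases xs; cases "tl xs") auto

context lcr_instance
begin

definition epair :: "nat \<times> nat \<Rightarrow> val" where
  "epair a = Cell (entry (fst a)) (enc_nat (snd a))"

lemma epair_inject [simp]: "epair a = epair b \<longleftrightarrow> a = b"
  by (auto simp: epair_def prod_eq_iff)

lemma inj_epair: "inj epair"
  by (simp add: inj_def)

lemma enc_epair_inject [simp]: "enc_list epair p = enc_list epair q \<longleftrightarrow> p = q"
  by (rule enc_list_inj[OF inj_epair])

lemma den_t_assignments:
  "den t_assignments [enc_list entry vs] = enc_list (enc_list epair) (assignments L vs)"
proof -
  have 1: "foldr (\<lambda>p z. Cell (Cell (Cell (entry v) (enc_nat c)) p) z) (map (enc_list epair) P)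
      (enc_list (enc_list epair) Q) = enc_list (enc_list epair) (map (\<lambda>p. (v, c) # p) P @ Q)" for v c P Q
    by (induction P) (auto simp: epair_def)
  have 2: "foldr (\<lambda>c z. foldr (\<lambda>p z. Cell (Cell (Cell (entry v) c) p) z) (map (enc_list epair) P) z)
      (map enc_nat cs) Atom = enc_list (enc_list epair) (concat (map (\<lambda>c. map (\<lambda>p. (v, c) # p) P) cs))" for v cs P
    by (induction cs) (auto simp: 1)
  have 3: "cell_fst (cell_snd (cell_snd (entry v))) = enc_nat_set (L v)" for v
    by (simp add: entry_def lab_def)
  let ?f = "\<lambda>e y. foldr (\<lambda>c z. foldr (\<lambda>p z. Cell (Cell (Cell e c) p) z) (vlist y) z)
      (vlist (cell_fst (cell_snd (cell_snd e)))) Atom"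
  have "foldr ?f (map entry vs) (Cell Atom Atom) = enc_list (enc_list epair) (assignments L vs)"
    by (induction vs) (auto simp: 2 3)
  then show ?thesis by (simp add: t_assignments_def fold_val_foldr)
qed

definition proper :: "(nat \<times> nat) list \<Rightarrow> bool" where
  "proper p \<longleftrightarrow> (\<forall>a\<in>set p. \<forall>b\<in>set p. {fst a, fst b} \<in> edges G \<longrightarrow> snd a \<noteq> snd b)"

lemma den_t_proper [simp]: "den t_proper [enc_list epair p] = enc_bool (proper p)"
  by (auto simp: t_proper_def proper_def epair_def)

lemma den_t_near [simp]:
  "den t_near [enc_list epair p, enc_list epair q, z] = enc_bool (length (filter (\<lambda>a. a \<notin> set q) p) \<le> 1)"
proof -
  have [simp]: "epair a \<in> epair ` A \<longleftrightarrow> a \<in> A" for a A by auto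
  show ?thesis by (simp add: t_near_def filter_map o_def cell_snd_enc_list)
qed

definition graph_of :: "nat list \<Rightarrow> (nat \<Rightarrow> nat) \<Rightarrow> (nat \<times> nat) list" where
  "graph_of vs f = map (\<lambda>v. (v, f v)) vs"

text \<open>The missing pairs correspond to the vertices of \<open>vs\<close> where the colorings
  differ; outside \<open>vs\<close> both are \<open>undefined\<close>.\<close>

lemma near_graph_of:
  assumes "distinct vs" "f \<in> extensional (set vs)" "g \<in> extensional (set vs)"
  shows "length (filter (\<lambda>a. a \<notin> set (graph_of vs g)) (graph_of vs f)) \<le> 1 \<longleftrightarrow>
    (\<exists>v. \<forall>x. x \<noteq> v \<longrightarrow> f x = g x)"
proof -
  have "filter (\<lambda>a. a \<notin> set (graph_of vs g)) (graph_of vs f) = graph_of (filter (\<lambda>v. f v \<noteq> g v) vs) f"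
    unfolding graph_of_def filter_map by (intro arg_cong[of _ _ "map _"] filter_cong) auto
  then have "length (filter (\<lambda>a. a \<notin> set (graph_of vs g)) (graph_of vs f)) = card {v \<in> set vs. f v \<noteq> g v}"
    using distinct_card[of "filter (\<lambda>v. f v \<noteq> g v) vs"] assms(1) by (simp add: graph_of_def)
  also have "\<dots> \<le> 1 \<longleftrightarrow> (\<forall>v\<in>{v \<in> set vs. f v \<noteq> g v}. \<forall>w\<in>{v \<in> set vs. f v \<noteq> g v}. v = w)"
    using card_le_Suc0_iff_eq[of "{v \<in> set vs. f v \<noteq> g v}"] by simp
  also have "{v \<in> set vs. f v \<noteq> g v} = {v. f v \<noteq> g v}"
    using extensional_arb[OF assms(2)] extensional_arb[OF assms(3)] by metis
  also have "(\<forall>v\<in>{v. f v \<noteq> g v}. \<forall>w\<in>{v. f v \<noteq> g v}. v = w) \<longleftrightarrow> (\<exists>v. \<forall>x. x \<noteq> v \<longrightarrow> f x = g x)"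
    unfolding Ball_def mem_Collect_eq by metis
  finally show ?thesis .
qed

text \<open>Extensional colorings correspond injectively to proper assignment lists, and
  \<open>recol\<close> corresponds to \<open>t_near\<close>. The closure computed on values is
  therefore reachability among colorings.\<close>

lemma den_t_brute_force:
  assumes vs: "set vs \<subseteq> verts G" "distinct vs"
  shows "den t_brute_force [enc_list entry vs] = enc_bool (reach G L f\<^sub>0 f\<^sub>t (set vs))"
proof -
  let ?e = "\<lambda>f. enc_list epair (graph_of vs f)"
  let ?colorings = "colorings G L (set vs)"
  let ?ps = "filter proper (assignments L vs)"
  have ext: "?colorings \<subseteq> extensional (set vs)" by (auto simp: colorings_def PiE_def)
  have inj: "inj_on ?e ?colorings"
  proof (rule inj_onI)
    fix f g assume fg: "f \<in> ?colorings" "g \<in> ?colorings" and "?e f = ?e g"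
    then have "graph_of vs f = graph_of vs g" by (simp only: enc_epair_inject)
    then have "f v = g v" if "v \<in> set vs" for v using that by (simp add: graph_of_def)
    then show "f = g" using fg ext by (intro extensionalityI[of f "set vs" g]) auto
  qed
  have asg: "set (assignments L vs) = {graph_of vs f | f. \<forall>v\<in>set vs. f v \<in> L v}"
    unfolding graph_of_def using vs finite_L by (intro set_assignments) auto
  have prp: "proper (graph_of vs f) \<longleftrightarrow> (\<forall>v\<in>set vs. \<forall>w\<in>set vs. {v, w} \<in> edges G \<longrightarrow> f v \<noteq> f w)" for f
    by (auto simp: proper_def graph_of_def)
  have ps: "set ?ps = graph_of vs ` ?colorings"
  proof (rule set_eqI, rule iffI)
    fix p assume "p \<in> set ?ps"
    then obtain f where f: "p = graph_of vs f" "\<forall>v\<in>set vs. f v \<in> L v" "proper (graph_of vs f)"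
      using asg by auto
    then have "restrict f (set vs) \<in> ?colorings" by (auto simp: colorings_def prp)
    moreover have "p = graph_of vs (restrict f (set vs))" by (simp add: f graph_of_def)
    ultimately show "p \<in> graph_of vs ` ?colorings" by blast
  next
    fix p assume "p \<in> graph_of vs ` ?colorings"
    then obtain f where "p = graph_of vs f" "f \<in> ?colorings" by blast
    then show "p \<in> set ?ps" using asg by (auto simp: colorings_def prp)
  qed
  let ?T = "{(y, x). y \<in> set (map (enc_list epair) ?ps) \<and> x \<in> set (map (enc_list epair) ?ps) \<and>
      den t_near [y, x, Atom] \<noteq> Atom}"
  have mem: "y \<in> set (map (enc_list epair) ?ps) \<longleftrightarrow> (\<exists>f\<in>?colorings. y = ?e f)" for y
    using ps by auto
  have near: "den t_near [?e f, ?e g, Atom] \<noteq> Atom \<longleftrightarrow> (\<exists>v. \<forall>x. x \<noteq> v \<longrightarrow> f x = g x)"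
    if "f \<in> ?colorings" "g \<in> ?colorings" for f g
    using near_graph_of[OF vs(2), of f g] ext that by auto
  have T: "?T = map_prod ?e ?e ` recol G L (set vs)"
  proof (rule set_eqI, rule iffI)
    fix p assume "p \<in> ?T"
    then obtain f g where fg: "f \<in> ?colorings" "g \<in> ?colorings" "p = (?e f, ?e g)" "den t_near [?e f, ?e g, Atom] \<noteq> Atom"
    proof -
      obtain y x where yx: "p = (y, x)" by (cases p)
      with \<open>p \<in> ?T\<close> have "y \<in> set (map (enc_list epair) ?ps)" "x \<in> set (map (enc_list epair) ?ps)"
        "den t_near [y, x, Atom] \<noteq> Atom" by blast+
      then show ?thesis using that yx unfolding mem by blast
    qed
    then have "(f, g) \<in> recol G L (set vs)" using near[OF fg(1,2)] by (auto simp: recol_def)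
    then show "p \<in> map_prod ?e ?e ` recol G L (set vs)" using fg(3) by force
  next
    fix p assume "p \<in> map_prod ?e ?e ` recol G L (set vs)"
    then obtain f g where p: "p = (?e f, ?e g)" and fg: "(f, g) \<in> recol G L (set vs)" by auto
    then have c: "f \<in> ?colorings" "g \<in> ?colorings" by (auto simp: recol_def)
    then have "den t_near [?e f, ?e g, Atom] \<noteq> Atom" using fg near[OF c] by (auto simp: recol_def)
    moreover have "?e f \<in> set (map (enc_list epair) ?ps)" "?e g \<in> set (map (enc_list epair) ?ps)"
      using c mem[of "?e f"] mem[of "?e g"] by blast+
    ultimately show "p \<in> ?T" unfolding p by (intro CollectI case_prodI conjI)
  qed
  let ?f = "restrict f\<^sub>0 (set vs)" and ?g = "restrict f\<^sub>t (set vs)"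
  have fg: "?f \<in> ?colorings" "?g \<in> ?colorings"
    using f colorings_verts[OF G] colorings_restrict[OF _ vs(1)] by blast+
  have tr: "(?e ?f, ?e ?g) \<in> ?T\<^sup>* \<longleftrightarrow> reach G L f\<^sub>0 f\<^sub>t (set vs)"
    unfolding T reach_def
    by (rule rtrancl_map_prod[OF inj _ fg]) (auto simp: recol_def)
  have start: "enc_list (\<lambda>v. Cell (entry v) (enc_nat (f\<^sub>0 v))) vs = ?e ?f"
    "enc_list (\<lambda>v. Cell (entry v) (enc_nat (f\<^sub>t v))) vs = ?e ?g"
    by (auto simp: graph_of_def epair_def intro!: enc_list_cong)
  have labs: "cell_fst (cell_snd (cell_snd (cell_snd (entry v)))) = enc_nat (f\<^sub>0 v)"
    "cell_snd (cell_snd (cell_snd (cell_snd (entry v)))) = enc_nat (f\<^sub>t v)" for v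
    by (auto simp: entry_def lab_def)
  have refl: "den t_near [x, x, Atom] \<noteq> Atom" if "x \<in> set (map (enc_list epair) ?ps)" for x
    using that by auto
  have in_ps: "?e ?f \<in> set (map (enc_list epair) ?ps)" "?e ?g \<in> set (map (enc_list epair) ?ps)"
    using fg mem[of "?e ?f"] mem[of "?e ?g"] by blast+
  have cl: "den (t_close t_near) [enc_list (\<lambda>x. x) (map (enc_list epair) ?ps), ?e ?f, Atom] =
      enc_list (\<lambda>x. x) (filter (\<lambda>x. ?e ?f \<in> set (map (enc_list epair) ?ps) \<and> (?e ?f, x) \<in> ?T\<^sup>*)
        (map (enc_list epair) ?ps))"
    by (rule den_t_close) (rule refl)
  have "den t_brute_force [enc_list entry vs] =
      den t_mem [?e ?g, den (t_close t_near) [enc_list (\<lambda>x. x) (map (enc_list epair) ?ps), ?e ?f, Atom]]"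
    by (simp add: t_brute_force_def t_search_def den_t_assignments labs filter_map o_def start)
  also have "\<dots> = enc_bool (?e ?g \<in> set (filter (\<lambda>x. ?e ?f \<in> set (map (enc_list epair) ?ps) \<and>
      (?e ?f, x) \<in> ?T\<^sup>*) (map (enc_list epair) ?ps)))"
    unfolding cl by (simp only: den_t_mem vlist_enc_list list.map_ident)
  also have "\<dots> = enc_bool (reach G L f\<^sub>0 f\<^sub>t (set vs))"
    using in_ps by (simp only: set_filter mem_Collect_eq tr simp_thms)
  finally show ?thesis .
qed

lemma den_t_main: "den t_main [enc_instance G L f\<^sub>0 f\<^sub>t] = enc_bool (reconfigurable G L f\<^sub>0 f\<^sub>t)"
proof -
  let ?vs = "sorted_list_of_set (verts G)"
  have "finite (verts G)" using G by (simp add: simple_graph_def)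
  then have "good (kernel ?vs)" by (intro kernel_good) auto
  then have "den t_brute_force [enc_list entry (kernel ?vs)] = enc_bool (reconfigurable G L f\<^sub>0 f\<^sub>t)"
    using den_t_brute_force[of "kernel ?vs"] reconfigurable_iff_reachable[OF G f] by (simp add: good_def)
  then show ?thesis by (simp add: t_main_def den_t_kernel enc_instance_eq)
qed

text \<open>A color occurs in the color list of its vertex record and is no larger than the record;
  so a pair is twice the record at most, up to one cell, and the factor 3 pays for the
  cells.\<close>

lemma val_size_assignment:
  "p \<in> set (assignments L vs) \<Longrightarrow> set vs \<subseteq> verts G \<Longrightarrow>
    val_size (enc_list epair p) \<le> 3 * val_size (enc_list entry vs)"
proof (induction vs arbitrary: p)
  case (Cons v vs)
  then obtain c q where c: "c \<in> L v" "q \<in> set (assignments L vs)" "p = (v, c) # q"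
    using finite_L[of v] by auto
  have "enc_nat c \<in> set (vlist (enc_nat_set (L v)))" using c finite_L[of v] Cons.prems by simp
  then have "val_size (enc_nat c) \<le> val_size (enc_nat_set (L v))" by (rule val_size_vlist)
  also have "\<dots> \<le> val_size (entry v)" by (simp add: entry_def lab_def)
  finally have "val_size (enc_nat c) \<le> val_size (entry v)" .
  moreover have "val_size (enc_list epair q) \<le> 3 * val_size (enc_list entry vs)"
    using c Cons by simp
  moreover have "epair (v, c) = Cell (entry v) (enc_nat c)" by (simp add: epair_def)
  ultimately show ?case by (simp add: c(3))
qed simp

lemma assignments_size_le:
  assumes vs: "set vs \<subseteq> verts G" and n: "length vs \<le> n"
  defines "S \<equiv> val_size (enc_list entry vs)"
  shows "assignments_size [enc_list entry vs] \<le> S + (1 + (k + 1) ^ n * (1 + 3 * S))"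
proof -
  have "val_size (den t_assignments [r]) \<le> 1 + (k + 1) ^ n * (1 + 3 * S)"
    if r: "r \<in> tails (enc_list entry vs)" for r
  proof -
    obtain ys zs where ys: "r = enc_list entry ys" "vs = zs @ ys" using tails_enc_list[OF r] by blast
    have sub: "set ys \<subseteq> verts G" using vs ys by auto
    have "val_size (enc_list entry ys) \<le> S" using val_size_tails[OF r] ys by (simp add: S_def)
    then have "val_size (enc_list epair p) \<le> 3 * S" if "p \<in> set (assignments L ys)" for p
      using val_size_assignment[OF that sub] by linarith
    then have size: "val_size (den t_assignments [r]) \<le> 1 + length (assignments L ys) * (1 + 3 * S)"
      unfolding ys(1) den_t_assignments by (rule val_size_enc_list_le)
    have "card (L v) \<le> k" if "v \<in> set ys" for v
      using that sub L C card_mono[OF C(1)] by (meson order_trans subsetD)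
    then have "length (assignments L ys) \<le> k ^ length ys" by (rule length_assignments)
    \<comment> \<open>A positive base allows raising the exponent also for
      \<open>k = 0\<close>.\<close>
    also have "\<dots> \<le> (k + 1) ^ length ys" by (simp add: power_mono)
    also have "\<dots> \<le> (k + 1) ^ n" using n ys by (intro power_increasing) auto
    finally have "length (assignments L ys) * (1 + 3 * S) \<le> (k + 1) ^ n * (1 + 3 * S)"
      by (rule mult_right_mono) simp
    with size show ?thesis by linarith
  qed
  then have "Max ((\<lambda>r. val_size (den t_assignments [r])) ` tails (enc_list entry vs)) \<le>
      1 + (k + 1) ^ n * (1 + 3 * S)"
  proof (intro Max.boundedI)
    show "(\<lambda>r. val_size (den t_assignments [r])) ` tails (enc_list entry vs) \<noteq> {}"
      using tails_self by (metis empty_iff image_is_empty)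
  qed auto
  then show ?thesis by (simp only: assignments_size_def S_def env_size_simps nth_Cons_0)
qed

text \<open>A label consists of a subset of \<open>C\<close> and two colors of \<open>C\<close>,
  whence the number \<open>2 ^ k * k * k\<close>.\<close>

lemma length_kernel:
  assumes "modular_width G \<le> m"
  shows "length (kernel (sorted_list_of_set (verts G))) \<le> kbound (2 ^ k * k * k) (k + m) k"
proof -
  let ?ks = "kernel (sorted_list_of_set (verts G))"
  let ?A = "(\<lambda>(X, x, y). Cell (enc_nat_set X) (Cell (enc_nat x) (enc_nat y))) ` (Pow C \<times> C \<times> C)"
  have "finite (verts G)" using G by (simp add: simple_graph_def)
  then have ks: "good ?ks" "reduced G lab ?ks" by (intro kernel_good; simp)+
  have fC: "f\<^sub>0 v \<in> C" "f\<^sub>t v \<in> C" if "v \<in> verts G" for v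
    using f L that PiE_mem unfolding list_coloring_def by blast+
  have "lab ` set ?ks \<subseteq> ?A"
  proof
    fix l assume "l \<in> lab ` set ?ks"
    then obtain v where "v \<in> verts G" "l = lab v" using ks(1) by (auto simp: good_def)
    then show "l \<in> ?A" using L fC
      by (intro image_eqI[of _ _ "(L v, f\<^sub>0 v, f\<^sub>t v)"]) (auto simp: lab_def)
  qed
  moreover have "card ?A \<le> 2 ^ k * k * k"
  proof -
    have "card ?A \<le> card (Pow C \<times> C \<times> C)" using C by (intro card_image_le) auto
    also have "\<dots> = 2 ^ card C * (card C * card C)" using C by (simp add: card_cartesian_product card_Pow)
    also have "\<dots> \<le> 2 ^ k * (k * k)" using C by (intro mult_le_mono power_increasing) auto
    finally show ?thesis by (simp add: mult.assoc)
  qed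
  moreover have "f\<^sub>0 v \<noteq> f\<^sub>0 w" if "{v, w} \<in> edges G" for v w
    using f that by (auto simp: list_coloring_def)
  moreover have "f\<^sub>0 ` verts G \<subseteq> C" using fC by auto
  ultimately show ?thesis
    using kernel_bound[OF G assms, of ?ks lab ?A _ f\<^sub>0 C k] ks C by (auto simp: good_def)
qed

end

section \<open>Computability of the parameter function\<close>

text \<open>A number in unary is a spine over which a fold can iterate, so arithmetic becomes nested
  loops.\<close>

fun unary :: "nat \<Rightarrow> val" where
  "unary 0 = Atom"
| "unary (Suc m) = Cell Atom (unary m)"

definition ucomp :: "nat \<Rightarrow> (nat list \<Rightarrow> nat) \<Rightarrow> bool" where
  "ucomp n F \<longleftrightarrow> (\<exists>t. wf_tm t n \<and> (\<forall>xs. length xs = n \<longrightarrow> den t (map unary xs) = unary (F xs)))"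

lemma ucomp_var: "i < n \<Longrightarrow> ucomp n (\<lambda>xs. xs ! i)"
  unfolding ucomp_def by (intro exI[of _ "TVar i"]) simp

lemma ucomp_const: "ucomp n (\<lambda>xs. c)"
  unfolding ucomp_def
proof (intro exI conjI allI impI)
  let ?t = "((\<lambda>t. TCell TAtom t) ^^ c) TAtom"
  show "wf_tm ?t n" by (induction c) auto
  fix xs :: "nat list"
  show "den ?t (map unary xs) = unary c" by (induction c) auto
qed

lemma ucomp_compose2:
  assumes "ucomp 2 (\<lambda>ys. h (ys ! 0) (ys ! 1))" "ucomp n A" "ucomp n B"
  shows "ucomp n (\<lambda>xs. h (A xs) (B xs))"
proof -
  obtain t where t: "wf_tm t 2" "\<And>ys. length ys = 2 \<Longrightarrow> den t (map unary ys) = unary (h (ys ! 0) (ys ! 1))"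
    using assms(1) by (auto simp: ucomp_def)
  obtain a b where "wf_tm a n" "wf_tm b n"
    "\<And>xs. length xs = n \<Longrightarrow> den a (map unary xs) = unary (A xs)"
    "\<And>xs. length xs = n \<Longrightarrow> den b (map unary xs) = unary (B xs)"
    using assms(2,3) by (auto simp: ucomp_def)
  then show ?thesis
    unfolding ucomp_def using t t(2)[of "[A xs, B xs]" for xs]
    by (intro exI[of _ "TApp t [a, b]"]) (simp add: numeral_2_eq_2)
qed

lemma fold_val_unary: "fold_val f a (unary m) = (f Atom ^^ m) a"
  by (induction m) auto

text \<open>The fold body sees an element of the spine and the running value; the element is
  \<open>Atom\<close>, that is \<open>unary 0\<close>, which explains the entry 0.\<close>

lemma ucomp_iterate:
  assumes B: "ucomp (n + 2) B" and A: "ucomp n A" and N: "ucomp n N"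
  shows "ucomp n (\<lambda>xs. ((\<lambda>r. B (xs @ [0, r])) ^^ N xs) (A xs))"
proof -
  obtain b where b: "wf_tm b (n + 2)" "\<And>xs. length xs = n + 2 \<Longrightarrow> den b (map unary xs) = unary (B xs)"
    using B by (auto simp: ucomp_def)
  obtain a where a: "wf_tm a n" "\<And>xs. length xs = n \<Longrightarrow> den a (map unary xs) = unary (A xs)"
    using A by (auto simp: ucomp_def)
  obtain c where c: "wf_tm c n" "\<And>xs. length xs = n \<Longrightarrow> den c (map unary xs) = unary (N xs)"
    using N by (auto simp: ucomp_def)
  have "((\<lambda>y. den b (map unary xs @ [Atom, y])) ^^ m) (unary r) = unary (((\<lambda>r. B (xs @ [0, r])) ^^ m) r)"
    if "length xs = n" for xs m r
  proof (induction m)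
    case (Suc m)
    then show ?case using b(2)[of "xs @ [0, ((\<lambda>r. B (xs @ [0, r])) ^^ m) r]"] that by simp
  qed simp
  then show ?thesis
    unfolding ucomp_def using a b(1) c
    by (intro exI[of _ "TFold b a c"]) (simp add: fold_val_unary)
qed

lemma ucomp_Suc:
  assumes "ucomp n A"
  shows "ucomp n (\<lambda>xs. Suc (A xs))"
proof -
  obtain a where "wf_tm a n" "\<And>xs. length xs = n \<Longrightarrow> den a (map unary xs) = unary (A xs)"
    using assms by (auto simp: ucomp_def)
  then show ?thesis unfolding ucomp_def by (intro exI[of _ "TCell TAtom a"]) simp
qed

lemma ucomp_cong: "ucomp n F \<Longrightarrow> (\<And>xs. length xs = n \<Longrightarrow> F xs = H xs) \<Longrightarrow> ucomp n H"
  unfolding ucomp_def by auto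

lemma ucomp_add: "ucomp n A \<Longrightarrow> ucomp n B \<Longrightarrow> ucomp n (\<lambda>xs. A xs + B xs)"
proof (rule ucomp_compose2[where h = "(+)"])
  have "ucomp 2 (\<lambda>xs. ((\<lambda>r. Suc ((xs @ [0, r]) ! 3)) ^^ (xs ! 1)) (xs ! 0))"
    by (rule ucomp_iterate) (auto intro!: ucomp_Suc ucomp_var)
  then show "ucomp 2 (\<lambda>xs. xs ! 0 + xs ! 1)"
  proof (rule ucomp_cong)
    fix xs :: "nat list" assume "length xs = 2"
    then have "(\<lambda>r. Suc ((xs @ [0, r]) ! 3)) = Suc" by (simp add: nth_append fun_eq_iff)
    moreover have "(Suc ^^ b) a = a + b" for a b by (induction b) auto
    ultimately show "((\<lambda>r. Suc ((xs @ [0, r]) ! 3)) ^^ (xs ! 1)) (xs ! 0) = xs ! 0 + xs ! 1" by simp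
  qed
qed

lemma ucomp_mult: "ucomp n A \<Longrightarrow> ucomp n B \<Longrightarrow> ucomp n (\<lambda>xs. A xs * B xs)"
proof (rule ucomp_compose2[where h = "(*)"])
  have "ucomp 2 (\<lambda>xs. ((\<lambda>r. (xs @ [0, r]) ! 0 + (xs @ [0, r]) ! 3) ^^ (xs ! 1)) 0)"
    by (rule ucomp_iterate) (auto intro!: ucomp_add ucomp_var ucomp_const)
  then show "ucomp 2 (\<lambda>xs. xs ! 0 * xs ! 1)"
  proof (rule ucomp_cong)
    fix xs :: "nat list" assume "length xs = 2"
    then have "(\<lambda>r. (xs @ [0, r]) ! 0 + (xs @ [0, r]) ! 3) = (\<lambda>r. xs ! 0 + r)" by (simp add: nth_append fun_eq_iff)
    moreover have "((\<lambda>r. a + r) ^^ b) 0 = a * b" for a b :: nat by (induction b) auto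
    ultimately show "((\<lambda>r. (xs @ [0, r]) ! 0 + (xs @ [0, r]) ! 3) ^^ (xs ! 1)) 0 = xs ! 0 * xs ! 1" by simp
  qed
qed

lemma ucomp_power: "ucomp n A \<Longrightarrow> ucomp n B \<Longrightarrow> ucomp n (\<lambda>xs. A xs ^ B xs)"
proof (rule ucomp_compose2[where h = "(^)"])
  have "ucomp 2 (\<lambda>xs. ((\<lambda>r. (xs @ [0, r]) ! 0 * (xs @ [0, r]) ! 3) ^^ (xs ! 1)) 1)"
    by (rule ucomp_iterate) (auto intro!: ucomp_mult ucomp_var ucomp_const)
  then show "ucomp 2 (\<lambda>xs. xs ! 0 ^ xs ! 1)"
  proof (rule ucomp_cong)
    fix xs :: "nat list" assume "length xs = 2"
    then have "(\<lambda>r. (xs @ [0, r]) ! 0 * (xs @ [0, r]) ! 3) = (\<lambda>r. xs ! 0 * r)" by (simp add: nth_append fun_eq_iff)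
    moreover have "((\<lambda>r. a * r) ^^ b) 1 = a ^ b" for a b :: nat by (induction b) auto
    ultimately show "((\<lambda>r. (xs @ [0, r]) ! 0 * (xs @ [0, r]) ! 3) ^^ (xs ! 1)) 1 = xs ! 0 ^ xs ! 1" by simp
  qed
qed

lemmas ucomp_arith = ucomp_var ucomp_const ucomp_add ucomp_mult ucomp_power

definition kernel_size :: "nat \<Rightarrow> nat \<Rightarrow> nat" where
  "kernel_size k m = kbound (2 ^ k * k * k) (k + m) k"

lemma ucomp_kernel_size: "ucomp 2 (\<lambda>xs. kernel_size (xs ! 0) (xs ! 1))"
proof -
  \<comment> \<open>Positions 0 and 1 hold the parameters, position 2 the dummy element and position
    3 the running value of the iteration that computes \<open>kbound\<close>.\<close>
  let ?B = "\<lambda>ys. cbound (2 ^ (ys ! 0) * ys ! 0 * ys ! 0) ((ys ! 0 + ys ! 1) * ys ! 3 + 1)"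
  have "ucomp (2 + 2) ?B"
    unfolding cbound_def by (intro ucomp_arith) simp_all
  then have "ucomp 2 (\<lambda>xs. ((\<lambda>r. ?B (xs @ [0, r])) ^^ (xs ! 0)) 0)"
    by (rule ucomp_iterate) (auto intro!: ucomp_arith)
  then show ?thesis
  proof (rule ucomp_cong)
    fix xs :: "nat list" assume l: "length xs = 2"
    have "kbound a q c = ((\<lambda>r. cbound a (q * r + 1)) ^^ c) 0" for a q c
      by (induction c) auto
    moreover have "(\<lambda>r. ?B (xs @ [0, r])) =
        (\<lambda>r. cbound (2 ^ (xs ! 0) * xs ! 0 * xs ! 0) ((xs ! 0 + xs ! 1) * r + 1))"
      using l by (simp add: nth_append fun_eq_iff)
    ultimately show "((\<lambda>r. ?B (xs @ [0, r])) ^^ (xs ! 0)) 0 = kernel_size (xs ! 0) (xs ! 1)"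
      by (simp add: kernel_size_def)
  qed
qed

section \<open>Conversion between binary and unary numbers\<close>

definition t_append :: tm where
  "t_append = TFold (TCell (TVar 2) (TVar 3)) (TVar 1) (TVar 0)"

text \<open>Horner's scheme: the least significant bit comes first, so the fold doubles the value of
  the higher bits and then adds the current bit.\<close>

definition t_unary :: tm where
  "t_unary = TFold
     (TIf (TVar 1) (TCell TAtom (TApp t_append [TVar 2, TVar 2])) (TApp t_append [TVar 2, TVar 2]))
     TAtom (TVar 0)"

text \<open>With the least significant bit first, a power of 2 is a run of zeros, each an
  \<open>Atom\<close>, in front of a single one.\<close>

definition t_power2 :: tm where
  "t_power2 = TFold (TCell TAtom (TVar 2)) (TCell TTrue TAtom) (TVar 0)"

lemma den_t_append: "den t_append [unary a, unary b] = unary (a + b)"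
  unfolding t_append_def by (simp add: fold_val_unary, induction a) auto

lemma den_t_unary: "den t_unary [enc_nat a] = unary a"
proof (induction a rule: less_induct)
  case (less a)
  show ?case
  proof (cases "a = 0")
    case True
    then show ?thesis by (simp add: t_unary_def enc_nat.simps[of 0])
  next
    case False
    then have "den t_unary [enc_nat (a div 2)] = unary (a div 2)" by (intro less) auto
    moreover have "den t_unary [enc_nat a] =
        (let r = den t_unary [enc_nat (a div 2)]; s = den t_append [r, r] in if odd a then Cell Atom s else s)"
      using False by (subst enc_nat.simps) (simp add: t_unary_def Let_def cong: if_cong)
    ultimately have "den t_unary [enc_nat a] = (if odd a then Cell Atom (unary (a div 2 + a div 2)) else unary (a div 2 + a div 2))"
      by (simp add: den_t_append Let_def)
    also have "\<dots> = unary (if odd a then Suc (a div 2 + a div 2) else a div 2 + a div 2)" by simp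
    also have "(if odd a then Suc (a div 2 + a div 2) else a div 2 + a div 2) = a"
      by (metis even_two_times_div_two mult_2 odd_two_times_div_two_succ Suc_eq_plus1)
    finally show ?thesis .
  qed
qed

lemma den_t_power2: "den t_power2 [unary m] = enc_nat (2 ^ m)"
proof (induction m)
  case 0
  have "enc_nat 1 = Cell (enc_bool True) Atom"
    by (subst enc_nat.simps) (simp add: enc_nat.simps[of 0])
  then show ?case by (simp add: t_power2_def)
next
  case (Suc m)
  have "enc_nat (2 ^ Suc m) = Cell Atom (enc_nat (2 ^ m))"
    by (subst enc_nat.simps) simp
  with Suc show ?case by (simp add: t_power2_def)
qed

lemma computable2_power2:
  assumes "ucomp 2 (\<lambda>xs. h (xs ! 0) (xs ! 1))"
  shows "computable2 (\<lambda>a b. 2 ^ h a b)"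
proof -
  obtain t where t: "wf_tm t 2" "\<And>xs. length xs = 2 \<Longrightarrow> den t (map unary xs) = unary (h (xs ! 0) (xs ! 1))"
    using assms by (auto simp: ucomp_def)
  let ?t = "TApp t_power2 [TApp t [TApp t_unary [TVar 0], TApp t_unary [TVar 1]]]"
  have "wf_tm ?t 2"
    using t(1) by (simp add: t_power2_def t_unary_def t_append_def TTrue_def numeral_2_eq_2)
  then have "runs (program_of ?t 2) [enc_nat a, enc_nat b] (den ?t [enc_nat a, enc_nat b])
      (cost ?t [enc_nat a, enc_nat b])" for a b
    using runs_program_of[of ?t "[enc_nat a, enc_nat b]"] by (simp add: numeral_2_eq_2)
  moreover have "den ?t [enc_nat a, enc_nat b] = enc_nat (2 ^ h a b)" for a b
    using t(2)[of "[a, b]"] by (simp add: den_t_unary den_t_power2)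
  ultimately show ?thesis unfolding computable2_def by metis
qed

lemma pbd_1E:
  assumes "pbd t 1 W"
  obtains c d where "\<And>x. cost t [x] \<le> (W [x] + 2) ^ c" "\<And>x. val_size (den t [x]) \<le> (W [x] + 2) ^ d"
proof -
  obtain c d where "\<forall>env\<in>{env. length env = 1}. cost t env \<le> (W env + 2) ^ c"
    "\<forall>env\<in>{env. length env = 1}. val_size (den t env) \<le> (W env + 2) ^ d"
    using pbdD(2,3)[OF assms] unfolding poly_bdd_def by blast
  then show ?thesis using that[of c d] by simp
qed

theorem theorem1:
  shows "\<exists>(P :: program) (g :: nat \<Rightarrow> nat \<Rightarrow> nat) (c :: nat). computable2 g \<and>
    (\<forall>(G :: nat graph) (C :: nat set) (L :: nat \<Rightarrow> nat set)
       (f\<^sub>0 :: nat \<Rightarrow> nat) (f\<^sub>t :: nat \<Rightarrow> nat) (k :: nat) (mw :: nat).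
       simple_graph G \<longrightarrow> finite C \<longrightarrow> card C \<le> k \<longrightarrow> (\<forall>v\<in>verts G. L v \<subseteq> C) \<longrightarrow>
       list_coloring G L f\<^sub>0 \<longrightarrow> list_coloring G L f\<^sub>t \<longrightarrow> modular_width G \<le> mw \<longrightarrow>
       (\<exists>t. runs P [enc_instance G L f\<^sub>0 f\<^sub>t] (enc_bool (reconfigurable G L f\<^sub>0 f\<^sub>t)) t \<and>
            t \<le> g k mw * val_size (enc_instance G L f\<^sub>0 f\<^sub>t) ^ c))"
proof -
  obtain c1 c2 where c1: "\<And>x. cost t_kernel [x] \<le> (val_size x + 2) ^ c1"
    and c2: "\<And>x. val_size (den t_kernel [x]) \<le> (val_size x + 2) ^ c2"
    using pbd_1E[OF ptime_t_kernel] by auto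
  obtain c3 where c3: "\<And>x. cost t_brute_force [x] \<le> (assignments_size [x] + 2) ^ c3"
    using pbd_1E[OF pbd_t_brute_force] by metis
  \<comment> \<open>\<open>c1\<close> pays for the kernelization. The search has exponent
    \<open>c3\<close> in a measure that grows like the size of the kernel, itself bounded with
    exponent \<open>c2\<close>.\<close>
  define e where "e = c1 + c2 * c3"
  \<comment> \<open>The 4 covers the cost of the kernelization and the three steps that glue the
    programs together; the inner power is the parameter part of the search cost;
    \<open>3 ^ e\<close> comes from replacing \<open>N + 2\<close> by \<open>3 * N\<close>.\<close>
  define h where "h k m = (4 + (8 * (k + 1) ^ kernel_size k m) ^ c3) * 3 ^ e" for k m
  have "ucomp 2 (\<lambda>xs. h (xs ! 0) (xs ! 1))"
    unfolding h_def using ucomp_kernel_size by (intro ucomp_arith) simp_all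
  then have compile: "computable2 (\<lambda>k m. 2 ^ h k m)" by (rule computable2_power2)
  have wf: "wf_tm t_main 1"
    using pbdD(1)[OF pbd_t_brute_force] pbdD(1)[OF ptime_t_kernel] by (simp add: t_main_def)
  show ?thesis
  proof (rule exI[of _ "program_of t_main 1"], rule exI[of _ "\<lambda>k m. 2 ^ h k m"], rule exI[of _ e],
      intro conjI allI impI, rule compile)
    fix G :: "nat graph" and C :: "nat set" and L :: "nat \<Rightarrow> nat set" and f\<^sub>0 f\<^sub>t :: "nat \<Rightarrow> nat" and k mw :: nat
    assume "simple_graph G" "finite C" "card C \<le> k" "\<forall>v\<in>verts G. L v \<subseteq> C"
      "list_coloring G L f\<^sub>0" "list_coloring G L f\<^sub>t" and mw: "modular_width G \<le> mw"
    then interpret lcr_instance G L f\<^sub>0 f\<^sub>t C k by unfold_locales auto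
    let ?I = "enc_instance G L f\<^sub>0 f\<^sub>t"
    let ?ks = "kernel (sorted_list_of_set (verts G))"
    define N where "N = val_size ?I"
    define S where "S = val_size (enc_list entry ?ks)"
    define K where "K = (k + 1) ^ kernel_size k mw"
    have K: "1 \<le> K" by (simp add: K_def)
    have N: "1 \<le> N" by (simp add: N_def Suc_leI)
    have ks: "den t_kernel [?I] = enc_list entry ?ks" by (simp add: enc_instance_eq den_t_kernel)
    have S: "S \<le> (N + 2) ^ c2" using c2[of ?I] ks by (simp add: S_def N_def)
    have "finite (verts G)" using G by (simp add: simple_graph_def)
    then have "good ?ks" by (intro kernel_good) auto
    then have "assignments_size [enc_list entry ?ks] \<le> S + (1 + K * (1 + 3 * S))"
      unfolding S_def K_def using length_kernel[OF mw]
      by (intro assignments_size_le) (auto simp: good_def kernel_size_def)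
    also have "\<dots> + 2 \<le> 8 * K * (N + 2) ^ c2"
    proof -
      have "1 \<le> (N + 2) ^ c2" by simp
      with S have "4 * S + 4 \<le> 8 * (N + 2) ^ c2" by linarith
      then have "K * (4 * S + 4) \<le> K * (8 * (N + 2) ^ c2)" by (rule mult_left_mono) simp
      moreover have "S \<le> K * S" using K by simp
      moreover have "K * (4 * S + 4) = K * S + K * (1 + 3 * S) + 3 * K" by (simp add: algebra_simps)
      moreover have "K * (8 * (N + 2) ^ c2) = 8 * K * (N + 2) ^ c2" by simp
      ultimately show ?thesis using K by linarith
    qed
    finally have "(assignments_size [enc_list entry ?ks] + 2) ^ c3 \<le> (8 * K * (N + 2) ^ c2) ^ c3"
      by (intro power_mono) simp_all
    with c3[of "enc_list entry ?ks"] have bf: "cost t_brute_force [enc_list entry ?ks] \<le> (8 * K) ^ c3 * (N + 2) ^ (c2 * c3)"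
      by (simp add: power_mult_distrib power_mult)
    have pw: "(N + 2) ^ c1 \<le> (N + 2) ^ e" "(N + 2) ^ (c2 * c3) \<le> (N + 2) ^ e"
      by (rule power_increasing; simp add: e_def)+
    have "cost t_main [?I] = cost t_kernel [?I] + cost t_brute_force [enc_list entry ?ks] + 3"
      by (simp add: t_main_def ks)
    also have "\<dots> \<le> (N + 2) ^ e + (8 * K) ^ c3 * (N + 2) ^ e + 3 * (N + 2) ^ e"
    proof (intro add_mono)
      show "cost t_kernel [?I] \<le> (N + 2) ^ e"
        using c1[of ?I] pw(1) unfolding N_def by (rule order_trans)
      show "cost t_brute_force [enc_list entry ?ks] \<le> (8 * K) ^ c3 * (N + 2) ^ e"
        using bf mult_left_mono[OF pw(2)] by (rule order_trans) simp
    qed simp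
    also have "\<dots> = (4 + (8 * K) ^ c3) * (N + 2) ^ e" by (simp add: algebra_simps)
    also have "\<dots> \<le> (4 + (8 * K) ^ c3) * (3 * N) ^ e"
      using N by (intro mult_left_mono power_mono) auto
    also have "\<dots> = h k mw * N ^ e" by (simp add: h_def K_def power_mult_distrib)
    \<comment> \<open>Passing to a power of 2 only weakens the bound and yields a function whose
      binary value a program can write down.\<close>
    also have "\<dots> \<le> 2 ^ h k mw * N ^ e" by (intro mult_right_mono) (auto simp: less_imp_le)
    finally have "cost t_main [?I] \<le> 2 ^ h k mw * val_size ?I ^ e" by (simp add: N_def)
    moreover have "runs (program_of t_main 1) [?I] (enc_bool (reconfigurable G L f\<^sub>0 f\<^sub>t)) (cost t_main [?I])"
      using runs_program_of[of t_main "[?I]"] wf by (simp add: den_t_main)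
    ultimately show "\<exists>t. runs (program_of t_main 1) [?I] (enc_bool (reconfigurable G L f\<^sub>0 f\<^sub>t)) t \<and>
        t \<le> 2 ^ h k mw * val_size ?I ^ e" by blast
  qed
qed

end
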